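(* Let $(\mathcal Q,d,\mathcal E)$ be as in the context. (A) If $q\in \mathrm{BV}([0,T];\mathcal Q)$ is an energetic solution of $(\mathcal Q,d,\mathcal E)$, then $q$ is also a BV solution if and only if the following additionally holds: for every $t\in \mathrm J_q$ there exist $y^t\in\mathcal A(q(t^-),q(t^+))$ and $\theta^t\in[0,1]$ such that $y^t(\theta^t)=q(t)$, $|\partial_q\mathcal E|(t,y^t(\theta))\ge1$ for all $\theta\in[0,1]$, and $\mathcal E(t,q(t^+))-\mathcal E(t,q(t^-))=-\int_0^1|\partial_q\mathcal E|(t,y^t(\theta))\,|(y^t)'|(\theta)\,\mathrm d\theta$. (B) If $q\in \mathrm{BV}([0,T];\mathcal Q)$ is a BV solution of $(\mathcal Q,d,\mathcal E)$ with $\mathcal G[\mathcal E(t,\cdot)](q(t))\le\max\{1,|\partial_q\mathcal E|(t,q(t))\}$ for all $t\in[0,T]$ and $\mathcal G[\mathcal E(0,\cdot)](q(0))\le1$, then $q$ is also an energetic solution.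
   Context: Setting. $T>0$; $\mathcal Q$ is a finite-dimensional smooth manifold; $\mathcal E\in C^1([0,T]\times\mathcal Q)$ is real-valued, with differential $\mathrm D_q\mathcal E(t,q)\in \mathrm T_q^*\mathcal Q$ in $q$. $\mathcal R_1:\mathrm T\mathcal Q\to[0,\infty)$ is continuous and $\mathcal R_1(q,\cdot)$ is a norm on $\mathrm T_q\mathcal Q$ for every $q$. $\mathcal A(q_0,q_1)$ is the set of $y\in \mathrm{AC}([0,1],\mathcal Q)$ with $y(0)=q_0$, $y(1)=q_1$. The distance $d:\mathcal Q\times\mathcal Q\to[0,\infty)$ is $d(q_0,q_1)=\min\{\int_0^1\mathcal R_1(y(s),y'(s))\,\mathrm ds: y\in\mathcal A(q_0,q_1)\}$, and $(\mathcal Q,d)$ is assumed complete. For an absolutely continuous curve $q$, $|q'|(t):=\mathcal R_1(q(t),q'(t))$. The local slope is $|\partial_q\mathcal E|(t,q):=\sup_{v\in \mathrm T_q\mathcal Q\setminus\{0\}}\frac{\langle \mathrm D_q\mathcal E(t,q),v\rangle}{\mathcal R_1(q,v)}$. The global slope is $\mathcal G[\mathcal E(t,\cdot)](q):=\sup_{\tilde q\ne q}\frac{(\mathcal E(t,q)-\mathcal E(t,\tilde q))^+}{d(q,\tilde q)}$ for $q\in\mathcal Q$. BV functions. $\mathrm{Var}(q,I)=\sup\sum_{j=1}^n d(q(\tau_{j-1}),q(\tau_j))$ over all $n$ and all $\tau_0<\dots<\tau_n$ in $I$; $\mathrm{BV}([0,T];\mathcal Q)$ is the set of everywhere-defined $q:[0,T]\to\mathcal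 Q$ with $\mathrm{Var}(q,[0,T])<\infty$. One-sided limits $q(t^\pm)$ exist, with $q(0^-)=q(0)$, $q(T^+)=q(T)$. $\mathrm C_q=\{t:q(t^-)=q(t)=q(t^+)\}$, $\mathrm J_q=[0,T]\setminus \mathrm C_q$. $V_q(t)=\mathrm{Var}(q,[0,t])$, and $\mu_q$ is the nonnegative Borel measure on $[0,T]$ given by the distributional derivative of $V_q$: $\mu_q([s,t])=V_q(t)-V_q(s)$ for $s\le t$ in $\mathrm C_q$, with atoms $\mu_q(\{t\})=d(q(t^-),q(t))+d(q(t),q(t^+))$ at $t\in \mathrm J_q$. Its diffuse part is $\mu_q^{\mathrm{co}}(A)=\mu_q(A\cap \mathrm C_q)$. Energetic solution: $q:[0,T]\to\mathcal Q$ such that for all $t\in[0,T]$: (S) $\mathcal E(t,q(t))\le\mathcal E(t,\tilde q)+d(q(t),\tilde q)$ for all $\tilde q\in\mathcal Q$; (E) $\mathcal E(t,q(t))+\mathrm{Var}(q,[0,t])=\mathcal E(0,q(0))+\int_0^t\partial_s\mathcal E(s,q(s))\,\mathrm ds$. Slope distance: $S_0(t;q_0,q_1)=\inf\{\int_0^1|\partial_q\mathcal E|(t,y(s))\,|y'|(s)\,\mathrm ds: y\in\mathcal A(q_0,q_1)\}$. For $0\le t_0\le t_1\le T$, $$\Sigma_0(q,[t_0,t_1])=\int_{t_0}^{t_1}|\partial_q\mathcal E|(r,q(r))\,\mu_q^{\mathrm{co}}(\mathrm dr)+S_0(t_0;q(t_0),q(t_0^+))+S_0(t_1;q(t_1^-),q(t_1))+\sum_{t\in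 \mathrm J_q\cap(t_0,t_1)}\big[S_0(t;q(t^-),q(t))+S_0(t;q(t),q(t^+))\big].$$ BV solution: $q\in \mathrm{BV}([0,T];\mathcal Q)$ is a BV solution of $(\mathcal Q,d,\mathcal E)$ if: (i) $\mathcal E(t_1,q(t_1))-\mathcal E(t_0,q(t_0))-\int_{t_0}^{t_1}\partial_t\mathcal E(t,q(t))\,\mathrm dt\le-\Sigma_0(q,[t_0,t_1])$ for $0\le t_0<t_1\le T$; (ii) $|\partial_q\mathcal E|(t,q(t))\le1$ for $t\in[0,T]\setminus \mathrm J_q$; (iii) $|\partial_q\mathcal E|(t,q(t))\ge1$ for $t$ in the support of $\mu_q$; (iv) for every $t\in \mathrm J_q$ there exist $y^t$ and $\theta^t$ with exactly the properties listed in (A) of the claim. *)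

theory Defs
  imports "HOL-Analysis.Analysis"
begin

section \<open>Differentiability classes\<close>

primrec Ck_on :: "nat \<Rightarrow> 'a::euclidean_space set \<Rightarrow> ('a \<Rightarrow> 'b::euclidean_space) \<Rightarrow> bool" where
  "Ck_on 0 S f \<longleftrightarrow> continuous_on S f"
| "Ck_on (Suc k) S f \<longleftrightarrow>
     (\<forall>x\<in>S. f differentiable (at x)) \<and> (\<forall>v. Ck_on k S (\<lambda>x. frechet_derivative f (at x) v))"

definition smooth_on :: "'a::euclidean_space set \<Rightarrow> ('a \<Rightarrow> 'b::euclidean_space) \<Rightarrow> bool" where
  "smooth_on S f \<longleftrightarrow> (\<forall>k. Ck_on k S f)"

text \<open>Unlike \<open>Ck_on 1\<close>, this uses derivatives relative to \<open>S\<close>, because it is applied to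
  sets of the form \<open>{0..T} \<times> W\<close> with \<open>W\<close> open, where the derivative is still unique.\<close>

definition C1_on :: "'a::euclidean_space set \<Rightarrow> ('a \<Rightarrow> 'b::euclidean_space) \<Rightarrow> bool" where
  "C1_on S f \<longleftrightarrow>
     (\<exists>D :: 'a \<Rightarrow> 'a \<Rightarrow>\<^sub>L 'b. continuous_on S D \<and>
        (\<forall>x\<in>S. (f has_derivative blinfun_apply (D x)) (at x within S)))"

text \<open>The classical epsilon-delta notion; the finite families of non-overlapping subintervals are
  divisions of subsets of the interval.\<close>

definition abs_cont_on :: "real \<Rightarrow> real \<Rightarrow> (real \<Rightarrow> 'e::euclidean_space) \<Rightarrow> bool" where
  "abs_cont_on a b f \<longleftrightarrow>
     (\<forall>\<epsilon>>0. \<exists>\<delta>>0. \<forall>\<D> S. \<D> division_of S \<and> S \<subseteq> {a..b} \<and> (\<Sum>K\<in>\<D>. Sup K - Inf K) < \<delta>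
        \<longrightarrow> (\<Sum>K\<in>\<D>. norm (f (Sup K) - f (Inf K))) < \<epsilon>)"

section \<open>Smooth manifolds\<close>

text \<open>A chart is a pair of its domain and its coordinate map. The manifold is the whole type
  \<open>'q\<close>; its dimension is \<open>DIM('e)\<close>.\<close>

type_synonym ('q, 'e) chart = "'q set \<times> ('q \<Rightarrow> 'e)"

text \<open>A tangent vector is represented by the family of its coordinates in all charts of the atlas
  around its base point (and \<open>0\<close> for every other index). The linear structure is pointwise.\<close>

type_synonym ('q, 'e) tvec = "('q, 'e) chart \<Rightarrow> 'e"

abbreviation cdom :: "('q, 'e) chart \<Rightarrow> 'q set" where "cdom \<equiv> fst"
abbreviation cmap :: "('q, 'e) chart \<Rightarrow> 'q \<Rightarrow> 'e" where "cmap \<equiv> snd"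

definition cinv :: "('q, 'e) chart \<Rightarrow> 'e \<Rightarrow> 'q" where
  "cinv c = inv_into (cdom c) (cmap c)"

locale smooth_manifold =
  fixes atlas :: "('q::{t2_space, second_countable_topology}, 'e::euclidean_space) chart set"
  assumes chart_open: "c \<in> atlas \<Longrightarrow> open (cdom c) \<and> open (cmap c ` cdom c)"
    and chart_homeomorphism:
      "c \<in> atlas \<Longrightarrow> homeomorphism (cdom c) (cmap c ` cdom c) (cmap c) (cinv c)"
    and charts_cover: "(\<Union>c\<in>atlas. cdom c) = UNIV"
    and charts_compatible:
      "c \<in> atlas \<Longrightarrow> c' \<in> atlas \<Longrightarrow> smooth_on (cmap c ` (cdom c \<inter> cdom c')) (cmap c' \<circ> cinv c)"
begin

definition charts_at :: "'q \<Rightarrow> ('q, 'e) chart set" where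
  "charts_at p = {c \<in> atlas. p \<in> cdom c}"

definition chart_at :: "'q \<Rightarrow> ('q, 'e) chart" where
  "chart_at p = (SOME c. c \<in> charts_at p)"

definition transition_deriv :: "('q, 'e) chart \<Rightarrow> ('q, 'e) chart \<Rightarrow> 'q \<Rightarrow> 'e \<Rightarrow> 'e" where
  "transition_deriv c c' p = frechet_derivative (cmap c' \<circ> cinv c) (at (cmap c p))"

definition tangent_space :: "'q \<Rightarrow> ('q, 'e) tvec set" where
  "tangent_space p =
     {v. (\<forall>c\<in>charts_at p. \<forall>c'\<in>charts_at p. v c' = transition_deriv c c' p (v c)) \<and>
         (\<forall>c. c \<notin> charts_at p \<longrightarrow> v c = 0)}"

text \<open>The tangent vector at \<open>p\<close> with coordinates \<open>w\<close> in the chart \<open>c\<close>.\<close>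

definition tangent_vector :: "('q, 'e) chart \<Rightarrow> 'q \<Rightarrow> 'e \<Rightarrow> ('q, 'e) tvec" where
  "tangent_vector c p w = (\<lambda>c'. if c' \<in> charts_at p then transition_deriv c c' p w else 0)"

definition AC :: "(real \<Rightarrow> 'q) set" where
  "AC = {y. continuous_on {0..1} y \<and>
            (\<forall>c\<in>atlas. \<forall>a b. 0 \<le> a \<and> a \<le> b \<and> b \<le> 1 \<and> y ` {a..b} \<subseteq> cdom c
               \<longrightarrow> abs_cont_on a b (cmap c \<circ> y))}"

text \<open>\<open>\<A>(q\<^sub>0,q\<^sub>1)\<close>; only the values on \<open>{0..1}\<close> matter.\<close>

definition admissible :: "'q \<Rightarrow> 'q \<Rightarrow> (real \<Rightarrow> 'q) set" where
  "admissible q0 q1 = {y \<in> AC. y 0 = q0 \<and> y 1 = q1}"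

text \<open>Meaningful where the coordinate curve is differentiable, that is, almost everywhere in
  \<open>{0..1}\<close> if \<open>y \<in> AC\<close>; there it does not depend on the chart chosen.\<close>

definition velocity :: "(real \<Rightarrow> 'q) \<Rightarrow> real \<Rightarrow> ('q, 'e) tvec" where
  "velocity y s =
     tangent_vector (chart_at (y s)) (y s)
       (vector_derivative (cmap (chart_at (y s)) \<circ> y) (at s within {0..1}))"

end

section \<open>The dissipation metric\<close>

text \<open>The last assumption expresses continuity of \<open>R1\<close> on the tangent bundle in the
  trivialisations \<open>cdom c \<times> 'e\<close> which define the topology of the bundle.\<close>

locale norm_manifold = smooth_manifold atlas
  for atlas :: "('q::{t2_space, second_countable_topology}, 'e::euclidean_space) chart set" +
  fixes R1 :: "'q \<Rightarrow> ('q, 'e) tvec \<Rightarrow> real"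
  assumes R1_nonneg: "v \<in> tangent_space p \<Longrightarrow> 0 \<le> R1 p v"
    and R1_eq_0_iff: "v \<in> tangent_space p \<Longrightarrow> R1 p v = 0 \<longleftrightarrow> v = (\<lambda>c. 0)"
    and R1_scaleR: "v \<in> tangent_space p \<Longrightarrow> R1 p (\<lambda>c. a *\<^sub>R v c) = \<bar>a\<bar> * R1 p v"
    and R1_triangle:
      "v \<in> tangent_space p \<Longrightarrow> w \<in> tangent_space p \<Longrightarrow> R1 p (\<lambda>c. v c + w c) \<le> R1 p v + R1 p w"
    and R1_continuous:
      "c \<in> atlas \<Longrightarrow> continuous_on (cdom c \<times> UNIV) (\<lambda>(p, w). R1 p (tangent_vector c p w))"
begin

definition speed :: "(real \<Rightarrow> 'q) \<Rightarrow> real \<Rightarrow> real" where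
  "speed y s = R1 (y s) (velocity y s)"

text \<open>An infimum over a nonempty set once \<open>admissible q0 q1 \<noteq> {}\<close>, and a minimum if the metric is
  complete. The integrand is integrable for every \<open>y \<in> AC\<close>; integrating against \<open>lebesgue\<close> makes
  its values on the null set of non-differentiability irrelevant.\<close>

definition dissip_dist :: "'q \<Rightarrow> 'q \<Rightarrow> real" where
  "dissip_dist q0 q1 = (INF y\<in>admissible q0 q1. LINT s:{0..1}|lebesgue. speed y s)"

definition Var :: "(real \<Rightarrow> 'q) \<Rightarrow> real set \<Rightarrow> ennreal" where
  "Var q I =
     (SUP (n, \<tau>)\<in>{(n::nat, \<tau>::nat \<Rightarrow> real). (\<forall>j\<le>n. \<tau> j \<in> I) \<and> (\<forall>j<n. \<tau> j < \<tau> (Suc j))}.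
        \<Sum>j<n. ennreal (dissip_dist (q (\<tau> j)) (q (\<tau> (Suc j)))))"

end

section \<open>Rate-independent systems\<close>

text \<open>Curves on \<open>[0,T]\<close> are functions on \<open>real\<close> of which only the values on \<open>{0..T}\<close> matter.
  The assumption \<open>admissible_nonempty\<close> expresses that the distance is finite.\<close>

locale rate_independent_system = norm_manifold atlas R1
  for atlas :: "('q::{t2_space, second_countable_topology}, 'e::euclidean_space) chart set"
    and R1 :: "'q \<Rightarrow> ('q, 'e) tvec \<Rightarrow> real" +
  fixes T :: real and E :: "real \<Rightarrow> 'q \<Rightarrow> real"
  assumes T_pos: "0 < T"
    and admissible_nonempty: "admissible q0 q1 \<noteq> {}"
    and complete: "Metric_space.mcomplete UNIV dissip_dist"
    and E_C1: "c \<in> atlas \<Longrightarrow> C1_on ({0..T} \<times> cmap c ` cdom c) (\<lambda>(t, x). E t (cinv c x))"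
begin

definition dtE :: "real \<Rightarrow> 'q \<Rightarrow> real" where
  "dtE t p = vector_derivative (\<lambda>s. E s p) (at t within {0..T})"

text \<open>The pairing of the differential of \<open>E t\<close> at \<open>p\<close> with a tangent vector \<open>v\<close> at \<open>p\<close>,
  computed in some chart around \<open>p\<close>.\<close>

definition dqE :: "real \<Rightarrow> 'q \<Rightarrow> ('q, 'e) tvec \<Rightarrow> real" where
  "dqE t p v =
     frechet_derivative (\<lambda>x. E t (cinv (chart_at p) x)) (at (cmap (chart_at p) p)) (v (chart_at p))"

definition slope :: "real \<Rightarrow> 'q \<Rightarrow> real" where
  "slope t p = (SUP v\<in>tangent_space p - {\<lambda>c. 0}. dqE t p v / R1 p v)"

definition global_slope :: "real \<Rightarrow> 'q \<Rightarrow> ereal" where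
  "global_slope t p = (SUP p'\<in>UNIV - {p}. ereal (max 0 (E t p - E t p') / dissip_dist p p'))"

subsection \<open>Functions of bounded variation\<close>

definition BV :: "(real \<Rightarrow> 'q) set" where
  "BV = {q. Var q {0..T} < \<infinity>}"

definition left_lim :: "(real \<Rightarrow> 'q) \<Rightarrow> real \<Rightarrow> 'q" where
  "left_lim q t = (if t = 0 then q 0 else Lim (at_left t) q)"

definition right_lim :: "(real \<Rightarrow> 'q) \<Rightarrow> real \<Rightarrow> 'q" where
  "right_lim q t = (if t = T then q T else Lim (at_right t) q)"

definition cont_set :: "(real \<Rightarrow> 'q) \<Rightarrow> real set" where
  "cont_set q = {t \<in> {0..T}. left_lim q t = q t \<and> q t = right_lim q t}"

definition jump_set :: "(real \<Rightarrow> 'q) \<Rightarrow> real set" where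
  "jump_set q = {0..T} - cont_set q"

definition V :: "(real \<Rightarrow> 'q) \<Rightarrow> real \<Rightarrow> real" where
  "V q t = enn2real (Var q {0..t})"

text \<open>The measure \<open>\<mu>\<^sub>q\<close>. For \<open>q \<in> BV\<close> the jump set is countable, so the prescribed values on
  intervals with endpoints in \<open>cont_set q\<close> and on atoms determine a unique Borel measure
  on \<open>{0..T}\<close>.\<close>

definition var_measure :: "(real \<Rightarrow> 'q) \<Rightarrow> real measure" where
  "var_measure q =
     (THE \<mu>. sets \<mu> = sets (restrict_space borel {0..T}) \<and>
        (\<forall>s\<in>cont_set q. \<forall>t\<in>cont_set q. s \<le> t \<longrightarrow> emeasure \<mu> {s..t} = ennreal (V q t - V q s)) \<and>
        (\<forall>t\<in>jump_set q.
           emeasure \<mu> {t} = ennreal (dissip_dist (left_lim q t) (q t) + dissip_dist (q t) (right_lim q t))))"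

definition diffuse_measure :: "(real \<Rightarrow> 'q) \<Rightarrow> real measure" where
  "diffuse_measure q = density (var_measure q) (indicator (cont_set q))"

definition var_support :: "(real \<Rightarrow> 'q) \<Rightarrow> real set" where
  "var_support q =
     {t \<in> {0..T}. \<forall>U. open U \<and> t \<in> U \<longrightarrow> 0 < emeasure (var_measure q) (U \<inter> {0..T})}"

subsection \<open>Solution concepts\<close>

definition energetic_solution :: "(real \<Rightarrow> 'q) \<Rightarrow> bool" where
  "energetic_solution q \<longleftrightarrow>
     (\<forall>t\<in>{0..T}.
        (\<forall>p. E t (q t) \<le> E t p + dissip_dist (q t) p) \<and>
        ereal (E t (q t)) + enn2ereal (Var q {0..t})
          = ereal (E 0 (q 0) + (LINT s:{0..t}|lebesgue. dtE s (q s))))"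

definition S0 :: "real \<Rightarrow> 'q \<Rightarrow> 'q \<Rightarrow> real" where
  "S0 t q0 q1 = (INF y\<in>admissible q0 q1. LINT s:{0..1}|lebesgue. slope t (y s) * speed y s)"

definition Sigma0 :: "(real \<Rightarrow> 'q) \<Rightarrow> real \<Rightarrow> real \<Rightarrow> ennreal" where
  "Sigma0 q t0 t1 =
     (\<integral>\<^sup>+ r\<in>{t0..t1}. ennreal (slope r (q r)) \<partial>diffuse_measure q)
     + ennreal (S0 t0 (q t0) (right_lim q t0)) + ennreal (S0 t1 (left_lim q t1) (q t1))
     + (\<Sum>\<^sub>\<infinity>t\<in>jump_set q \<inter> {t0<..<t1}.
          ennreal (S0 t (left_lim q t) (q t) + S0 t (q t) (right_lim q t)))"

definition optimal_jump :: "(real \<Rightarrow> 'q) \<Rightarrow> real \<Rightarrow> bool" where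
  "optimal_jump q t \<longleftrightarrow>
     (\<exists>y\<in>admissible (left_lim q t) (right_lim q t). \<exists>\<theta>\<in>{0..1}.
        y \<theta> = q t \<and>
        (\<forall>s\<in>{0..1}. 1 \<le> slope t (y s)) \<and>
        E t (right_lim q t) - E t (left_lim q t)
          = - (LINT s:{0..1}|lebesgue. slope t (y s) * speed y s))"

definition BV_solution :: "(real \<Rightarrow> 'q) \<Rightarrow> bool" where
  "BV_solution q \<longleftrightarrow>
     q \<in> BV \<and>
     (\<forall>t0 t1. 0 \<le> t0 \<and> t0 < t1 \<and> t1 \<le> T \<longrightarrow>
        ereal (E t1 (q t1) - E t0 (q t0) - (LINT t:{t0..t1}|lebesgue. dtE t (q t)))
          \<le> - enn2ereal (Sigma0 q t0 t1)) \<and>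
     (\<forall>t\<in>{0..T} - jump_set q. slope t (q t) \<le> 1) \<and>
     (\<forall>t\<in>var_support q. 1 \<le> slope t (q t)) \<and>
     (\<forall>t\<in>jump_set q. optimal_jump q t)"

end

end

theory Submission
  imports Defs
begin

text \<open>
  Along an absolutely continuous curve the energy is absolutely continuous, with derivative bounded
  by slope times speed; hence \<open>\<bar>E t q1 - E t q0\<bar> \<le> S0 t q0 q1\<close>. The variation
  \<open>V q t1 - V q t0\<close> splits into a diffuse part and jump contributions exactly like \<open>Sigma0\<close>, with
  \<open>slope\<close> replaced by \<open>1\<close> and \<open>S0\<close> by the distance, so both implications amount to comparing the
  two decompositions term by term.

  For an energetic solution, stability gives slope \<open>\<le> 1\<close>, the energy balance makes the energy drop
  at each jump equal to the distance, and an optimal jump curve realises this drop as \<open>S0\<close>;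
  hence \<open>Sigma0\<close> is at most the variation. Where the slope is below \<open>1\<close>, the energy balance forces
  the variation to be locally constant. For a BV solution, slope \<open>\<ge> 1\<close> along the optimal curve
  makes the energy drop at least the distance, whence \<open>Sigma0\<close> is at least the variation;
  stability extends from continuity points to left limits and, across the jump, to all times,
  and stability alone yields the opposite energy inequality.
\<close>

section \<open>Absolutely continuous functions on an interval\<close>

text \<open>Three obstacles shape the development. Absolute continuity of curves is the
  epsilon-delta notion in charts, so differentiability almost everywhere and the fundamental theorem
  are derived for it before lengths can be handled. \<open>var_measure\<close> is a definite
  description and says nothing until existence and uniqueness are shown. The limits in
  \<open>left_lim\<close> are taken in the manifold topology while completeness concerns
  \<open>dissip_dist\<close>, so the two topologies must be identified. Global estimates come from
  local ones by \<open>Bolzano\<close>: a property inherited by concatenation and true of all short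
  intervals around every point holds on the whole interval. It glues charts along a curve and also
  yields the reverse energy inequality: with \<Psi> denoting energy plus variation minus work,
  stability gives \<Psi> a - \<Psi> b \<le> e (b - a) only on short intervals, because the power
  along \<open>q\<close> has to be compared with the power at a frozen state; to the left of a jump
  that state has to be the left limit. Letting e tend to 0 after gluing shows that \<Psi> does not
  decrease.\<close>

lemma division_of_realE:
  fixes D :: "real set set"
  assumes "D division_of S" "K \<in> D"
  obtains u v where "u \<le> v" "K = {u..v}" "Inf K = u" "Sup K = v" "{u..v} \<subseteq> S"
proof -
  obtain u v where K: "K = cbox u v" using division_ofD(4)[OF assms] by blast
  have ne: "K \<noteq> {}" using division_ofD(3)[OF assms] .
  have "K \<subseteq> S" using division_ofD(2)[OF assms] .
  with K ne show ?thesis by (intro that[of u v]) auto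
qed

lemma sum_division_of_eq:
  fixes f :: "real \<Rightarrow> 'b::real_normed_vector"
  assumes "D division_of {a..b}" "a \<le> b"
  shows "(\<Sum>K\<in>D. f (Sup K) - f (Inf K)) = f b - f a"
proof -
  let ?p = "(\<lambda>K. (Inf K, K)) ` D"
  note D = division_ofD[OF assms(1)]
  have *: "Inf K \<in> K" if "K \<in> D" for K
    using that by (rule division_of_realE[OF assms(1)]) auto
  have "?p tagged_division_of {a..b}"
  proof (rule tagged_division_ofI)
    show "finite ?p" using D by auto
    fix x K assume "(x, K) \<in> ?p"
    then have KD: "K \<in> D" and x: "x = Inf K" by auto
    show "x \<in> K" using * KD x by auto
    show "K \<subseteq> {a..b}" using D(2) KD by auto
    show "\<exists>a b. K = cbox a b" using D(4) KD by auto
    fix x' K' assume "(x', K') \<in> ?p" "(x, K) \<noteq> (x', K')"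
    then show "interior K \<inter> interior K' = {}" using D(5)[of K K'] KD x by auto
  next
    have "{K. \<exists>x. (x, K) \<in> ?p} = D" by auto
    then show "\<Union>{K. \<exists>x. (x, K) \<in> ?p} = {a..b}" using D(6) by simp
  qed
  from additive_tagged_division_1[OF assms(2) this, of f]
  show ?thesis by (subst (asm) sum.reindex) (auto simp: inj_on_def)
qed

text \<open>A partial division extends to a division of the whole interval, where the increments
  telescope; monotonicity makes the added terms nonnegative.\<close>

lemma mono_on_sum_division_le:
  fixes f :: "real \<Rightarrow> real"
  assumes "mono_on {a..b} f" "D division_of S" "S \<subseteq> {a..b}" "a \<le> b"
  shows "(\<Sum>K\<in>D. f (Sup K) - f (Inf K)) \<le> f b - f a"
proof -
  have "D division_of \<Union>D" "\<Union>D \<subseteq> cbox a b" using assms by auto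
  then obtain D' where D': "D \<subseteq> D'" "D' division_of cbox a b"
    using partial_division_extend_interval by metis
  then have D2: "D' division_of {a..b}" by simp
  have "(\<Sum>K\<in>D. f (Sup K) - f (Inf K)) \<le> (\<Sum>K\<in>D'. f (Sup K) - f (Inf K))"
  proof (rule sum_mono2)
    show "finite D'" using D2 by auto
    fix K assume "K \<in> D' - D"
    then have "K \<in> D'" by simp
    then show "0 \<le> f (Sup K) - f (Inf K)"
      by (rule division_of_realE[OF D2]) (use assms(1) in \<open>auto simp: mono_on_def\<close>)
  qed (use D' in auto)
  also have "\<dots> = f b - f a" by (rule sum_division_of_eq[OF D2 assms(4)])
  finally show ?thesis .
qed

section \<open>Almost everywhere differentiability of monotone functions\<close>

lemma cball_midpoint_real: "cball ((c + d) / 2) ((d - c) / 2) = {c..d::real}"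
  by (auto simp: cball_eq_atLeastAtMost field_simps)

text \<open>The hypothesis says that \<open>S\<close> fills at most the fraction \<open>c\<close> of
  arbitrarily short intervals around each of its points. A Vitali selection of such intervals inside
  an open superset \<open>G\<close> covers \<open>S\<close>, up to a null set, by sets of total
  measure at most \<open>c\<close> times that of \<open>G\<close>. So the outer measure shrinks by
  the factor \<open>c\<close> and, being finite, is zero.\<close>

lemma negligible_if_small_density:
  fixes S :: "real set"
  assumes c: "0 < c" "c < 1" and bS: "bounded S"
    and dens: "\<And>x e. x \<in> S \<Longrightarrow> 0 < e \<Longrightarrow>
      \<exists>a b U. a \<le> x \<and> x \<le> b \<and> a < b \<and> b - a < e \<and> S \<inter> {a..b} \<subseteq> U \<and> U \<in> lmeasurable \<and>
        measure lebesgue U \<le> c * (b - a)"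
  shows "negligible S"
proof -
  have shrink: "\<exists>U. S \<subseteq> U \<and> U \<in> lmeasurable \<and> measure lebesgue U \<le> c * measure lebesgue G"
    if G: "open G" "S \<subseteq> G" "G \<in> lmeasurable" for G
  proof -
    define K where "K = {(a, b, U). a < b \<and> {a..b} \<subseteq> G \<and> S \<inter> {a..b} \<subseteq> U \<and> U \<in> lmeasurable \<and>
        measure lebesgue U \<le> c * (b - a)}"
    let ?a = "\<lambda>(a, b, U::real set). (a + b) / 2 :: real"
    let ?r = "\<lambda>(a, b, U::real set). (b - a) / 2 :: real"
    obtain C where C: "countable C" "C \<subseteq> K"
      and dis: "pairwise (\<lambda>i j. disjnt (cball (?a i) (?r i)) (cball (?a j) (?r j))) C"
      and neg: "negligible (S - (\<Union>i \<in> C. cball (?a i) (?r i)))"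
    proof (rule Vitali_covering_theorem_cballs[of K ?r S ?a])
      show "0 < ?r i" if "i \<in> K" for i using that by (auto simp: K_def)
      fix x d assume x: "x \<in> S" and d: "0 < (d::real)"
      obtain e where e: "e > 0" "cball x e \<subseteq> G" using G x open_contains_cball by blast
      from dens[OF x, of "min d e"] d e(1) obtain a b U where
        *: "a \<le> x" "x \<le> b" "a < b" "b - a < min d e" "S \<inter> {a..b} \<subseteq> U" "U \<in> lmeasurable"
        "measure lebesgue U \<le> c * (b - a)" by auto
      have "{a..b} \<subseteq> cball x e" using * by (auto simp: dist_real_def)
      then have "(a, b, U) \<in> K" using * e by (auto simp: K_def)
      moreover have "x \<in> cball (?a (a, b, U)) (?r (a, b, U))"
        using * by (simp add: cball_midpoint_real)
      moreover have "?r (a, b, U) < d" using * by auto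
      ultimately show "\<exists>i. i \<in> K \<and> x \<in> cball (?a i) (?r i) \<and> ?r i < d" by blast
    qed
    have ball_eq: "cball (?a i) (?r i) = {fst i..fst (snd i)}" for i
      by (cases i) (simp add: cball_midpoint_real)
    let ?V = "\<Union>i\<in>C. snd (snd i)"
    have meas: "snd (snd i) \<in> lmeasurable" if "i \<in> C" for i using subsetD[OF C(2) that] by (auto simp: K_def)
    have sub: "{fst i..fst (snd i)} \<subseteq> G" "S \<inter> {fst i..fst (snd i)} \<subseteq> snd (snd i)" if "i \<in> C" for i
      using subsetD[OF C(2) that] by (auto simp: K_def)
    have bnd: "measure lebesgue (\<Union>i\<in>I. snd (snd i)) \<le> c * measure lebesgue G"
      if I: "I \<subseteq> C" "finite I" for I
    proof -
      have "measure lebesgue (\<Union>i\<in>I. snd (snd i)) \<le> (\<Sum>i\<in>I. measure lebesgue (snd (snd i)))"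
        by (rule measure_UNION_le) (use I meas in auto)
      also have "\<dots> \<le> (\<Sum>i\<in>I. c * measure lebesgue {fst i..fst (snd i)})"
        by (rule sum_mono) (use I C(2) in \<open>auto simp: K_def\<close>)
      also have "\<dots> = c * (\<Sum>i\<in>I. measure lebesgue {fst i..fst (snd i)})"
        by (simp add: sum_distrib_left)
      also have "(\<Sum>i\<in>I. measure lebesgue {fst i..fst (snd i)})
          = measure lebesgue (\<Union>i\<in>I. {fst i..fst (snd i)})"
      proof (rule measure_UNION'[symmetric])
        show "pairwise (\<lambda>i j. disjnt {fst i..fst (snd i)} {fst j..fst (snd j)}) I"
          using pairwise_subset[OF dis I(1)] unfolding ball_eq .
      qed (use I in auto)
      also have "\<dots> \<le> measure lebesgue G"
      proof (rule measure_mono_fmeasurable)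
        show "(\<Union>i\<in>I. {fst i..fst (snd i)}) \<subseteq> G" using sub(1) I(1) by blast
      qed (use I G in auto)
      finally show ?thesis using c by auto
    qed
    have V: "?V \<in> lmeasurable" "measure lebesgue ?V \<le> c * measure lebesgue G"
      using fmeasurable_UN_bound[OF C(1) meas bnd] measure_UN_bound[OF C(1) meas bnd] by auto
    let ?N = "S - (\<Union>i \<in> C. cball (?a i) (?r i))"
    have "S \<subseteq> ?V \<union> ?N"
    proof
      fix x assume x: "x \<in> S"
      show "x \<in> ?V \<union> ?N"
      proof (cases "x \<in> ?N")
        case False
        then obtain i where i: "i \<in> C" "x \<in> cball (?a i) (?r i)" using x by blast
        then have "x \<in> snd (snd i)" using sub(2)[of i] x unfolding ball_eq by blast
        then show ?thesis using i by auto
      qed auto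
    qed
    moreover have "?V \<union> ?N \<in> lmeasurable"
      by (rule fmeasurable.Un[OF V(1) negligible_imp_measurable[OF neg]])
    moreover have "measure lebesgue (?V \<union> ?N) \<le> c * measure lebesgue G"
      using measure_Un_le[OF fmeasurableD[OF V(1)] negligible_imp_sets[OF neg]] V(2)
        negligible_imp_measure0[OF neg] by linarith
    ultimately show ?thesis by blast
  qed
  \<comment> \<open>\<open>Inf A\<close> is the outer measure of \<open>S\<close>, finite because
    \<open>S\<close> is bounded. If it were positive, \<open>shrink\<close> and a slight enlargement
    to an open set would produce an element of \<open>A\<close> below it.\<close>
  define A where "A = {measure lebesgue G | G. open G \<and> S \<subseteq> G \<and> G \<in> lmeasurable}"
  obtain R where R: "S \<subseteq> ball 0 R"
    using bS bounded_subset_ballD by blast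
  have Ane: "A \<noteq> {}" using R by (auto simp: A_def)
  have Abd: "bdd_below A" by (auto simp: A_def intro!: bdd_belowI[of _ 0])
  have "Inf A \<le> 0"
  proof (rule ccontr)
    assume "\<not> Inf A \<le> 0"
    then have pos: "Inf A > 0" by simp
    then have "Inf A < Inf A / c" using c by (simp add: field_simps)
    then obtain z where "z \<in> A" "z < Inf A / c" using cInf_lessD[OF Ane] by blast
    then obtain G where G: "open G" "S \<subseteq> G" "G \<in> lmeasurable" "measure lebesgue G < Inf A / c"
      by (auto simp: A_def)
    obtain U where U: "S \<subseteq> U" "U \<in> lmeasurable" "measure lebesgue U \<le> c * measure lebesgue G"
      using shrink[OF G(1-3)] by blast
    have less: "measure lebesgue U < Inf A"
      using U(3) G(4) c by (simp add: field_simps)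
    obtain W where W: "open W" "U \<subseteq> W" "W - U \<in> lmeasurable"
      "emeasure lebesgue (W - U) < ennreal (Inf A - measure lebesgue U)"
      using sets_lebesgue_outer_open[of U "Inf A - measure lebesgue U"] U less by auto
    have "W = U \<union> (W - U)" using W by auto
    then have Wm: "W \<in> lmeasurable" using U W by (metis fmeasurable.Un)
    have "measure lebesgue (W - U) < Inf A - measure lebesgue U"
      using W(3,4) less by (metis emeasure_eq_measure2 ennreal_less_iff measure_nonneg)
    moreover have "measure lebesgue W \<le> measure lebesgue U + measure lebesgue (W - U)"
      using measure_Un_le[of U lebesgue "W - U"] U W \<open>W = _\<close> by auto
    ultimately have "measure lebesgue W < Inf A" by simp
    moreover have "measure lebesgue W \<in> A"
      unfolding A_def using W(1,2) U(1) Wm by blast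
    ultimately show False using cInf_lower[OF _ Abd] by force
  qed
  show ?thesis unfolding negligible_outer
  proof safe
    fix e :: real assume "e > 0"
    with \<open>Inf A \<le> 0\<close> obtain z where "z \<in> A" "z < e" using cInf_lessD[OF Ane, of e] by auto
    then show "\<exists>T. S \<subseteq> T \<and> T \<in> lmeasurable \<and> measure lebesgue T < e"
      by (auto simp: A_def)
  qed
qed

text \<open>A Vitali selection of steep secants consists of disjoint intervals on each of which
  \<open>f\<close> rises by more than \<open>v\<close> times the length. Monotonicity bounds the
  total rise by f b - f a and hence the total length.\<close>

lemma mono_on_steep_cover:
  fixes f :: "real \<Rightarrow> real"
  assumes mono: "mono_on {a..b} f" and ab: "a < b" and v: "0 < v"
    and steep: "\<And>z e. z \<in> S \<Longrightarrow> a < z \<Longrightarrow> z < b \<Longrightarrow> 0 < e \<Longrightarrow>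
      \<exists>y. y \<noteq> z \<and> \<bar>y - z\<bar> < e \<and> (f y - f z) / (y - z) > v"
  shows "\<exists>U. S \<inter> {a..b} \<subseteq> U \<and> U \<in> lmeasurable \<and> measure lebesgue U \<le> (f b - f a) / v"
proof -
  define K where "K = {(c, d). c < d \<and> {c..d} \<subseteq> {a..b} \<and> f d - f c > v * (d - c)}"
  let ?a = "\<lambda>(a, b). (a + b) / 2 :: real"
  let ?r = "\<lambda>(a, b). (b - a) / 2 :: real"
  obtain C where C: "countable C" "C \<subseteq> K"
    and dis: "pairwise (\<lambda>i j. disjnt (cball (?a i) (?r i)) (cball (?a j) (?r j))) C"
    and neg: "negligible (S \<inter> {a<..<b} - (\<Union>i \<in> C. cball (?a i) (?r i)))"
  proof (rule Vitali_covering_theorem_cballs[of K ?r "S \<inter> {a<..<b}" ?a])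
    show "0 < ?r i" if "i \<in> K" for i using that by (auto simp: K_def)
    fix z d assume z: "z \<in> S \<inter> {a<..<b}" and d: "0 < (d::real)"
    obtain y where y: "y \<noteq> z" "\<bar>y - z\<bar> < min d (min (z - a) (b - z))" "(f y - f z) / (y - z) > v"
      using steep[of z "min d (min (z - a) (b - z))"] z d by auto
    \<comment> \<open>The steep secant may lie on either side of \<open>z\<close>.\<close>
    let ?i = "(min y z, max y z)"
    have "f (max y z) - f (min y z) > v * (max y z - min y z)"
      using y(1,3) by (cases "y < z") (auto simp: field_simps min_def max_def)
    then have "?i \<in> K" using y by (auto simp: K_def)
    moreover have "z \<in> cball (?a ?i) (?r ?i)" by (simp only: prod.case cball_midpoint_real) auto
    moreover have "?r ?i < d" using y by auto
    ultimately show "\<exists>i. i \<in> K \<and> z \<in> cball (?a i) (?r i) \<and> ?r i < d" by blast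
  qed
  have ball_eq: "cball (?a i) (?r i) = {fst i..snd i}" for i
    by (cases i) (simp add: cball_midpoint_real)
  have lt: "fst i < snd i" "{fst i..snd i} \<subseteq> {a..b}" "f (snd i) - f (fst i) > v * (snd i - fst i)"
    if "i \<in> C" for i using subsetD[OF C(2) that] by (auto simp: K_def)
  let ?V = "\<Union>i\<in>C. {fst i..snd i}"
  have bnd: "measure lebesgue (\<Union>i\<in>I. {fst i..snd i}) \<le> (f b - f a) / v"
    if I: "I \<subseteq> C" "finite I" for I
  proof -
    let ?D = "(\<lambda>i. {fst i..snd i}) ` I"
    have disI: "{fst i..snd i} \<inter> {fst j..snd j} = {}" if "i \<in> I" "j \<in> I" "i \<noteq> j" for i j
      using dis that I(1) unfolding pairwise_def disjnt_def ball_eq by blast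
    have inj: "inj_on (\<lambda>i. {fst i..snd i}) I"
    proof (rule inj_onI, rule ccontr)
      fix i j assume *: "i \<in> I" "j \<in> I" "{fst i..snd i} = {fst j..snd j}" "i \<noteq> j"
      then show False using disI[of i j] lt(1)[of i] I by auto
    qed
    have div: "?D division_of \<Union>?D"
    proof (rule division_ofI)
      fix K assume "K \<in> ?D"
      then obtain i where i: "i \<in> I" "K = {fst i..snd i}" by auto
      show "K \<noteq> {}" using i lt(1)[of i] I by auto
      show "\<exists>a b. K = cbox a b" using i by auto
      fix K' assume "K' \<in> ?D" "K \<noteq> K'"
      then obtain j where j: "j \<in> I" "K' = {fst j..snd j}" by auto
      with i \<open>K \<noteq> K'\<close> have "K \<inter> K' = {}" using disI[of i j] by auto
      then show "interior K \<inter> interior K' = {}" using interior_subset by blast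
    qed (use I in auto)
    have "measure lebesgue (\<Union>i\<in>I. {fst i..snd i}) \<le> (\<Sum>i\<in>I. measure lebesgue {fst i..snd i})"
      by (rule measure_UNION_le) (use I in auto)
    also have "\<dots> \<le> (\<Sum>i\<in>I. (f (snd i) - f (fst i)) / v)"
    proof (rule sum_mono)
      fix i assume "i \<in> I"
      with lt[of i] I v show "measure lebesgue {fst i..snd i} \<le> (f (snd i) - f (fst i)) / v"
        by (auto simp: field_simps)
    qed
    also have "\<dots> = (\<Sum>i\<in>I. f (snd i) - f (fst i)) / v" by (simp add: sum_divide_distrib)
    also have "(\<Sum>i\<in>I. f (snd i) - f (fst i)) = (\<Sum>i\<in>I. f (Sup {fst i..snd i}) - f (Inf {fst i..snd i}))"
      by (rule sum.cong) (use lt(1) I in \<open>auto simp: less_imp_le subset_iff\<close>)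
    also have "\<dots> = (\<Sum>K\<in>?D. f (Sup K) - f (Inf K))"
      by (subst sum.reindex[OF inj]) simp
    also have "\<dots> \<le> f b - f a"
      by (rule mono_on_sum_division_le[OF mono div]) (use lt I ab in force)+
    finally show ?thesis using v by (simp add: divide_right_mono)
  qed
  have meas: "{fst i..snd i} \<in> lmeasurable" for i :: "real \<times> real" by simp
  have V: "?V \<in> lmeasurable" "measure lebesgue ?V \<le> (f b - f a) / v"
    using fmeasurable_UN_bound[OF C(1) meas bnd] measure_UN_bound[OF C(1) meas bnd] by auto
  let ?N = "(S \<inter> {a<..<b} - (\<Union>i \<in> C. cball (?a i) (?r i))) \<union> {a, b}"
  have N: "negligible ?N" by (intro negligible_Un neg negligible_finite) auto
  have "S \<inter> {a..b} \<subseteq> ?V \<union> ?N" unfolding ball_eq by auto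
  moreover have "?V \<union> ?N \<in> lmeasurable"
    by (rule fmeasurable.Un[OF V(1) negligible_imp_measurable[OF N]])
  moreover have "measure lebesgue (?V \<union> ?N) \<le> (f b - f a) / v"
    using measure_Un_le[OF fmeasurableD[OF V(1)] negligible_imp_sets[OF N]] V(2)
      negligible_imp_measure0[OF N] by linarith
  ultimately show ?thesis by blast
qed

text \<open>On the interval between \<open>x\<close> and \<open>y\<close> the points of
  \<open>S\<close> are covered by a set whose measure is at most the rise of \<open>f\<close>
  divided by \<open>v\<close>, hence at most \<open>c\<close> times the length, so \<open>S\<close>
  has small density. Letting \<open>v\<close> depend on \<open>x\<close> also captures points with
  infinite upper derivate.\<close>

lemma mono_on_negligible_steep:
  fixes f :: "real \<Rightarrow> real"
  assumes mono: "mono_on {a..b} f" and c: "0 < c" "c < 1" and S: "S \<subseteq> {a<..<b}"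
    and steep: "\<And>x e. x \<in> S \<Longrightarrow> 0 < e \<Longrightarrow> \<exists>y v. y \<noteq> x \<and> \<bar>y - x\<bar> < e \<and> 0 < v \<and>
        (f y - f x) / (y - x) \<le> c * v \<and>
        (\<forall>z\<in>S. \<forall>e>0. \<exists>y. y \<noteq> z \<and> \<bar>y - z\<bar> < e \<and> (f y - f z) / (y - z) > v)"
  shows "negligible S"
proof (rule negligible_if_small_density[OF c])
  show "bounded S" using bounded_subset[OF bounded_box S[folded box_real(1)]] .
  fix x e :: real assume x: "x \<in> S" and e: "0 < e"
  have xab: "a < x" "x < b" using x S by auto
  obtain y v where y: "y \<noteq> x" "\<bar>y - x\<bar> < min e (min (x - a) (b - x))" "0 < v"
    "(f y - f x) / (y - x) \<le> c * v"
    and st: "\<And>z e. z \<in> S \<Longrightarrow> e > 0 \<Longrightarrow> \<exists>y. y \<noteq> z \<and> \<bar>y - z\<bar> < e \<and> (f y - f z) / (y - z) > v"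
  proof -
    have "0 < min e (min (x - a) (b - x))" using xab e by simp
    from steep[OF x this] show ?thesis by (elim exE conjE) (rule that, blast+)
  qed
  let ?a = "min x y" and ?b = "max x y"
  have 1: "mono_on {?a..?b} f"
    by (rule mono_on_subset[OF mono]) (use y xab in auto)
  have ab': "?a < ?b" using y(1) by linarith
  have "\<exists>U. S \<inter> {?a..?b} \<subseteq> U \<and> U \<in> lmeasurable \<and> measure lebesgue U \<le> (f ?b - f ?a) / v"
    by (rule mono_on_steep_cover[OF 1 ab' y(3)]) (rule st)
  then obtain U where U: "S \<inter> {?a..?b} \<subseteq> U" "U \<in> lmeasurable" "measure lebesgue U \<le> (f ?b - f ?a) / v"
    by blast
  have "(f ?b - f ?a) / v \<le> c * (?b - ?a)"
  proof (cases "x < y")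
    case True
    then have "?a = x" "?b = y" by auto
    with y True show ?thesis by (simp add: field_simps)
  next
    case False
    then have "?a = y" "?b = x" by auto
    with y False show ?thesis by (simp add: field_simps)
  qed
  then have "measure lebesgue U \<le> c * (?b - ?a)" using U(3) by linarith
  moreover have "?a \<le> x" "x \<le> ?b" "?b - ?a < e" using y(2) by linarith+
  ultimately show "\<exists>a b U. a \<le> x \<and> x \<le> b \<and> a < b \<and> b - a < e \<and> S \<inter> {a..b} \<subseteq> U \<and> U \<in> lmeasurable \<and>
        measure lebesgue U \<le> c * (b - a)"
    using U(1,2) ab' by blast
qed

text \<open>If the lower and the upper limit differed, two rationals would fit between them, against
  \<open>osc\<close>. Restricting \<open>osc\<close> to rationals keeps the exceptional sets of the
  application countable in number.\<close>

lemma real_limit_exists: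
  fixes g :: "real \<Rightarrow> real"
  assumes nt: "F \<noteq> bot" and lo: "eventually (\<lambda>x. 0 \<le> g x) F" and hi: "eventually (\<lambda>x. g x \<le> M) F"
    and osc: "\<And>u v. u \<in> \<rat> \<Longrightarrow> v \<in> \<rat> \<Longrightarrow> u < v \<Longrightarrow>
      eventually (\<lambda>x. u \<le> g x) F \<or> eventually (\<lambda>x. g x \<le> v) F"
  shows "\<exists>l. (g \<longlongrightarrow> l) F"
proof -
  let ?g = "\<lambda>x. ereal (g x)"
  have "Limsup F ?g \<le> Liminf F ?g"
  proof (rule ccontr)
    assume "\<not> Limsup F ?g \<le> Liminf F ?g"
    then obtain r where r: "Liminf F ?g < ereal r" "ereal r < Limsup F ?g"
      using ereal_dense2[of "Liminf F ?g" "Limsup F ?g"] by (meson not_le)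
    obtain s where s: "ereal r < ereal s" "ereal s < Limsup F ?g" using ereal_dense2[OF r(2)] by blast
    obtain v where v: "v \<in> \<rat>" "r < v" "v < s" using Rats_dense_in_real[of r s] s by auto
    obtain u where u: "u \<in> \<rat>" "r < u" "u < v" using Rats_dense_in_real[of r v] v by auto
    have *: "ereal v < Limsup F ?g" "Liminf F ?g < ereal u"
      using less_trans[OF _ s(2), of "ereal v"] less_trans[OF r(1), of "ereal u"] u v by simp_all
    from osc[OF u(1) v(1) u(3)] show False
    proof
      assume "eventually (\<lambda>x. u \<le> g x) F"
      then have "ereal u \<le> Liminf F ?g" by (intro Liminf_bounded) (simp add: zero_ereal_def)
      then show False using * by auto
    next
      assume "eventually (\<lambda>x. g x \<le> v) F"
      then have "Limsup F ?g \<le> ereal v" by (intro Limsup_bounded) simp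
      then show False using * by auto
    qed
  qed
  then have eq: "Limsup F ?g = Liminf F ?g" using Liminf_le_Limsup[OF nt] by (auto intro: antisym)
  have "0 \<le> Liminf F ?g" using lo by (intro Liminf_bounded) (simp add: zero_ereal_def)
  moreover have "Limsup F ?g \<le> ereal M" using hi by (intro Limsup_bounded) simp
  ultimately obtain l where l: "Liminf F ?g = ereal l" using eq by (cases "Liminf F ?g") auto
  have "(?g \<longlongrightarrow> ereal l) F" using tendsto_iff_Liminf_eq_Limsup[OF nt, of ?g "ereal l"] eq l by metis
  then show ?thesis unfolding lim_ereal by blast
qed

text \<open>Lebesgue's theorem. The difference quotient fails to converge only if it is unbounded
  above or passes both below \<open>u\<close> and above \<open>v\<close>, for rationals u < v,
  arbitrarily close to the point. Both kinds of points are negligible.\<close>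

lemma mono_on_differentiable_ae:
  fixes f :: "real \<Rightarrow> real"
  assumes mono: "mono_on {a..b} f"
  obtains N where "negligible N" "\<And>x. x \<in> {a<..<b} - N \<Longrightarrow> f differentiable (at x)"
proof -
  define q where "q = (\<lambda>x y. (f y - f x) / (y - x))"
  define P where "P = (\<lambda>v z. \<forall>e>0. \<exists>y. y \<noteq> z \<and> \<bar>y - z\<bar> < e \<and> q z y > v)"
  define E where "E = (\<lambda>(u, v). {x \<in> {a<..<b}. P v x \<and> (\<forall>e>0. \<exists>y. y \<noteq> x \<and> \<bar>y - x\<bar> < e \<and> q x y < u)})"
  define Einf where "Einf = {x \<in> {a<..<b}. \<forall>v. P v x}"
  have qq: "q x y = (f y - f x) / (y - x)" for x y by (simp add: q_def)
  have q0: "0 \<le> q x y" if "x \<in> {a<..<b}" "y \<in> {a<..<b}" for x y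
  proof (cases "x < y")
    case True
    then show ?thesis using mono_onD[OF mono, of x y] that by (auto simp: q_def)
  next
    case False
    then show ?thesis using mono_onD[OF mono, of y x] that by (auto simp: q_def divide_nonpos_nonpos)
  qed
  have qpos: "\<exists>y. y \<noteq> x \<and> \<bar>y - x\<bar> < e \<and> y \<in> {a<..<b}" if "x \<in> {a<..<b}" "e > 0" for x e
    by (rule exI[of _ "x + min (e/2) ((b - x)/2)"]) (use that in \<open>auto simp: min_def field_simps\<close>)
  have "negligible (E (u, v))" if "u < v" for u v
  proof (cases "0 < u")
    case True
    show ?thesis
    proof (rule mono_on_negligible_steep[OF mono, of "u / v"])
      fix x e :: real assume "x \<in> E (u, v)" "e > 0"
      then obtain y where "y \<noteq> x" "\<bar>y - x\<bar> < e" "q x y < u" by (auto simp: E_def)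
      then show "\<exists>y v'. y \<noteq> x \<and> \<bar>y - x\<bar> < e \<and> 0 < v' \<and> (f y - f x) / (y - x) \<le> u / v * v' \<and>
        (\<forall>z\<in>E (u, v). \<forall>e>0. \<exists>y. y \<noteq> z \<and> \<bar>y - z\<bar> < e \<and> (f y - f z) / (y - z) > v')"
        using True that by (intro exI[of _ y] exI[of _ v]) (auto simp: E_def P_def q_def)
    qed (use True that in \<open>auto simp: E_def\<close>)
  next
    case False
    \<comment> \<open>Difference quotients of a monotone function are nonnegative, so none lies
      below \<open>u\<close>.\<close>
    have "E (u, v) = {}"
    proof (rule ccontr)
      assume "E (u, v) \<noteq> {}"
      then obtain x where x: "x \<in> {a<..<b}" and *: "\<And>e. e > 0 \<Longrightarrow> \<exists>y. y \<noteq> x \<and> \<bar>y - x\<bar> < e \<and> q x y < u"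
        unfolding E_def by blast
      from *[of "min (x - a) (b - x)"] x obtain y where "\<bar>y - x\<bar> < min (x - a) (b - x)" "q x y < u" by auto
      then have "y \<in> {a<..<b}" "q x y < u" by (auto simp: abs_less_iff)
      then show False using q0[of x y] x False by linarith
    qed
    then show ?thesis by simp
  qed
  moreover have "negligible Einf"
  proof (rule mono_on_negligible_steep[OF mono, of "1/2"])
    fix x e :: real assume x: "x \<in> Einf" and e: "e > 0"
    then obtain y where y: "y \<noteq> x" "\<bar>y - x\<bar> < e" "y \<in> {a<..<b}" using qpos[of x e] by (auto simp: Einf_def)
    then have "0 \<le> q x y" using q0[of x y] x by (auto simp: Einf_def)
    then show "\<exists>y v'. y \<noteq> x \<and> \<bar>y - x\<bar> < e \<and> 0 < v' \<and> (f y - f x) / (y - x) \<le> 1/2 * v' \<and>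
        (\<forall>z\<in>Einf. \<forall>e>0. \<exists>y. y \<noteq> z \<and> \<bar>y - z\<bar> < e \<and> (f y - f z) / (y - z) > v')"
      \<comment> \<open>The witness for v' is positive and at least twice the quotient at
        \<open>y\<close>; points of \<open>Einf\<close> are steeper than every bound, so it may
        depend on \<open>x\<close>.\<close>
      using y unfolding qq[symmetric] by - (rule exI[of _ y], rule exI[of _ "2 * (q x y + 1)"], auto simp: Einf_def P_def)
  qed (auto simp: Einf_def)
  moreover have "negligible (\<Union>p\<in>(\<rat> \<times> \<rat>) \<inter> {(u, v). u < v}. E p)"
    by (rule negligible_countable_Union) (use calculation(1) in \<open>auto intro!: countable_Int1 countable_SIGMA simp: countable_rat\<close>)
  ultimately have "negligible (Einf \<union> (\<Union>p\<in>(\<rat> \<times> \<rat>) \<inter> {(u, v). u < v}. E p))" (is "negligible ?N")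
    by (intro negligible_Un)
  moreover have "f differentiable (at x)" if x: "x \<in> {a<..<b} - ?N" for x
  proof -
    have ev: "eventually (\<lambda>y. y \<in> {a<..<b}) (at x)"
      using x by (intro eventually_at_in_open') auto
    have Plim: "eventually (\<lambda>y. \<not> R y) (at x)" if "\<not> (\<forall>e>0. \<exists>y. y \<noteq> x \<and> \<bar>y - x\<bar> < e \<and> R y)" for R
      using that unfolding eventually_at by (auto simp: dist_real_def)
    have "\<exists>l. (q x \<longlongrightarrow> l) (at x)"
    proof -
      obtain M where "\<not> P M x" using x by (auto simp: Einf_def)
      then have hi: "eventually (\<lambda>y. q x y \<le> M) (at x)"
        using Plim[of "\<lambda>y. q x y > M"] by (auto simp: P_def not_less)
      have lo: "eventually (\<lambda>y. 0 \<le> q x y) (at x)"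
        using ev by eventually_elim (use q0 x in auto)
      show ?thesis
      proof (rule real_limit_exists[OF _ lo hi])
        fix u v :: real assume uv: "u \<in> \<rat>" "v \<in> \<rat>" "u < v"
        then have "x \<notin> E (u, v)" using x by auto
        then show "eventually (\<lambda>y. u \<le> q x y) (at x) \<or> eventually (\<lambda>y. q x y \<le> v) (at x)"
          using Plim[of "\<lambda>y. q x y > v"] Plim[of "\<lambda>y. q x y < u"] x
          by (auto simp: E_def P_def not_less)
      qed simp
    qed
    then obtain l where "((\<lambda>y. (f y - f x) / (y - x)) \<longlongrightarrow> l) (at x)" by (auto simp: q_def)
    then have "(f has_real_derivative l) (at x)" by (simp add: has_field_derivative_iff)
    then show ?thesis using real_differentiable_def by blast
  qed
  ultimately show ?thesis by (rule that)
qed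

section \<open>Absolute continuity: gluing and bounded variation\<close>

lemma abs_cont_onD:
  assumes "abs_cont_on a b f" "0 < e"
  obtains d where "d > 0" "\<And>D S. D division_of S \<Longrightarrow> S \<subseteq> {a..b} \<Longrightarrow> (\<Sum>K\<in>D. Sup K - Inf K) < d \<Longrightarrow>
     (\<Sum>K\<in>D. norm (f (Sup K) - f (Inf K))) < e"
proof -
  from assms obtain d where "d > 0" and *: "\<forall>D S. D division_of S \<and> S \<subseteq> {a..b} \<and> (\<Sum>K\<in>D. Sup K - Inf K) < d
     \<longrightarrow> (\<Sum>K\<in>D. norm (f (Sup K) - f (Inf K))) < e" unfolding abs_cont_on_def by meson
  show ?thesis by (rule that[OF \<open>d > 0\<close>]) (simp add: *)
qed

lemma abs_cont_on_subset:
  assumes "abs_cont_on a b f" "a \<le> c" "d \<le> b"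
  shows "abs_cont_on c d f"
proof -
  have "{c..d} \<subseteq> {a..b}" using assms by auto
  then show ?thesis using assms(1) unfolding abs_cont_on_def by (meson order_trans)
qed

lemma abs_cont_on_lipschitz_le:
  fixes f :: "real \<Rightarrow> 'a::euclidean_space" and g :: "real \<Rightarrow> 'b::euclidean_space"
  assumes "abs_cont_on a b f" and L: "0 < L"
    and le: "\<And>x y. a \<le> x \<Longrightarrow> x \<le> y \<Longrightarrow> y \<le> b \<Longrightarrow> norm (g y - g x) \<le> L * norm (f y - f x)"
  shows "abs_cont_on a b g"
  unfolding abs_cont_on_def
proof (intro allI impI)
  fix e :: real assume "e > 0"
  then have "e / L > 0" using L by simp
  from abs_cont_onD[OF assms(1) this] obtain d where d: "d > 0"
    "\<And>D S. D division_of S \<Longrightarrow> S \<subseteq> {a..b} \<Longrightarrow> (\<Sum>K\<in>D. Sup K - Inf K) < d \<Longrightarrow>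
     (\<Sum>K\<in>D. norm (f (Sup K) - f (Inf K))) < e / L" by blast
  show "\<exists>d>0. \<forall>D S. D division_of S \<and> S \<subseteq> {a..b} \<and> (\<Sum>K\<in>D. Sup K - Inf K) < d \<longrightarrow>
     (\<Sum>K\<in>D. norm (g (Sup K) - g (Inf K))) < e"
  proof (intro exI conjI allI impI)
    fix D S assume *: "D division_of S \<and> S \<subseteq> {a..b} \<and> (\<Sum>K\<in>D. Sup K - Inf K) < d"
    have "(\<Sum>K\<in>D. norm (g (Sup K) - g (Inf K))) \<le> (\<Sum>K\<in>D. L * norm (f (Sup K) - f (Inf K)))"
    proof (rule sum_mono)
      fix K assume K: "K \<in> D"
      from * have "D division_of S" by blast
      then show "norm (g (Sup K) - g (Inf K)) \<le> L * norm (f (Sup K) - f (Inf K))"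
        using K
      proof (rule division_of_realE)
        fix u v assume uv: "u \<le> v" "Inf K = u" "Sup K = v" "{u..v} \<subseteq> S"
        then have "{u..v} \<subseteq> {a..b}" using * by blast
        then show ?thesis using le[of u v] uv by simp
      qed
    qed
    also have "\<dots> = L * (\<Sum>K\<in>D. norm (f (Sup K) - f (Inf K)))" by (simp add: sum_distrib_left)
    also have "\<dots> < e" using d(2) * L by (metis mult.commute pos_less_divide_eq)
    finally show "(\<Sum>K\<in>D. norm (g (Sup K) - g (Inf K))) < e" .
  qed (rule d)
qed

lemma division_of_singleton_real: "u \<le> v \<Longrightarrow> {{u..v}} division_of {u..v::real}"
  by (metis box_real(2) atLeastatMost_empty_iff division_of_self not_le)

lemma abs_cont_on_small:
  assumes "abs_cont_on a b f" "0 < e"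
  obtains d where "d > 0" "\<And>x y. a \<le> x \<Longrightarrow> x \<le> y \<Longrightarrow> y \<le> b \<Longrightarrow> y - x < d \<Longrightarrow> norm (f y - f x) < e"
proof -
  from abs_cont_onD[OF assms] obtain d where d: "d > 0"
    "\<And>D S. D division_of S \<Longrightarrow> S \<subseteq> {a..b} \<Longrightarrow> (\<Sum>K\<in>D. Sup K - Inf K) < d \<Longrightarrow>
     (\<Sum>K\<in>D. norm (f (Sup K) - f (Inf K))) < e" by blast
  have "norm (f y - f x) < e" if "a \<le> x" "x \<le> y" "y \<le> b" "y - x < d" for x y
    using d(2)[OF division_of_singleton_real[of x y]] that by auto
  then show ?thesis using d(1) that by blast
qed

lemma abs_cont_on_imp_continuous_on:
  assumes "abs_cont_on a b f"
  shows "continuous_on {a..b} f"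
  unfolding continuous_on_iff
proof (intro ballI allI impI)
  fix x e :: real assume x: "x \<in> {a..b}" and e: "e > 0"
  obtain d where d: "d > 0" "\<And>x y. a \<le> x \<Longrightarrow> x \<le> y \<Longrightarrow> y \<le> b \<Longrightarrow> y - x < d \<Longrightarrow> norm (f y - f x) < e"
    using abs_cont_on_small[OF assms e] by blast
  show "\<exists>d>0. \<forall>x'\<in>{a..b}. dist x' x < d \<longrightarrow> dist (f x') (f x) < e"
  proof (intro exI conjI ballI impI)
    fix y assume y: "y \<in> {a..b}" "dist y x < d"
    show "dist (f y) (f x) < e"
      using d(2)[of x y] d(2)[of y x] x y by (cases "x \<le> y") (auto simp: dist_norm norm_minus_commute)
  qed (rule d)
qed

text \<open>\<open>D3\<close> has at most one element because the interiors of the intervals are disjoint.\<close>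

lemma division_of_real_split:
  fixes D :: "real set set" and m :: real
  assumes D: "D division_of S" and S: "S \<subseteq> {a..b}" and m: "a \<le> m" "m \<le> b"
  obtains D1 D2 D3 where "D = D1 \<union> D2 \<union> D3" "D1 \<inter> D2 = {}" "(D1 \<union> D2) \<inter> D3 = {}"
    "D1 division_of \<Union>D1" "\<Union>D1 \<subseteq> {a..m}" "D2 division_of \<Union>D2" "\<Union>D2 \<subseteq> {m..b}"
    "D3 = {} \<or> (\<exists>u v. D3 = {{u..v}} \<and> a \<le> u \<and> u < m \<and> m < v \<and> v \<le> b)"
proof -
  define D1 where "D1 = {K \<in> D. Sup K \<le> m}"
  define D2 where "D2 = {K \<in> D. m < Sup K \<and> m \<le> Inf K}"
  define D3 where "D3 = {K \<in> D. m < Sup K \<and> Inf K < m}"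
  have DU: "D division_of \<Union>D" using D by auto
  have iv: "\<exists>u v. u \<le> v \<and> K = {u..v} \<and> Inf K = u \<and> Sup K = v \<and> a \<le> u \<and> v \<le> b" if "K \<in> D" for K
    using division_of_realE[OF D that] S by (metis atLeastAtMost_iff order_refl subset_iff)
  have "D = D1 \<union> D2 \<union> D3" "D1 \<inter> D2 = {}" "(D1 \<union> D2) \<inter> D3 = {}"
    by (auto simp: D1_def D2_def D3_def)
  moreover have "D1 division_of \<Union>D1" "D2 division_of \<Union>D2"
    by (rule division_of_subset[OF DU], force simp: D1_def D2_def)+
  moreover have "\<Union>D1 \<subseteq> {a..m}"
  proof
    fix x assume "x \<in> \<Union>D1"
    then obtain K where "K \<in> D" "Sup K \<le> m" "x \<in> K" by (auto simp: D1_def)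
    then show "x \<in> {a..m}" using iv[of K] by (smt (verit) atLeastAtMost_iff)
  qed
  moreover have "\<Union>D2 \<subseteq> {m..b}"
  proof
    fix x assume "x \<in> \<Union>D2"
    then obtain K where "K \<in> D" "m \<le> Inf K" "x \<in> K" by (auto simp: D2_def)
    then show "x \<in> {m..b}" using iv[of K] by (smt (verit) atLeastAtMost_iff)
  qed
  moreover have "D3 = {} \<or> (\<exists>u v. D3 = {{u..v}} \<and> a \<le> u \<and> u < m \<and> m < v \<and> v \<le> b)"
  proof (cases "D3 = {}")
    case False
    then obtain K where K: "K \<in> D3" by blast
    then have KD: "K \<in> D" "m < Sup K" "Inf K < m" by (auto simp: D3_def)
    obtain u v where uv: "K = {u..v}" "u \<le> v" "u < m" "m < v" "a \<le> u" "v \<le> b"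
      using iv[OF KD(1)] KD by auto
    have "K' = K" if "K' \<in> D3" for K'
    proof (rule ccontr)
      assume ne: "K' \<noteq> K"
      have K': "K' \<in> D" "m < Sup K'" "Inf K' < m" using that by (auto simp: D3_def)
      obtain u' v' where uv': "K' = {u'..v'}" "u' < m" "m < v'"
        using iv[OF K'(1)] K' by auto
      have "interior K' \<inter> interior K = {}" using division_ofD(5)[OF D K'(1) KD(1) ne] .
      moreover have "m \<in> interior K' \<inter> interior K" using uv uv' by auto
      ultimately show False by blast
    qed
    then have "D3 = {K}" using K by blast
    then show ?thesis using uv by blast
  qed auto
  ultimately show ?thesis using that by blast
qed

text \<open>A division need not respect the cut \<open>m\<close>. The single interval that can
  straddle it is charged to \<open>B3\<close>, so no refinement of the division is required.\<close>

lemma sum_division_real_split_le: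
  fixes g :: "real set \<Rightarrow> real"
  assumes D: "D division_of S" and S: "S \<subseteq> {a..b}" and m: "a \<le> m" "m \<le> b"
    and B1: "\<And>D'. D' \<subseteq> D \<Longrightarrow> D' division_of \<Union>D' \<Longrightarrow> \<Union>D' \<subseteq> {a..m} \<Longrightarrow> sum g D' \<le> B1"
    and B2: "\<And>D'. D' \<subseteq> D \<Longrightarrow> D' division_of \<Union>D' \<Longrightarrow> \<Union>D' \<subseteq> {m..b} \<Longrightarrow> sum g D' \<le> B2"
    and B3: "\<And>u v. {u..v} \<in> D \<Longrightarrow> a \<le> u \<Longrightarrow> u < m \<Longrightarrow> m < v \<Longrightarrow> v \<le> b \<Longrightarrow> g {u..v} \<le> B3"
    and B3': "0 \<le> B3"
  shows "sum g D \<le> B1 + B2 + B3"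
proof -
  obtain D1 D2 D3 where *: "D = D1 \<union> D2 \<union> D3" "D1 \<inter> D2 = {}" "(D1 \<union> D2) \<inter> D3 = {}"
    "D1 division_of \<Union>D1" "\<Union>D1 \<subseteq> {a..m}" "D2 division_of \<Union>D2" "\<Union>D2 \<subseteq> {m..b}"
    "D3 = {} \<or> (\<exists>u v. D3 = {{u..v}} \<and> a \<le> u \<and> u < m \<and> m < v \<and> v \<le> b)"
    using division_of_real_split[OF D S m] by metis
  have fin: "finite D1" "finite D2" "finite D3" using * by auto
  have "sum g D = sum g D1 + sum g D2 + sum g D3"
    unfolding *(1) using fin *(2,3) by (subst sum.union_disjoint; auto)+
  moreover have "sum g D3 \<le> B3" using *(8) B3' B3 *(1) by auto
  moreover have "sum g D1 \<le> B1" by (rule B1) (use * in auto)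
  moreover have "sum g D2 \<le> B2" by (rule B2) (use * in auto)
  ultimately show ?thesis by linarith
qed

lemma abs_cont_on_combine:
  assumes f1: "abs_cont_on a m f" and f2: "abs_cont_on m b f" and m: "a \<le> m" "m \<le> b"
  shows "abs_cont_on a b f"
  unfolding abs_cont_on_def
proof (intro allI impI)
  fix e :: real assume "e > 0"
  \<comment> \<open>One fifth for each side, two for the interval straddling \<open>m\<close>, and
    one left over for the strict inequality.\<close>
  then have e: "e / 5 > 0" by simp
  obtain d1 where d1: "d1 > 0" "\<And>D S. D division_of S \<Longrightarrow> S \<subseteq> {a..m} \<Longrightarrow> (\<Sum>K\<in>D. Sup K - Inf K) < d1 \<Longrightarrow>
     (\<Sum>K\<in>D. norm (f (Sup K) - f (Inf K))) < e / 5" using abs_cont_onD[OF f1 e] by blast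
  obtain d2 where d2: "d2 > 0" "\<And>D S. D division_of S \<Longrightarrow> S \<subseteq> {m..b} \<Longrightarrow> (\<Sum>K\<in>D. Sup K - Inf K) < d2 \<Longrightarrow>
     (\<Sum>K\<in>D. norm (f (Sup K) - f (Inf K))) < e / 5" using abs_cont_onD[OF f2 e] by blast
  obtain d3 where d3: "d3 > 0" "\<And>x y. a \<le> x \<Longrightarrow> x \<le> y \<Longrightarrow> y \<le> m \<Longrightarrow> y - x < d3 \<Longrightarrow> norm (f y - f x) < e / 5"
    using abs_cont_on_small[OF f1 e] by blast
  obtain d4 where d4: "d4 > 0" "\<And>x y. m \<le> x \<Longrightarrow> x \<le> y \<Longrightarrow> y \<le> b \<Longrightarrow> y - x < d4 \<Longrightarrow> norm (f y - f x) < e / 5"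
    using abs_cont_on_small[OF f2 e] by blast
  let ?d = "min (min d1 d2) (min d3 d4)"
  show "\<exists>d>0. \<forall>D S. D division_of S \<and> S \<subseteq> {a..b} \<and> (\<Sum>K\<in>D. Sup K - Inf K) < d \<longrightarrow>
     (\<Sum>K\<in>D. norm (f (Sup K) - f (Inf K))) < e"
  proof (intro exI[of _ ?d] conjI allI impI)
    fix D S assume *: "D division_of S \<and> S \<subseteq> {a..b} \<and> (\<Sum>K\<in>D. Sup K - Inf K) < ?d"
    then have D: "D division_of S" "S \<subseteq> {a..b}" "(\<Sum>K\<in>D. Sup K - Inf K) < ?d" by auto
    have fin: "finite D" using D by auto
    have nn: "0 \<le> Sup K - Inf K" if "K \<in> D" for K
      by (rule division_of_realE[OF D(1) that]) auto
    have sub: "(\<Sum>K\<in>D'. Sup K - Inf K) < ?d" if "D' \<subseteq> D" for D'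
      using sum_mono2[OF fin that, of "\<lambda>K. Sup K - Inf K"] nn D(3) by auto
    have "(\<Sum>K\<in>D. norm (f (Sup K) - f (Inf K))) \<le> e / 5 + e / 5 + (e / 5 + e / 5)"
    proof (rule sum_division_real_split_le[OF D(1,2) m])
      fix D' assume D': "D' \<subseteq> D" "D' division_of \<Union>D'" "\<Union>D' \<subseteq> {a..m}"
      show "(\<Sum>K\<in>D'. norm (f (Sup K) - f (Inf K))) \<le> e / 5"
        using d1(2)[OF D'(2,3)] sub[OF D'(1)] by auto
    next
      fix D' assume D': "D' \<subseteq> D" "D' division_of \<Union>D'" "\<Union>D' \<subseteq> {m..b}"
      show "(\<Sum>K\<in>D'. norm (f (Sup K) - f (Inf K))) \<le> e / 5"
        using d2(2)[OF D'(2,3)] sub[OF D'(1)] by auto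
    next
      fix u v assume uv: "{u..v} \<in> D" "a \<le> u" "u < m" "m < v" "v \<le> b"
      have "v - u < ?d" using sub[of "{{u..v}}"] uv by auto
      then have "norm (f m - f u) < e / 5" "norm (f v - f m) < e / 5"
        using d3(2)[of u m] d4(2)[of m v] uv by auto
      then show "norm (f (Sup {u..v}) - f (Inf {u..v})) \<le> e / 5 + e / 5"
        using norm_triangle_ineq[of "f v - f m" "f m - f u"] uv by auto
    qed (use e in auto)
    then show "(\<Sum>K\<in>D. norm (f (Sup K) - f (Inf K))) < e" using \<open>e > 0\<close> by simp
  qed (use d1(1) d2(1) d3(1) d4(1) in auto)
qed

text \<open>Tolerance 1 in the definition bounds the sums on short intervals by 1. Concatenation
  preserves boundedness because the interval straddling the cut contributes at most twice a bound
  \<open>M\<close> for the norm of \<open>f\<close>.\<close>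

lemma abs_cont_on_bounded_variation:
  assumes f: "abs_cont_on a b f" and ab: "a \<le> b"
  obtains B where "\<And>D S. D division_of S \<Longrightarrow> S \<subseteq> {a..b} \<Longrightarrow> (\<Sum>K\<in>D. norm (f (Sup K) - f (Inf K))) \<le> B"
proof -
  obtain d where d: "d > 0" "\<And>D S. D division_of S \<Longrightarrow> S \<subseteq> {a..b} \<Longrightarrow> (\<Sum>K\<in>D. Sup K - Inf K) < d \<Longrightarrow>
     (\<Sum>K\<in>D. norm (f (Sup K) - f (Inf K))) < 1" using abs_cont_onD[OF f zero_less_one] by blast
  have "compact (f ` {a..b})"
    by (intro compact_continuous_image abs_cont_on_imp_continuous_on f compact_Icc)
  then obtain M where M: "\<And>x. x \<in> {a..b} \<Longrightarrow> norm (f x) \<le> M"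
    using compact_imp_bounded[of "f ` {a..b}"] unfolding bounded_iff by blast
  then have M0: "0 \<le> M" using order_trans[OF norm_ge_zero, of "f a" M] ab by simp
  define Q where "Q u w \<longleftrightarrow> (a \<le> u \<and> w \<le> b \<longrightarrow> (\<exists>B. \<forall>D S. D division_of S \<and> S \<subseteq> {u..w} \<longrightarrow>
      (\<Sum>K\<in>D. norm (f (Sup K) - f (Inf K))) \<le> B))" for u w
  have "Q a b"
  proof (rule Bolzano[OF ab, of Q])
    fix x y z assume trans: "Q x y" "Q y z" "x \<le> y" "y \<le> z"
    show "Q x z" unfolding Q_def
    proof
      assume ax: "a \<le> x \<and> z \<le> b"
      have *: "a \<le> x \<and> y \<le> b" "a \<le> y \<and> z \<le> b" using ax trans(3,4) by auto
      obtain B1 where B1: "\<And>D S. D division_of S \<Longrightarrow> S \<subseteq> {x..y} \<Longrightarrow> (\<Sum>K\<in>D. norm (f (Sup K) - f (Inf K))) \<le> B1"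
        using trans(1)[unfolded Q_def, THEN mp, OF *(1)] by blast
      obtain B2 where B2: "\<And>D S. D division_of S \<Longrightarrow> S \<subseteq> {y..z} \<Longrightarrow> (\<Sum>K\<in>D. norm (f (Sup K) - f (Inf K))) \<le> B2"
        using trans(2)[unfolded Q_def, THEN mp, OF *(2)] by blast
      have "(\<Sum>K\<in>D. norm (f (Sup K) - f (Inf K))) \<le> B1 + B2 + (M + M)"
        if "D division_of S" "S \<subseteq> {x..z}" for D S
      proof (rule sum_division_real_split_le[OF that trans(3,4)])
        fix u v assume "{u..v} \<in> D" "x \<le> u" "u < y" "y < v" "v \<le> z"
        then have "norm (f u) \<le> M" "norm (f v) \<le> M" using M ax by auto
        then show "norm (f (Sup {u..v}) - f (Inf {u..v})) \<le> M + M"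
          using norm_triangle_ineq4[of "f v" "f u"] \<open>u < y\<close> \<open>y < v\<close> by auto
      qed (use B1 B2 M0 in auto)
      then show "\<exists>B. \<forall>D S. D division_of S \<and> S \<subseteq> {x..z} \<longrightarrow> (\<Sum>K\<in>D. norm (f (Sup K) - f (Inf K))) \<le> B"
        by blast
    qed
  next
    fix x assume "a \<le> x" "x \<le> b"
    show "\<exists>d>0. \<forall>u w. u \<le> x \<and> x \<le> w \<and> w - u < d \<longrightarrow> Q u w" unfolding Q_def
    proof (rule exI[of _ d], intro conjI allI impI d(1))
      fix u v assume uv: "u \<le> x \<and> x \<le> v \<and> v - u < d" "a \<le> u \<and> v \<le> b"
      have "(\<Sum>K\<in>D. norm (f (Sup K) - f (Inf K))) \<le> 1" if D: "D division_of S" "S \<subseteq> {u..v}" for D S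
      proof -
        have "(\<Sum>K\<in>D. Sup K - Inf K) \<le> v - u"
          by (rule mono_on_sum_division_le[of u v "\<lambda>x. x", OF _ D]) (use uv in \<open>auto simp: mono_on_def\<close>)
        then show ?thesis using d(2)[OF D(1)] D(2) uv by force
      qed
      then show "\<exists>B. \<forall>D S. D division_of S \<and> S \<subseteq> {u..v} \<longrightarrow> (\<Sum>K\<in>D. norm (f (Sup K) - f (Inf K))) \<le> B"
        by blast
    qed
  qed
  then show ?thesis unfolding Q_def using that by blast
qed

text \<open>Jordan decomposition: \<open>v\<close> is the total variation on {a..x}. Appending
  {x..y} to a division of a part of {a..x} shows that \<open>v\<close> grows at least by the
  absolute increment of \<open>f\<close>, which gives both monotonicity claims.\<close>

lemma abs_cont_on_mono_decomposition:
  fixes f :: "real \<Rightarrow> real"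
  assumes f: "abs_cont_on a b f" and ab: "a \<le> b"
  obtains v where "mono_on {a..b} v" "mono_on {a..b} (\<lambda>x. v x - f x)"
proof -
  obtain B where B: "\<And>D S. D division_of S \<Longrightarrow> S \<subseteq> {a..b} \<Longrightarrow> (\<Sum>K\<in>D. norm (f (Sup K) - f (Inf K))) \<le> B"
    using abs_cont_on_bounded_variation[OF f ab] by blast
  define A where "A x = {(\<Sum>K\<in>D. norm (f (Sup K) - f (Inf K))) | D S. D division_of S \<and> S \<subseteq> {a..x}}" for x
  define v where "v x = Sup (A x)" for x
  have bdd: "bdd_above (A x)" if "x \<le> b" for x
  proof (rule bdd_aboveI[of _ B])
    fix s assume "s \<in> A x"
    then obtain D S where "D division_of S" "S \<subseteq> {a..x}" and s: "s = (\<Sum>K\<in>D. norm (f (Sup K) - f (Inf K)))"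
      unfolding A_def by blast
    moreover from this that have "S \<subseteq> {a..b}" by auto
    ultimately show "s \<le> B" using B by blast
  qed
  have ne: "A x \<noteq> {}" for x
  proof -
    have "0 \<in> A x" unfolding A_def by (rule CollectI, rule exI[of _ "{}"], rule exI[of _ "{}"]) simp
    then show ?thesis by blast
  qed
  have inc: "v x + \<bar>f y - f x\<bar> \<le> v y" if xy: "a \<le> x" "x < y" "y \<le> b" for x y
  proof -
    have "s \<le> v y - \<bar>f y - f x\<bar>" if "s \<in> A x" for s
    proof -
      obtain D S where D: "D division_of S" "S \<subseteq> {a..x}" "s = (\<Sum>K\<in>D. norm (f (Sup K) - f (Inf K)))"
        using \<open>s \<in> A x\<close> unfolding A_def by blast
      have "interior S \<subseteq> interior {a..x}" using D(2) by (rule interior_mono)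
      then have "interior S \<inter> interior {x..y} = {}" by fastforce
      then have 1: "(D \<union> {{x..y}}) division_of (S \<union> {x..y})"
        by (intro division_disjoint_union D(1) division_of_singleton_real) (use xy in auto)
      have nin: "{x..y} \<notin> D"
      proof
        assume "{x..y} \<in> D"
        then have "{x..y} \<subseteq> {a..x}" using D by blast
        then show False using xy by auto
      qed
      have "(\<Sum>K\<in>D \<union> {{x..y}}. norm (f (Sup K) - f (Inf K))) = s + \<bar>f y - f x\<bar>"
        using nin D xy by (subst sum.union_disjoint) auto
      moreover have "S \<union> {x..y} \<subseteq> {a..y}" using D xy by auto
      ultimately have "s + \<bar>f y - f x\<bar> \<in> A y" unfolding A_def using 1 by (metis (mono_tags, lifting) mem_Collect_eq)
      then have "s + \<bar>f y - f x\<bar> \<le> v y" unfolding v_def by (rule cSup_upper[OF _ bdd[OF xy(3)]])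
      then show ?thesis by linarith
    qed
    then have "v x \<le> v y - \<bar>f y - f x\<bar>" unfolding v_def[of x] by (rule cSup_least[OF ne])
    then show ?thesis by simp
  qed
  show ?thesis
  proof (rule that[of v])
    show "mono_on {a..b} v"
      unfolding mono_on_def using inc by (smt (verit) atLeastAtMost_iff)
    show "mono_on {a..b} (\<lambda>x. v x - f x)"
      unfolding mono_on_def using inc by (smt (verit) atLeastAtMost_iff)
  qed
qed

section \<open>Derivatives of absolutely continuous functions and the fundamental theorem\<close>

lemma abs_cont_on_differentiable_ae:
  fixes f :: "real \<Rightarrow> real"
  assumes f: "abs_cont_on a b f" and ab: "a \<le> b"
  obtains N where "negligible N" "\<And>x. x \<in> {a<..<b} - N \<Longrightarrow> f differentiable (at x)"
proof -
  obtain v where v: "mono_on {a..b} v" "mono_on {a..b} (\<lambda>x. v x - f x)"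
    using abs_cont_on_mono_decomposition[OF f ab] by blast
  obtain N1 where N1: "negligible N1" "\<And>x. x \<in> {a<..<b} - N1 \<Longrightarrow> v differentiable (at x)"
    using mono_on_differentiable_ae[OF v(1)] by blast
  obtain N2 where N2: "negligible N2" "\<And>x. x \<in> {a<..<b} - N2 \<Longrightarrow> (\<lambda>x. v x - f x) differentiable (at x)"
    using mono_on_differentiable_ae[OF v(2)] by blast
  have "f differentiable (at x)" if "x \<in> {a<..<b} - (N1 \<union> N2)" for x
    using differentiable_diff[OF N1(2)[of x] N2(2)[of x]] that by auto
  then show ?thesis using N1(1) N2(1) by (intro that[of "N1 \<union> N2"]) auto
qed

text \<open>The gauge treats two kinds of tags. Off the null set it comes from differentiability, so
  each interval errs by at most e' times its length. At tags in the null set, where the integrand is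
  set to 0, it keeps the intervals inside an open set of measure below \<delta>, so absolute
  continuity bounds the total increment over them.\<close>

lemma has_integral_deriv_abs_cont_on:
  fixes f :: "real \<Rightarrow> 'b::euclidean_space"
  assumes f: "abs_cont_on a b f" and ab: "a \<le> b" and N: "negligible N"
    and deriv: "\<And>x. x \<in> {a<..<b} - N \<Longrightarrow> (f has_vector_derivative f' x) (at x)"
  shows "(f' has_integral (f b - f a)) {a..b}"
proof -
  define N' where "N' = N \<union> {a, b}"
  have N': "negligible N'" unfolding N'_def using N by (auto intro: negligible_Un)
  define g where "g x = (if x \<in> N' then 0 else f' x)" for x
  have "(g has_integral (f b - f a)) (cbox a b)"
    unfolding has_integral
  proof (intro allI impI)
    fix e :: real assume e: "e > 0"
    \<comment> \<open>The summand 1 keeps the denominator positive when a = b; the errors e' (b - a)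
      then stay below e / 2.\<close>
    define e' where "e' = e / (2 * (b - a + 1))"
    have e': "e' > 0" using e ab by (simp add: e'_def)
    have "e / 2 > 0" using e by simp
    from abs_cont_onD[OF f this] obtain \<delta> where \<delta>: "\<delta> > 0"
      "\<And>D S. D division_of S \<Longrightarrow> S \<subseteq> {a..b} \<Longrightarrow> (\<Sum>K\<in>D. Sup K - Inf K) < \<delta> \<Longrightarrow>
       (\<Sum>K\<in>D. norm (f (Sup K) - f (Inf K))) < e / 2" by blast
    obtain W where W: "open W" "N' \<subseteq> W" "(W - N') \<in> lmeasurable" "emeasure lebesgue (W - N') < ennreal \<delta>"
      using sets_lebesgue_outer_open[OF negligible_imp_sets[OF N'] \<delta>(1)] by blast
    have WN: "W = N' \<union> (W - N')" using W(2) by blast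
    have Wm: "W \<in> lmeasurable"
      using fmeasurable.Un[OF negligible_imp_measurable[OF N'] W(3)] WN by simp
    have "measure lebesgue (W - N') < \<delta>"
      using W(3,4) \<delta>(1) by (metis emeasure_eq_measure2 ennreal_less_iff measure_nonneg)
    moreover have "measure lebesgue W \<le> measure lebesgue N' + measure lebesgue (W - N')"
      using measure_Un_le[OF negligible_imp_sets[OF N'] fmeasurableD[OF W(3)]] WN by simp
    ultimately have W\<delta>: "measure lebesgue W < \<delta>" using negligible_imp_measure0[OF N'] by linarith
    have "\<exists>r>0. if x \<in> N' then ball x r \<subseteq> W
        else x \<in> {a<..<b} \<longrightarrow> (\<forall>y. \<bar>y - x\<bar> < r \<longrightarrow> norm (f y - f x - (y - x) *\<^sub>R f' x) \<le> e' * \<bar>y - x\<bar>)" for x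
    proof (cases "x \<in> N'")
      case True
      then obtain r where "r > 0" "ball x r \<subseteq> W" using W(1,2) open_contains_ball by blast
      then show ?thesis using True by auto
    next
      case False
      show ?thesis
      proof (cases "x \<in> {a<..<b}")
        case True
        then have "(f has_vector_derivative f' x) (at x)" using deriv False by (auto simp: N'_def)
        then have "(f has_derivative (\<lambda>h. h *\<^sub>R f' x)) (at x)" by (simp add: has_vector_derivative_def)
        then obtain r where "r > 0" "\<And>y. norm (y - x) < r \<Longrightarrow> norm (f y - f x - (y - x) *\<^sub>R f' x) \<le> e' * norm (y - x)"
          unfolding has_derivative_at_alt using e' by blast
        then show ?thesis using False by (intro exI[of _ r]) auto
      next
        case False2: False
        then show ?thesis using False by (intro exI[of _ 1]) auto
      qed
    qed
    then obtain r where r: "\<And>x. r x > 0" "\<And>x. x \<in> N' \<Longrightarrow> ball x (r x) \<subseteq> W"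
      "\<And>x y. x \<notin> N' \<Longrightarrow> x \<in> {a<..<b} \<Longrightarrow> \<bar>y - x\<bar> < r x \<Longrightarrow> norm (f y - f x - (y - x) *\<^sub>R f' x) \<le> e' * \<bar>y - x\<bar>"
      by metis
    show "\<exists>\<gamma>. gauge \<gamma> \<and> (\<forall>D. D tagged_division_of cbox a b \<and> \<gamma> fine D \<longrightarrow>
        norm ((\<Sum>(x, K)\<in>D. measure lborel K *\<^sub>R g x) - (f b - f a)) < e)"
    proof (rule exI[of _ "\<lambda>x. ball x (r x)"], intro conjI allI impI)
      show "gauge (\<lambda>x. ball x (r x))" using r(1) by (intro gauge_ball_dependent) auto
      fix p assume p: "p tagged_division_of cbox a b \<and> (\<lambda>x. ball x (r x)) fine p"
      then have ptag: "p tagged_division_of {a..b}" and fine: "(\<lambda>x. ball x (r x)) fine p" by auto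
      note pD = tagged_division_ofD[OF ptag]
      have pK: "\<exists>u v. K = {u..v} \<and> u \<le> v \<and> u \<le> x \<and> x \<le> v \<and> a \<le> u \<and> v \<le> b \<and> {u..v} \<subseteq> ball x (r x)"
        if xK: "(x, K) \<in> p" for x K
      proof -
        obtain u v where K: "K = cbox u v" using pD(4)[OF xK] by blast
        have "x \<in> K" "K \<subseteq> {a..b}" using pD(2,3)[OF xK] by auto
        moreover have "K \<subseteq> ball x (r x)" using fine xK by (auto simp: fine_def)
        ultimately show ?thesis using K by (intro exI[of _ u] exI[of _ v]) auto
      qed
      let ?h = "\<lambda>(x, K). measure lborel K *\<^sub>R g x - (f (Sup K) - f (Inf K))"
      let ?p1 = "{q \<in> p. fst q \<notin> N'}" and ?p2 = "{q \<in> p. fst q \<in> N'}"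
      have "(\<Sum>(x, K)\<in>p. measure lborel K *\<^sub>R g x) - (f b - f a) = sum ?h p"
        using additive_tagged_division_1[OF ab ptag, of f] by (simp add: sum_subtractf case_prod_unfold)
      also have "\<dots> = sum ?h ?p1 + sum ?h ?p2"
        using pD(1) by (subst sum.union_disjoint[symmetric]) (auto intro: sum.cong)
      finally have "norm ((\<Sum>(x, K)\<in>p. measure lborel K *\<^sub>R g x) - (f b - f a)) \<le> norm (sum ?h ?p1) + norm (sum ?h ?p2)"
        by (simp add: norm_triangle_ineq)
      moreover have "norm (sum ?h ?p1) \<le> e' * (b - a)"
      proof -
        have "norm (sum ?h ?p1) \<le> (\<Sum>(x, K)\<in>?p1. e' * measure lborel K)"
        proof (rule sum_norm_le)
          fix q assume q: "q \<in> ?p1"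
          obtain x K where qe: "q = (x, K)" by (cases q)
          then have xK: "(x, K) \<in> p" "x \<notin> N'" using q by auto
          obtain u v where uv: "K = {u..v}" "u \<le> v" "u \<le> x" "x \<le> v" "a \<le> u" "v \<le> b" "{u..v} \<subseteq> ball x (r x)"
            using pK[OF xK(1)] by blast
          have x: "x \<in> {a<..<b}" using uv xK(2) by (auto simp: N'_def)
          have "u \<in> ball x (r x)" "v \<in> ball x (r x)"
            using subsetD[OF uv(7), of u] subsetD[OF uv(7), of v] uv(2) by auto
          then have "\<bar>u - x\<bar> < r x" "\<bar>v - x\<bar> < r x" by (auto simp: dist_real_def)
          then have "norm (f u - f x - (u - x) *\<^sub>R f' x) \<le> e' * (x - u)"
             "norm (f v - f x - (v - x) *\<^sub>R f' x) \<le> e' * (v - x)"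
            using r(3)[OF xK(2) x, of u] r(3)[OF xK(2) x, of v] uv by auto
          moreover have "(v - u) *\<^sub>R f' x - (f v - f u) = (f u - f x - (u - x) *\<^sub>R f' x) - (f v - f x - (v - x) *\<^sub>R f' x)"
            by (simp add: algebra_simps)
          ultimately have "norm ((v - u) *\<^sub>R f' x - (f v - f u)) \<le> e' * (x - u) + e' * (v - x)"
            by (metis (no_types, opaque_lifting) norm_triangle_le_diff add_mono)
          then show "norm (?h q) \<le> (case q of (x, K) \<Rightarrow> e' * measure lborel K)"
            using uv xK(2) by (simp add: qe g_def algebra_simps)
        qed
        also have "\<dots> \<le> (\<Sum>(x, K)\<in>p. e' * measure lborel K)"
          by (rule sum_mono2) (use pD(1) e' in auto)
        also have "\<dots> = e' * (b - a)"
          using additive_content_tagged_division[of p a b] ptag ab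
          by (simp add: sum_distrib_left[symmetric] case_prod_unfold)
        finally show ?thesis .
      qed
      moreover have "e' * (b - a) < e / 2"
        using e ab by (simp add: e'_def field_simps)
      moreover have "norm (sum ?h ?p2) \<le> e / 2"
      proof -
        have p2: "?p2 tagged_partial_division_of {a..b}"
          using tagged_division_of_def ptag tagged_partial_division_subset[of p "{a..b}" ?p2] by blast
        let ?D = "snd ` ?p2"
        have D: "?D division_of \<Union>?D" using partial_division_of_tagged_division[OF p2] .
        have sub: "\<Union>?D \<subseteq> {a..b}" using pD(3) by force
        have subW: "\<Union>?D \<subseteq> W"
        proof
          fix z assume "z \<in> \<Union>?D"
          then obtain x K where "(x, K) \<in> p" "x \<in> N'" "z \<in> K" by auto
          then show "z \<in> W" using fine r(2) unfolding fine_def by blast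
        qed
        have "(\<Sum>K\<in>?D. Sup K - Inf K) = (\<Sum>K\<in>?D. measure lebesgue K)"
        proof (rule sum.cong)
          fix K assume "K \<in> ?D"
          then show "Sup K - Inf K = measure lebesgue K" by (rule division_of_realE[OF D]) simp
        qed simp
        also have "\<dots> = measure lebesgue (\<Union>?D)" by (rule content_division[OF D])
        also have "\<dots> \<le> measure lebesgue W"
          using lmeasurable_division[OF D] subW Wm by (intro measure_mono_fmeasurable) auto
        finally have less: "(\<Sum>K\<in>?D. norm (f (Sup K) - f (Inf K))) < e / 2"
          using \<delta>(2)[OF D sub] W\<delta> by linarith
        have "norm (sum ?h ?p2) \<le> (\<Sum>q\<in>?p2. norm (f (Sup (snd q)) - f (Inf (snd q))))"
          by (rule sum_norm_le) (auto simp: g_def norm_minus_commute)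
        also have "\<dots> = (\<Sum>K\<in>?D. norm (f (Sup K) - f (Inf K)))"
        \<comment> \<open>Two different tags can share an interval only if it degenerates to a
          point, where the increment vanishes.\<close>
        proof (rule sum.reindex_nontrivial[symmetric, unfolded o_def])
          show "finite ?p2" using pD(1) by auto
          fix q1 q2 assume q: "q1 \<in> ?p2" "q2 \<in> ?p2" "q1 \<noteq> q2" "snd q1 = snd q2"
          obtain x1 x2 K where *: "q1 = (x1, K)" "q2 = (x2, K)" using q(4) by (cases q1, cases q2) auto
          then have "interior K \<inter> interior K = {}" using pD(5)[of x1 K x2 K] q by auto
          moreover obtain u v where "K = {u..v}" "u \<le> v" using pK[of x1 K] q * by blast
          ultimately have "K = {u}" "u = v" by (auto simp: not_less)
          then show "norm (f (Sup (snd q1)) - f (Inf (snd q1))) = 0" using * by simp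
        qed
        finally show ?thesis using less by linarith
      qed
      ultimately show "norm ((\<Sum>(x, K)\<in>p. measure lborel K *\<^sub>R g x) - (f b - f a)) < e" by linarith
    qed
  qed
  then have "(f' has_integral (f b - f a)) (cbox a b)"
    by (rule has_integral_spike[OF N', rotated]) (auto simp: g_def)
  then show ?thesis by simp
qed

text \<open>The derivative exists off the union of the null sets of the finitely many components.
  The integrals of f' over subintervals are increments of \<open>f\<close>, so their bounded
  variation upgrades gauge integrability to absolute integrability.\<close>

theorem abs_cont_on_vector_derivative:
  fixes f :: "real \<Rightarrow> 'b::euclidean_space"
  assumes f: "abs_cont_on a b f" and ab: "a \<le> b"
  obtains N f' where "negligible N" "f' absolutely_integrable_on {a..b}"
    "\<And>x. x \<in> {a<..<b} - N \<Longrightarrow> (f has_vector_derivative f' x) (at x)"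
    "\<And>u v. a \<le> u \<Longrightarrow> u \<le> v \<Longrightarrow> v \<le> b \<Longrightarrow> (f' has_integral (f v - f u)) {u..v}"
proof -
  have "\<exists>N. negligible N \<and> (\<forall>x\<in>{a<..<b} - N. (\<lambda>x. f x \<bullet> i) differentiable (at x))" if "i \<in> Basis" for i
  proof -
    have "abs_cont_on a b (\<lambda>x. f x \<bullet> i)"
      by (rule abs_cont_on_lipschitz_le[OF f zero_less_one])
        (use Basis_le_norm[OF that] in \<open>auto simp: inner_diff_left[symmetric]\<close>)
    then show ?thesis using abs_cont_on_differentiable_ae[OF _ ab] by metis
  qed
  then obtain N where N: "\<And>i. i \<in> Basis \<Longrightarrow> negligible (N i)"
    "\<And>i x. i \<in> Basis \<Longrightarrow> x \<in> {a<..<b} - N i \<Longrightarrow> (\<lambda>x. f x \<bullet> i) differentiable (at x)" by metis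
  let ?N = "\<Union>i\<in>Basis. N i"
  define f' where "f' x = vector_derivative f (at x)" for x
  have N0: "negligible ?N" using N(1) by (intro negligible_Union) auto
  have der: "(f has_vector_derivative f' x) (at x)" if "x \<in> {a<..<b} - ?N" for x
  proof -
    have "f differentiable (at x)"
      using N(2) that by (subst differentiable_componentwise_within) auto
    then show ?thesis unfolding f'_def by (simp add: vector_derivative_works)
  qed
  have int: "(f' has_integral (f v - f u)) {u..v}" if "a \<le> u" "u \<le> v" "v \<le> b" for u v
    by (rule has_integral_deriv_abs_cont_on[OF abs_cont_on_subset[OF f that(1,3)] that(2) N0])
      (use der that in auto)
  obtain B where B: "\<And>D S. D division_of S \<Longrightarrow> S \<subseteq> {a..b} \<Longrightarrow> (\<Sum>K\<in>D. norm (f (Sup K) - f (Inf K))) \<le> B"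
    using abs_cont_on_bounded_variation[OF f ab] by blast
  have "f' absolutely_integrable_on cbox a b"
  proof (rule bounded_variation_absolutely_integrable_interval)
    show "f' integrable_on cbox a b" using int[of a b] ab by (auto intro: has_integral_integrable)
    fix D assume D: "D division_of cbox a b"
    have "(\<Sum>K\<in>D. norm (integral K f')) = (\<Sum>K\<in>D. norm (f (Sup K) - f (Inf K)))"
    proof (rule sum.cong)
      fix K assume K: "K \<in> D"
      show "norm (integral K f') = norm (f (Sup K) - f (Inf K))"
        by (rule division_of_realE[OF D K]) (use int in \<open>auto intro!: arg_cong[of _ _ norm] integral_unique\<close>)
    qed simp
    also have "\<dots> \<le> B" using B[OF D] by simp
    finally show "(\<Sum>K\<in>D. norm (integral K f')) \<le> B" .
  qed
  then show ?thesis using that[OF N0 _ der int] by simp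
qed

section \<open>Affine reparametrisation and locally Lipschitz composition\<close>

lemma abs_cont_on_affine:
  fixes f :: "real \<Rightarrow> 'b::euclidean_space"
  assumes f: "abs_cont_on a b f" and c: "c \<noteq> 0"
    and img: "\<And>s. a' \<le> s \<Longrightarrow> s \<le> b' \<Longrightarrow> a \<le> c * s + e \<and> c * s + e \<le> b"
  shows "abs_cont_on a' b' (\<lambda>s. f (c * s + e))"
  unfolding abs_cont_on_def
proof (intro allI impI)
  fix \<epsilon> :: real assume "\<epsilon> > 0"
  from abs_cont_onD[OF f this] obtain d where d: "d > 0"
    "\<And>D S. D division_of S \<Longrightarrow> S \<subseteq> {a..b} \<Longrightarrow> (\<Sum>K\<in>D. Sup K - Inf K) < d \<Longrightarrow>
     (\<Sum>K\<in>D. norm (f (Sup K) - f (Inf K))) < \<epsilon>" by blast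
  define \<phi> where "\<phi> s = c * s + e" for s
  have inj: "inj \<phi>" using c by (auto simp: inj_def \<phi>_def)
  have im: "\<phi> ` {u..v} = {min (\<phi> u) (\<phi> v)..max (\<phi> u) (\<phi> v)}" if "u \<le> v" for u v
  proof (cases "c > 0")
    case True
    then have "\<phi> u \<le> \<phi> v" using that by (simp add: \<phi>_def)
    moreover have "\<phi> ` {u..v} = {\<phi> u..\<phi> v}"
      using image_affinity_atLeastAtMost[of c e u v] that True unfolding \<phi>_def by (simp add: algebra_simps)
    ultimately show ?thesis by simp
  next
    case False
    then have "\<phi> v \<le> \<phi> u" using that by (simp add: \<phi>_def mult_left_mono_neg)
    moreover have "\<phi> ` {u..v} = {\<phi> v..\<phi> u}"
      using image_affinity_atLeastAtMost[of c e u v] that False unfolding \<phi>_def by (simp add: algebra_simps)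
    ultimately show ?thesis by simp
  qed
  have int: "interior (\<phi> ` K) \<subseteq> \<phi> ` interior K" if "K = {u..v}" "u \<le> v" for K u v
  proof
    fix x assume x: "x \<in> interior (\<phi> ` K)"
    define z where "z = (x - e) / c"
    have xz: "x = \<phi> z" using c by (simp add: z_def \<phi>_def)
    have "min (\<phi> u) (\<phi> v) < \<phi> z" "\<phi> z < max (\<phi> u) (\<phi> v)"
      using x that im[OF that(2)] xz by auto
    then have "u < z \<and> z < v"
      using that(2) c by (cases "c > 0") (auto simp: \<phi>_def min_def max_def split: if_splits)
    then show "x \<in> \<phi> ` interior K" using xz that by auto
  qed
  show "\<exists>d>0. \<forall>D S. D division_of S \<and> S \<subseteq> {a'..b'} \<and> (\<Sum>K\<in>D. Sup K - Inf K) < d \<longrightarrow>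
     (\<Sum>K\<in>D. norm (f (c * Sup K + e) - f (c * Inf K + e))) < \<epsilon>"
  proof (rule exI[of _ "d / \<bar>c\<bar>"], intro conjI allI impI)
    fix D S assume *: "D division_of S \<and> S \<subseteq> {a'..b'} \<and> (\<Sum>K\<in>D. Sup K - Inf K) < d / \<bar>c\<bar>"
    then have D: "D division_of S" and S: "S \<subseteq> {a'..b'}" by auto
    let ?D = "(`) \<phi> ` D"
    have iv: "\<exists>u v. u \<le> v \<and> K = {u..v}" if "K \<in> D" for K
      by (rule division_of_realE[OF D that]) blast
    have D': "?D division_of \<Union>?D"
    proof (rule division_ofI)
      show "finite ?D" using D by auto
      fix K assume "K \<in> ?D"
      then obtain L where L: "L \<in> D" "K = \<phi> ` L" by auto
      show "K \<noteq> {}" using L D by auto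
      show "\<exists>a b. K = cbox a b" using iv[OF L(1)] im L(2) by (metis box_real(2))
      fix K' assume K': "K' \<in> ?D" "K \<noteq> K'"
      then obtain L' where L': "L' \<in> D" "K' = \<phi> ` L'" by auto
      then have "L \<noteq> L'" using K' L by auto
      then have "interior L \<inter> interior L' = {}" using division_ofD(5)[OF D L(1) L'(1)] by blast
      then have "\<phi> ` interior L \<inter> \<phi> ` interior L' = {}" using inj by (auto simp: inj_def)
      moreover have "interior K \<subseteq> \<phi> ` interior L" "interior K' \<subseteq> \<phi> ` interior L'"
        using iv[OF L(1)] iv[OF L'(1)] int L(2) L'(2) by blast+
      ultimately show "interior K \<inter> interior K' = {}" by blast
    qed auto
    have "\<Union>?D = \<phi> ` S" unfolding division_ofD(6)[OF D, symmetric] by blast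
    then have S': "\<Union>?D \<subseteq> {a..b}" using S img by (auto simp: \<phi>_def)
    have injD: "inj_on ((`) \<phi>) D" using inj by (simp add: inj_on_def inj_image_eq_iff)
    have SI: "Sup (\<phi> ` K) - Inf (\<phi> ` K) = \<bar>c\<bar> * (Sup K - Inf K)"
      "norm (f (Sup (\<phi> ` K)) - f (Inf (\<phi> ` K))) = norm (f (\<phi> (Sup K)) - f (\<phi> (Inf K)))"
      if KD: "K \<in> D" for K
    proof -
      obtain u v where uv: "u \<le> v" "K = {u..v}" using iv[OF KD] by blast
      show "Sup (\<phi> ` K) - Inf (\<phi> ` K) = \<bar>c\<bar> * (Sup K - Inf K)"
      proof (cases "c > 0")
        case True
        then have "\<phi> u \<le> \<phi> v" using uv by (simp add: \<phi>_def)
        then show ?thesis using True uv im[OF uv(1)] by (simp add: \<phi>_def algebra_simps)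
      next
        case False
        then have "\<phi> v \<le> \<phi> u" using uv by (simp add: \<phi>_def mult_left_mono_neg)
        then show ?thesis using False uv im[OF uv(1)] by (simp add: \<phi>_def algebra_simps)
      qed
      show "norm (f (Sup (\<phi> ` K)) - f (Inf (\<phi> ` K))) = norm (f (\<phi> (Sup K)) - f (\<phi> (Inf K)))"
        using uv im[OF uv(1)] by (cases "\<phi> u \<le> \<phi> v") (auto simp: norm_minus_commute)
    qed
    have "(\<Sum>K\<in>?D. Sup K - Inf K) = (\<Sum>K\<in>D. Sup (\<phi> ` K) - Inf (\<phi> ` K))"
      by (rule sum.reindex[OF injD, unfolded o_def])
    also have "\<dots> = \<bar>c\<bar> * (\<Sum>K\<in>D. Sup K - Inf K)"
      unfolding sum_distrib_left by (rule sum.cong[OF refl SI(1)])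
    also have "\<dots> < d" using * c by (simp add: field_simps)
    finally have "(\<Sum>K\<in>?D. norm (f (Sup K) - f (Inf K))) < \<epsilon>" by (rule d(2)[OF D' S'])
    moreover have "(\<Sum>K\<in>?D. norm (f (Sup K) - f (Inf K))) = (\<Sum>K\<in>D. norm (f (Sup (\<phi> ` K)) - f (Inf (\<phi> ` K))))"
      by (rule sum.reindex[OF injD, unfolded o_def])
    moreover have "\<dots> = (\<Sum>K\<in>D. norm (f (\<phi> (Sup K)) - f (\<phi> (Inf K))))"
      by (rule sum.cong[OF refl SI(2)])
    ultimately show "(\<Sum>K\<in>D. norm (f (c * Sup K + e) - f (c * Inf K + e))) < \<epsilon>"
      by (simp add: \<phi>_def)
  qed (use d c in auto)
qed

text \<open>In the applications the outer maps are chart transitions and the energy in a chart.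
  These are C1 on open sets, so Lipschitz constants are available only near each point, and the
  local pieces are glued by \<open>Bolzano\<close>.\<close>

lemma abs_cont_on_compose_local_lipschitz:
  fixes x :: "real \<Rightarrow> 'a::euclidean_space" and g :: "'a \<Rightarrow> 'b::euclidean_space"
  assumes x: "abs_cont_on a b x" and ab: "a \<le> b"
    and lip: "\<And>s. a \<le> s \<Longrightarrow> s \<le> b \<Longrightarrow>
      \<exists>r>0. \<exists>L. \<forall>y\<in>ball (x s) r. \<forall>z\<in>ball (x s) r. norm (g y - g z) \<le> L * norm (y - z)"
  shows "abs_cont_on a b (g \<circ> x)"
proof -
  define Q where "Q u w \<longleftrightarrow> (a \<le> u \<and> w \<le> b \<longrightarrow> abs_cont_on u w (g \<circ> x))" for u w
  have "Q a b"
  proof (rule Bolzano[OF ab, of Q])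
    fix u v w assume "Q u v" "Q v w" "u \<le> v" "v \<le> w"
    then show "Q u w" unfolding Q_def using abs_cont_on_combine[of u v "g \<circ> x" w] by auto
  next
    fix s assume s: "a \<le> s" "s \<le> b"
    obtain r L where r: "r > 0" and L: "\<And>y z. y \<in> ball (x s) r \<Longrightarrow> z \<in> ball (x s) r \<Longrightarrow> norm (g y - g z) \<le> L * norm (y - z)"
      using lip[OF s] by blast
    obtain d where d: "d > 0" "\<And>t. t \<in> {a..b} \<Longrightarrow> dist t s < d \<Longrightarrow> dist (x t) (x s) < r"
      using abs_cont_on_imp_continuous_on[OF x, unfolded continuous_on_iff] s r by (metis atLeastAtMost_iff)
    show "\<exists>d>0. \<forall>u w. u \<le> s \<and> s \<le> w \<and> w - u < d \<longrightarrow> Q u w"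
    proof (rule exI[of _ d], intro conjI allI impI d(1))
      fix u w assume uw: "u \<le> s \<and> s \<le> w \<and> w - u < d"
      show "Q u w" unfolding Q_def
      proof
        assume ab': "a \<le> u \<and> w \<le> b"
        have near: "x t \<in> ball (x s) r" if "u \<le> t" "t \<le> w" for t
          using d(2)[of t] that uw ab' by (auto simp: dist_commute dist_real_def)
        show "abs_cont_on u w (g \<circ> x)"
        proof (rule abs_cont_on_lipschitz_le[OF abs_cont_on_subset[OF x], of u w "max L 1"])
          fix p q assume "u \<le> p" "p \<le> q" "q \<le> w"
          then have "norm ((g \<circ> x) q - (g \<circ> x) p) \<le> L * norm (x q - x p)" using L near by auto
          also have "\<dots> \<le> max L 1 * norm (x q - x p)" by (intro mult_right_mono) auto
          finally show "norm ((g \<circ> x) q - (g \<circ> x) p) \<le> max L 1 * norm (x q - x p)" .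
        qed (use ab' in auto)
      qed
    qed
  qed
  then show ?thesis by (simp add: Q_def)
qed

lemma C1_imp_local_lipschitz:
  fixes g :: "'a::euclidean_space \<Rightarrow> 'b::euclidean_space"
  assumes U: "open U" "p \<in> U"
    and der: "\<And>x. x \<in> U \<Longrightarrow> (g has_derivative g' x) (at x)"
    and cont: "\<And>v. continuous_on U (\<lambda>x. g' x v)"
  shows "\<exists>r>0. \<exists>L. \<forall>y\<in>ball p r. \<forall>z\<in>ball p r. norm (g y - g z) \<le> L * norm (y - z)"
proof -
  \<comment> \<open>The hypotheses give continuity of the derivative only in each fixed direction.
    Summing over the basis yields a continuous bound for the operator norm.\<close>
  define h where "h x = (\<Sum>i\<in>Basis. norm (g' x i))" for x
  have "continuous_on U h" unfolding h_def by (intro continuous_intros cont)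
  then have "isCont h p" using U continuous_on_eq_continuous_at by blast
  then obtain r1 where r1: "r1 > 0" "\<And>x. dist x p < r1 \<Longrightarrow> dist (h x) (h p) < 1"
    unfolding continuous_at_eps_delta by (metis zero_less_one)
  obtain r2 where r2: "r2 > 0" "ball p r2 \<subseteq> U" using U open_contains_ball by blast
  let ?r = "min r1 r2"
  have "norm (g y - g z) \<le> (h p + 1) * norm (y - z)" if yz: "y \<in> ball p ?r" "z \<in> ball p ?r" for y z
  proof (rule differentiable_bound[OF convex_ball _ _ yz])
    fix x assume x: "x \<in> ball p ?r"
    then have xU: "x \<in> U" using r2 by auto
    show "(g has_derivative g' x) (at x within ball p ?r)" using der[OF xU] has_derivative_at_withinI by blast
    interpret bounded_linear "g' x" using der[OF xU] by (rule has_derivative_bounded_linear)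
    have hx: "h x \<le> h p + 1" using r1(2)[of x] x by (auto simp: dist_real_def dist_commute)
    show "onorm (g' x) \<le> h p + 1"
    proof (rule onorm_le)
      fix v
      have "g' x v = (\<Sum>i\<in>Basis. (v \<bullet> i) *\<^sub>R g' x i)"
        by (subst euclidean_representation[of v, symmetric]) (simp add: sum scaleR)
      then have "norm (g' x v) \<le> (\<Sum>i\<in>Basis. norm ((v \<bullet> i) *\<^sub>R g' x i))" by (metis norm_sum)
      also have "\<dots> \<le> (\<Sum>i\<in>Basis. norm v * norm (g' x i))"
        by (rule sum_mono) (simp add: Basis_le_norm mult_right_mono)
      also have "\<dots> = h x * norm v" by (simp add: h_def sum_distrib_left[symmetric] mult.commute)
      also have "\<dots> \<le> (h p + 1) * norm v" using hx by (simp add: mult_right_mono)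
      finally show "norm (g' x v) \<le> (h p + 1) * norm v" .
    qed
  qed
  then show ?thesis using r1(1) r2(1) by (intro exI[of _ ?r] conjI exI[of _ "h p + 1"]) auto
qed

section \<open>Charts and velocities\<close>

context smooth_manifold begin

section \<open>Chart maps and coordinates of tangent vectors\<close>

lemma cinv_cmap: "c \<in> atlas \<Longrightarrow> p \<in> cdom c \<Longrightarrow> cinv c (cmap c p) = p"
  using chart_homeomorphism unfolding homeomorphism_def by blast

lemma cmap_cinv: "c \<in> atlas \<Longrightarrow> x \<in> cmap c ` cdom c \<Longrightarrow> cmap c (cinv c x) = x"
  using chart_homeomorphism unfolding homeomorphism_def by blast

lemma cinv_in_cdom: "c \<in> atlas \<Longrightarrow> x \<in> cmap c ` cdom c \<Longrightarrow> cinv c x \<in> cdom c"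
  using cinv_cmap by fastforce

lemma continuous_on_cmap: "c \<in> atlas \<Longrightarrow> continuous_on (cdom c) (cmap c)"
  using chart_homeomorphism unfolding homeomorphism_def by blast

lemma continuous_on_cinv: "c \<in> atlas \<Longrightarrow> continuous_on (cmap c ` cdom c) (cinv c)"
  using chart_homeomorphism unfolding homeomorphism_def by blast

lemma open_cdom: "c \<in> atlas \<Longrightarrow> open (cdom c)"
  and open_chart_image: "c \<in> atlas \<Longrightarrow> open (cmap c ` cdom c)"
  using chart_open by auto

lemma charts_atD: "c \<in> charts_at p \<Longrightarrow> c \<in> atlas" "c \<in> charts_at p \<Longrightarrow> p \<in> cdom c"
  by (auto simp: charts_at_def)

lemma charts_at_nonempty: "charts_at p \<noteq> {}"
proof -
  have "p \<in> (\<Union>c\<in>atlas. cdom c)" using charts_cover by simp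
  then show ?thesis unfolding charts_at_def by blast
qed

lemma chart_at_in: "chart_at p \<in> charts_at p"
  unfolding chart_at_def using charts_at_nonempty some_in_eq by blast

lemma open_overlap_image:
  assumes "c \<in> atlas" "c' \<in> atlas"
  shows "open (cmap c ` (cdom c \<inter> cdom c'))"
proof -
  have "cmap c ` (cdom c \<inter> cdom c') = cmap c ` cdom c \<inter> cinv c -` cdom c'"
    using cinv_cmap[OF assms(1)] by force
  then show ?thesis
    using continuous_open_preimage[OF continuous_on_cinv open_chart_image open_cdom] assms by simp
qed

lemma transition_has_derivative_at:
  assumes "c \<in> atlas" "c' \<in> atlas" "x \<in> cmap c ` (cdom c \<inter> cdom c')"
  shows "((cmap c' \<circ> cinv c) has_derivative frechet_derivative (cmap c' \<circ> cinv c) (at x)) (at x)"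
proof -
  have "Ck_on 1 (cmap c ` (cdom c \<inter> cdom c')) (cmap c' \<circ> cinv c)"
    using charts_compatible[OF assms(1,2)] by (simp only: smooth_on_def)
  then have "(cmap c' \<circ> cinv c) differentiable (at x)" using assms(3) by auto
  then show ?thesis by (subst (asm) frechet_derivative_works)
qed

lemma transition_derivative_continuous:
  assumes "c \<in> atlas" "c' \<in> atlas"
  shows "continuous_on (cmap c ` (cdom c \<inter> cdom c')) (\<lambda>x. frechet_derivative (cmap c' \<circ> cinv c) (at x) v)"
proof -
  have "Ck_on 1 (cmap c ` (cdom c \<inter> cdom c')) (cmap c' \<circ> cinv c)"
    using charts_compatible[OF assms(1,2)] by (simp only: smooth_on_def)
  then show ?thesis by simp
qed

lemma transition_has_derivative:
  assumes "c \<in> charts_at p" "c' \<in> charts_at p"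
  shows "((cmap c' \<circ> cinv c) has_derivative transition_deriv c c' p) (at (cmap c p))"
  unfolding transition_deriv_def
  by (rule transition_has_derivative_at) (use assms in \<open>auto simp: charts_at_def\<close>)

lemma eventually_in_overlap_image:
  assumes "c \<in> charts_at p" "c' \<in> charts_at p"
  shows "eventually (\<lambda>x. x \<in> cmap c ` (cdom c \<inter> cdom c')) (nhds (cmap c p))"
  by (rule eventually_nhds_in_open[OF open_overlap_image]) (use assms in \<open>auto simp: charts_at_def\<close>)

lemma transition_refl:
  assumes "c \<in> charts_at p"
  shows "transition_deriv c c p w = w"
proof -
  have "eventually (\<lambda>x. x = (cmap c \<circ> cinv c) x) (at (cmap c p))"
    unfolding eventually_at_filter
    by (rule eventually_mono[OF eventually_in_overlap_image[OF assms assms]])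
      (simp add: cmap_cinv charts_atD[OF assms])
  moreover have "((\<lambda>x. x) has_derivative (\<lambda>h. h)) (at (cmap c p))" by (rule has_derivative_ident)
  ultimately have "((cmap c \<circ> cinv c) has_derivative (\<lambda>h. h)) (at (cmap c p))"
    using has_derivative_transform_eventually[of "\<lambda>x. x" "\<lambda>h. h" "cmap c p" UNIV "cmap c \<circ> cinv c"] assms
    by (simp add: cinv_cmap charts_atD)
  then show ?thesis
    using has_derivative_unique[OF transition_has_derivative[OF assms assms]] by metis
qed

text \<open>Chain rule on the overlap of the charts. This cocycle identity is what places
  \<open>tangent_vector\<close> in \<open>tangent_space\<close>.\<close>

lemma transition_comp:
  assumes "c1 \<in> charts_at p" "c2 \<in> charts_at p" "c3 \<in> charts_at p"
  shows "transition_deriv c2 c3 p (transition_deriv c1 c2 p w) = transition_deriv c1 c3 p w"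
proof -
  have p: "(cmap c2 \<circ> cinv c1) (cmap c1 p) = cmap c2 p"
    using assms by (simp add: cinv_cmap charts_atD)
  have "((cmap c3 \<circ> cinv c2) \<circ> (cmap c2 \<circ> cinv c1) has_derivative
      transition_deriv c2 c3 p \<circ> transition_deriv c1 c2 p) (at (cmap c1 p))"
    by (rule diff_chain_at[OF transition_has_derivative[OF assms(1,2)]])
      (use transition_has_derivative[OF assms(2,3)] p in simp)
  moreover have "eventually (\<lambda>x. ((cmap c3 \<circ> cinv c2) \<circ> (cmap c2 \<circ> cinv c1)) x = (cmap c3 \<circ> cinv c1) x) (at (cmap c1 p))"
    unfolding eventually_at_filter
    by (rule eventually_mono[OF eventually_in_overlap_image[OF assms(1,2)]])
      (auto simp: cinv_cmap charts_atD[OF assms(1)] charts_atD[OF assms(2)])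
  ultimately have "((cmap c3 \<circ> cinv c1) has_derivative
      transition_deriv c2 c3 p \<circ> transition_deriv c1 c2 p) (at (cmap c1 p))"
    by (rule has_derivative_transform_eventually)
      (use assms in \<open>auto simp: cinv_cmap charts_atD\<close>)
  from has_derivative_unique[OF this transition_has_derivative[OF assms(1,3)]]
  show ?thesis by (metis comp_apply)
qed

lemma linear_transition: "c \<in> charts_at p \<Longrightarrow> c' \<in> charts_at p \<Longrightarrow> linear (transition_deriv c c' p)"
  using has_derivative_linear[OF transition_has_derivative] .

lemma tangent_vector_in: "c \<in> charts_at p \<Longrightarrow> tangent_vector c p w \<in> tangent_space p"
  by (auto simp: tangent_space_def tangent_vector_def transition_comp)

lemma tangent_vector_coord: "c \<in> charts_at p \<Longrightarrow> tangent_vector c p w c = w"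
  by (simp add: tangent_vector_def transition_refl)

lemma tangent_vector_of_coord:
  assumes "c \<in> charts_at p" "v \<in> tangent_space p"
  shows "tangent_vector c p (v c) = v"
proof (rule ext)
  fix c'
  have "c' \<in> charts_at p \<Longrightarrow> transition_deriv c c' p (v c) = v c'" "c' \<notin> charts_at p \<Longrightarrow> v c' = 0"
    using assms unfolding tangent_space_def mem_Collect_eq by metis+
  then show "tangent_vector c p (v c) c' = v c'" unfolding tangent_vector_def by presburger
qed

lemma tangent_vector_change:
  "c \<in> charts_at p \<Longrightarrow> c' \<in> charts_at p \<Longrightarrow> tangent_vector c' p (transition_deriv c c' p w) = tangent_vector c p w"
  by (rule ext) (auto simp: tangent_vector_def transition_comp)

lemma tangent_vector_scaleR: "c \<in> charts_at p \<Longrightarrow> tangent_vector c p (a *\<^sub>R w) = (\<lambda>c'. a *\<^sub>R tangent_vector c p w c')"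
  by (rule ext) (auto simp: tangent_vector_def linear_scale[OF linear_transition])

lemma tangent_vector_zero: "c \<in> charts_at p \<Longrightarrow> tangent_vector c p 0 = (\<lambda>c. 0)"
  by (rule ext) (auto simp: tangent_vector_def linear_0[OF linear_transition])

lemma tangent_vector_eq_0_iff: "c \<in> charts_at p \<Longrightarrow> tangent_vector c p w = (\<lambda>c. 0) \<longleftrightarrow> w = 0"
  using tangent_vector_coord[of c p w] tangent_vector_zero[of c p] by (metis (mono_tags))

text \<open>\<open>velocity\<close> is computed in the arbitrarily chosen \<open>chart_at\<close>.
  By the chain rule for the transition map, every chart around the point yields the same tangent
  vector wherever the coordinate curve is differentiable.\<close>

lemma velocity_eq:
  assumes c: "c \<in> charts_at (y s)" and s: "0 \<le> s" "s \<le> 1"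
    and cont: "continuous_on {0..1} y"
    and der: "((cmap c \<circ> y) has_vector_derivative w) (at s within {0..1})"
  shows "velocity y s = tangent_vector c (y s) w"
proof -
  let ?c = "chart_at (y s)"
  have c': "?c \<in> charts_at (y s)" by (rule chart_at_in)
  have "((cmap ?c \<circ> cinv c) has_derivative transition_deriv c ?c (y s)) (at ((cmap c \<circ> y) s))"
    using transition_has_derivative[OF c c'] by simp
  then have "((cmap ?c \<circ> cinv c) \<circ> (cmap c \<circ> y) has_derivative
     transition_deriv c ?c (y s) \<circ> (\<lambda>h. h *\<^sub>R w)) (at s within {0..1})"
    using der unfolding has_vector_derivative_def by (intro diff_chain_within) (auto intro: has_derivative_at_withinI)
  moreover have "eventually (\<lambda>r. ((cmap ?c \<circ> cinv c) \<circ> (cmap c \<circ> y)) r = (cmap ?c \<circ> y) r) (at s within {0..1})"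
  proof -
    have "(y \<longlongrightarrow> y s) (at s within {0..1})" using cont s by (auto simp: continuous_on_def)
    then have "eventually (\<lambda>r. y r \<in> cdom c) (at s within {0..1})"
      using open_cdom[OF charts_atD(1)[OF c]] charts_atD(2)[OF c] by (rule topological_tendstoD)
    then show ?thesis by eventually_elim (simp add: cinv_cmap charts_atD[OF c])
  qed
  ultimately have "((cmap ?c \<circ> y) has_derivative transition_deriv c ?c (y s) \<circ> (\<lambda>h. h *\<^sub>R w)) (at s within {0..1})"
    by (rule has_derivative_transform_eventually) (use c s in \<open>auto simp: cinv_cmap charts_atD\<close>)
  then have "((cmap ?c \<circ> y) has_vector_derivative transition_deriv c ?c (y s) w) (at s within {0..1})"
    unfolding has_vector_derivative_def
    by (rule has_derivative_eq_rhs) (auto simp: linear_scale[OF linear_transition[OF c c']])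
  then have "vector_derivative (cmap ?c \<circ> y) (at s within {0..1}) = transition_deriv c ?c (y s) w"
    by (rule vector_derivative_within[rotated]) (use s in \<open>auto simp: trivial_limit_within intro!: \<close>)
  then show ?thesis unfolding velocity_def by (simp add: tangent_vector_change[OF c c'])
qed

lemma velocity_in: "velocity y s \<in> tangent_space (y s)"
  unfolding velocity_def by (rule tangent_vector_in[OF chart_at_in])

lemma AC_D:
  assumes "y \<in> AC"
  shows "continuous_on {0..1} y"
    and "c \<in> atlas \<Longrightarrow> 0 \<le> a \<Longrightarrow> a \<le> b \<Longrightarrow> b \<le> 1 \<Longrightarrow> y ` {a..b} \<subseteq> cdom c \<Longrightarrow> abs_cont_on a b (cmap c \<circ> y)"
  using assms unfolding AC_def by blast+

lemma AC_local_derivative: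
  assumes y: "y \<in> AC" and c: "c \<in> atlas" and ab: "0 \<le> a" "a \<le> b" "b \<le> 1" and im: "y ` {a..b} \<subseteq> cdom c"
  obtains N x' where "negligible N" "x' absolutely_integrable_on {a..b}"
    "\<And>s. s \<in> {a<..<b} - N \<Longrightarrow> ((cmap c \<circ> y) has_vector_derivative x' s) (at s)"
    "\<And>s. s \<in> {a<..<b} - N \<Longrightarrow> velocity y s = tangent_vector c (y s) (x' s)"
    "\<And>u v. a \<le> u \<Longrightarrow> u \<le> v \<Longrightarrow> v \<le> b \<Longrightarrow> (x' has_integral (cmap c (y v) - cmap c (y u))) {u..v}"
proof -
  obtain N x' where *: "negligible N" "x' absolutely_integrable_on {a..b}"
    "\<And>s. s \<in> {a<..<b} - N \<Longrightarrow> ((cmap c \<circ> y) has_vector_derivative x' s) (at s)"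
    "\<And>u v. a \<le> u \<Longrightarrow> u \<le> v \<Longrightarrow> v \<le> b \<Longrightarrow> (x' has_integral ((cmap c \<circ> y) v - (cmap c \<circ> y) u)) {u..v}"
    using abs_cont_on_vector_derivative[OF AC_D(2)[OF y c ab im] ab(2)] by metis
  have "velocity y s = tangent_vector c (y s) (x' s)" if s: "s \<in> {a<..<b} - N" for s
  proof (rule velocity_eq[OF _ _ _ AC_D(1)[OF y]])
    have "s \<in> {a..b}" using s by auto
    then show "c \<in> charts_at (y s)" using c im by (auto simp: charts_at_def)
    show "((cmap c \<circ> y) has_vector_derivative x' s) (at s within {0..1})"
      using *(3)[OF s] by (rule has_vector_derivative_at_within)
  qed (use s ab in auto)
  then show ?thesis using that[OF *(1,2,3)] *(4) by simp
qed

text \<open>The conclusion has the shape of the local hypothesis of \<open>Bolzano\<close>, so that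
  statements proved inside one chart can be glued along a curve.\<close>

lemma curve_local_chart:
  fixes y :: "real \<Rightarrow> 'q"
  assumes y: "continuous_on {0..1} y" and s: "0 \<le> s" "s \<le> 1" and U: "open U" "y s \<in> U"
  obtains d where "d > 0" "\<And>u v. 0 \<le> u \<Longrightarrow> u \<le> s \<Longrightarrow> s \<le> v \<Longrightarrow> v \<le> 1 \<Longrightarrow> v - u < d \<Longrightarrow> y ` {u..v} \<subseteq> U"
proof -
  have "(y \<longlongrightarrow> y s) (at s within {0..1})" using y s by (auto simp: continuous_on_def)
  then have "eventually (\<lambda>r. y r \<in> U) (at s within {0..1})" using U by (rule topological_tendstoD)
  then obtain d where d: "d > 0" "\<And>r. r \<in> {0..1} \<Longrightarrow> r \<noteq> s \<Longrightarrow> dist r s < d \<Longrightarrow> y r \<in> U"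
    unfolding eventually_at by blast
  have "y ` {u..v} \<subseteq> U" if "0 \<le> u" "u \<le> s" "s \<le> v" "v \<le> 1" "v - u < d" for u v
  proof
    fix p assume "p \<in> y ` {u..v}"
    then obtain r where r: "r \<in> {u..v}" "p = y r" by blast
    then show "p \<in> U" using d(2)[of r] U(2) that by (cases "r = s") (auto simp: dist_real_def)
  qed
  with d(1) show ?thesis by (rule that)
qed

end

section \<open>Weighted lengths of curves\<close>

lemma has_integral_affine_real:
  fixes g :: "real \<Rightarrow> real"
  assumes "(g has_integral I) {u..v}" "m \<noteq> 0" "(\<lambda>s. m * s + e) ` {a..b} = {u..v}"
  shows "((\<lambda>s. \<bar>m\<bar> * g (m * s + e)) has_integral I) {a..b}"
proof -
  have "((\<lambda>x. g (m *\<^sub>R x + e)) has_integral (1 / (\<bar>m\<bar> ^ DIM(real))) *\<^sub>R I)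
     ((\<lambda>x. (1 / m) *\<^sub>R x + -((1 / m) *\<^sub>R e)) ` cbox u v)"
    by (rule has_integral_affinity) (use assms in auto)
  moreover have "(\<lambda>x. (1 / m) *\<^sub>R x + -((1 / m) *\<^sub>R e)) ` cbox u v = {a..b}"
    unfolding box_real assms(3)[symmetric] image_image using assms(2) by (simp add: field_simps)
  ultimately have "((\<lambda>x. g (m * x + e)) has_integral (I / \<bar>m\<bar>)) {a..b}" by simp
  from has_integral_mult_right[OF this, of "\<bar>m\<bar>"] show ?thesis using assms(2) by simp
qed

context smooth_manifold begin

text \<open>Regularity is recorded because at irregular points \<open>velocity\<close> is an arbitrary value, so that
  reparametrisation rescales it only almost everywhere.\<close>

definition regular_point :: "(real \<Rightarrow> 'q) \<Rightarrow> real \<Rightarrow> bool" where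
  "regular_point y s \<longleftrightarrow> 0 < s \<and> s < 1 \<and> (\<exists>c\<in>charts_at (y s). (cmap c \<circ> y) differentiable (at s))"

lemma AC_regular_ae:
  assumes y: "y \<in> AC"
  shows "negligible {s \<in> {0..1}. \<not> regular_point y s}"
proof -
  define Q where "Q u w \<longleftrightarrow> (0 \<le> u \<and> w \<le> 1 \<longrightarrow> negligible {s \<in> {u..w}. \<not> regular_point y s})" for u w
  have "Q 0 1"
  proof (rule Bolzano[of 0 1 Q])
    fix u v w assume Q: "Q u v" "Q v w" "u \<le> v" "v \<le> w"
    have "{s \<in> {u..w}. \<not> regular_point y s} = {s \<in> {u..v}. \<not> regular_point y s} \<union> {s \<in> {v..w}. \<not> regular_point y s}"
      using Q(3,4) by auto
    then show "Q u w" using Q by (auto simp: Q_def intro: negligible_Un)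
  next
    fix s :: real assume s: "0 \<le> s" "s \<le> 1"
    obtain c where c: "c \<in> charts_at (y s)" using charts_at_nonempty by blast
    obtain d where d: "d > 0" "\<And>u v. 0 \<le> u \<Longrightarrow> u \<le> s \<Longrightarrow> s \<le> v \<Longrightarrow> v \<le> 1 \<Longrightarrow> v - u < d \<Longrightarrow> y ` {u..v} \<subseteq> cdom c"
      using curve_local_chart[OF AC_D(1)[OF y] s open_cdom[OF charts_atD(1)[OF c]] charts_atD(2)[OF c]] by metis
    show "\<exists>d>0. \<forall>u w. u \<le> s \<and> s \<le> w \<and> w - u < d \<longrightarrow> Q u w"
    proof (rule exI[of _ d], intro conjI allI impI d(1))
      fix u w assume uw: "u \<le> s \<and> s \<le> w \<and> w - u < d"
      show "Q u w" unfolding Q_def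
      proof
        assume 01: "0 \<le> u \<and> w \<le> 1"
        have im: "y ` {u..w} \<subseteq> cdom c" using d(2) uw 01 by auto
        obtain N x' where N: "negligible N"
          "\<And>r. r \<in> {u<..<w} - N \<Longrightarrow> ((cmap c \<circ> y) has_vector_derivative x' r) (at r)"
          using AC_local_derivative[OF y charts_atD(1)[OF c] _ _ _ im] uw 01 by (metis order_trans)
        have "regular_point y r" if r: "r \<in> {u<..<w} - N" for r
        proof -
          have "c \<in> charts_at (y r)" using im r charts_atD(1)[OF c] by (auto simp: charts_at_def)
          moreover have "(cmap c \<circ> y) differentiable (at r)" using N(2)[OF r] by (rule differentiableI_vector)
          ultimately show ?thesis using r 01 unfolding regular_point_def by auto
        qed
        then have "{r \<in> {u..w}. \<not> regular_point y r} \<subseteq> N \<union> {u, w}" by force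
        then show "negligible {s \<in> {u..w}. \<not> regular_point y s}"
          by (rule negligible_subset[rotated]) (intro negligible_Un N(1) negligible_finite, simp)
      qed
    qed
  qed simp
  then show ?thesis by (simp add: Q_def)
qed

lemma velocity_affine:
  assumes reg: "regular_point z (m * s + e)" and s: "0 \<le> s" "s \<le> 1" and y: "continuous_on {0..1} y"
    and eq: "a < s" "s < b" "\<And>r. a \<le> r \<Longrightarrow> r \<le> b \<Longrightarrow> y r = z (m * r + e)"
    and z: "continuous_on {0..1} z"
  shows "velocity y s = (\<lambda>c. m *\<^sub>R velocity z (m * s + e) c)"
proof -
  let ?r = "m * s + e"
  obtain c where c: "c \<in> charts_at (z ?r)" "(cmap c \<circ> z) differentiable (at ?r)" and r: "0 < ?r" "?r < 1"
    using reg unfolding regular_point_def by blast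
  have ys: "y s = z ?r" using eq(3)[of s] eq(1,2) by simp
  define w where "w = vector_derivative (cmap c \<circ> z) (at ?r)"
  have w: "((cmap c \<circ> z) has_vector_derivative w) (at ?r)"
    using c(2) unfolding w_def by (simp add: vector_derivative_works)
  have "velocity z ?r = tangent_vector c (z ?r) w"
    by (rule velocity_eq[where y=z, OF c(1) _ _ z]) (use r has_vector_derivative_at_within[OF w] in auto)
  moreover have "velocity y s = tangent_vector c (y s) (m *\<^sub>R w)"
  proof (rule velocity_eq[OF _ s y])
    show "c \<in> charts_at (y s)" using c ys by simp
    have "((\<lambda>r. m * r + e) has_vector_derivative m) (at s)"
      by (auto intro!: derivative_eq_intros simp: has_real_derivative_iff_has_vector_derivative[symmetric])
    from vector_diff_chain_at[OF this w]
    have "((cmap c \<circ> z) \<circ> (\<lambda>r. m * r + e) has_vector_derivative m *\<^sub>R w) (at s)" .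
    moreover have "eventually (\<lambda>r. ((cmap c \<circ> z) \<circ> (\<lambda>r. m * r + e)) r = (cmap c \<circ> y) r) (nhds s)"
    proof -
      have "eventually (\<lambda>r. r \<in> {a<..<b}) (nhds s)" by (rule eventually_nhds_in_open) (use eq in auto)
      then show ?thesis by eventually_elim (use eq(3) in auto)
    qed
    ultimately have "((cmap c \<circ> y) has_vector_derivative m *\<^sub>R w) (at s)"
      by (subst has_vector_derivative_cong_ev[where g="(cmap c \<circ> z) \<circ> (\<lambda>r. m * r + e)"])
        (use ys in \<open>auto elim: eventually_mono\<close>)
    then show "((cmap c \<circ> y) has_vector_derivative m *\<^sub>R w) (at s within {0..1})"
      by (rule has_vector_derivative_at_within)
  qed
  ultimately show ?thesis using tangent_vector_scaleR[OF c(1)] ys by simp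
qed

lemma AC_affine:
  assumes z: "z \<in> AC" and m: "m \<noteq> 0" and im: "\<And>s. 0 \<le> s \<Longrightarrow> s \<le> 1 \<Longrightarrow> 0 \<le> m * s + e \<and> m * s + e \<le> 1"
  shows "(\<lambda>s. z (m * s + e)) \<in> AC"
  unfolding AC_def
proof (intro CollectI conjI ballI allI impI)
  show "continuous_on {0..1} (\<lambda>s. z (m * s + e))"
    by (rule continuous_on_compose2[OF AC_D(1)[OF z]]) (use im in \<open>auto intro!: continuous_intros\<close>)
  fix c a b assume c: "c \<in> atlas" and *: "0 \<le> a \<and> a \<le> b \<and> b \<le> 1 \<and> (\<lambda>s. z (m * s + e)) ` {a..b} \<subseteq> cdom c"
  let ?u = "min (m * a + e) (m * b + e)" and ?v = "max (m * a + e) (m * b + e)"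
  have img: "(\<lambda>s. m * s + e) ` {a..b} = {?u..?v}"
    using image_affinity_atLeastAtMost[of m e a b] * m
    by (cases "m > 0") (auto simp: min_def max_def mult_left_mono mult_left_mono_neg not_less)
  have "abs_cont_on ?u ?v (cmap c \<circ> z)"
  proof (rule AC_D(2)[OF z c])
    show "0 \<le> ?u" "?v \<le> 1" using im[of a] im[of b] * by auto
    show "z ` {?u..?v} \<subseteq> cdom c" unfolding img[symmetric] using * by (simp add: image_image)
  qed simp
  then have "abs_cont_on a b (\<lambda>s. (cmap c \<circ> z) (m * s + e))"
  proof (rule abs_cont_on_affine[OF _ m])
    fix s assume "a \<le> s" "s \<le> b"
    then have "m * s + e \<in> {?u..?v}" unfolding img[symmetric] by auto
    then show "?u \<le> m * s + e \<and> m * s + e \<le> ?v" by simp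
  qed
  then show "abs_cont_on a b (cmap c \<circ> (\<lambda>s. z (m * s + e)))" by (simp add: o_def)
qed

lemma abs_cont_on_cong:
  assumes "abs_cont_on a b f" "\<And>s. a \<le> s \<Longrightarrow> s \<le> b \<Longrightarrow> g s = f s"
  shows "abs_cont_on a b g"
  by (rule abs_cont_on_lipschitz_le[OF assms(1) zero_less_one]) (use assms(2) in auto)

definition join_curves :: "(real \<Rightarrow> 'q) \<Rightarrow> (real \<Rightarrow> 'q) \<Rightarrow> real \<Rightarrow> 'q" where
  "join_curves y1 y2 s = (if s \<le> 1/2 then y1 (2 * s) else y2 (2 * s - 1))"

text \<open>The second branch also covers s = 1/2, so both halves become closed intervals. Writing
  \<open>+ - 1\<close> matches the shape m * s + e of the affine lemmas.\<close>

lemma join_curves_right: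
  assumes "y1 1 = y2 0" "1/2 \<le> s"
  shows "join_curves y1 y2 s = y2 (2 * s + - 1)"
proof (cases "s = 1/2")
  case True
  show ?thesis unfolding True join_curves_def using assms by simp
qed (use assms in \<open>simp add: join_curves_def\<close>)

lemma join_curves_AC:
  assumes y1: "y1 \<in> AC" and y2: "y2 \<in> AC" and eq: "y1 1 = y2 0"
  shows "join_curves y1 y2 \<in> AC"
  unfolding AC_def
proof (intro CollectI conjI ballI allI impI)
  have "continuous_on ({0..1/2} \<union> {1/2..1}) (\<lambda>s. if s \<le> 1/2 then y1 (2 * s) else y2 (2 * s - 1))"
  proof (rule continuous_on_If)
    show "continuous_on {0..1/2} (\<lambda>s. y1 (2 * s))"
      by (rule continuous_on_compose2[OF AC_D(1)[OF y1]]) (auto intro!: continuous_intros)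
    show "continuous_on {1/2..1} (\<lambda>s. y2 (2 * s - 1))"
      by (rule continuous_on_compose2[OF AC_D(1)[OF y2]]) (auto intro!: continuous_intros)
    fix s :: real assume "s \<in> {0..1/2}" "\<not> s \<le> 1/2"
    then show "y1 (2 * s) = y2 (2 * s - 1)" by auto
  next
    fix s :: real assume "s \<in> {1/2..1}" "s \<le> 1/2"
    then have s: "s = 1/2" by auto
    show "y1 (2 * s) = y2 (2 * s - 1)" unfolding s using eq by simp
  qed auto
  moreover have "{0..1/2} \<union> {1/2..1} = {0..1::real}" by auto
  ultimately show "continuous_on {0..1} (join_curves y1 y2)" by (simp add: join_curves_def[abs_def])
  fix c a b assume c: "c \<in> atlas" and *: "0 \<le> a \<and> a \<le> b \<and> b \<le> 1 \<and> join_curves y1 y2 ` {a..b} \<subseteq> cdom c"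
  let ?f = "cmap c \<circ> join_curves y1 y2"
  have half: "join_curves y1 y2 s = y2 (2 * s + - 1)" if "1/2 \<le> s" for s
    by (rule join_curves_right) (use eq that in auto)
  have left: "abs_cont_on u v ?f" if uv: "a \<le> u" "u \<le> v" "v \<le> b" "v \<le> 1/2" for u v
  proof -
    have "abs_cont_on (2 * u) (2 * v) (cmap c \<circ> y1)"
    proof (rule AC_D(2)[OF y1 c])
      show "y1 ` {2 * u..2 * v} \<subseteq> cdom c"
      proof
        fix p assume "p \<in> y1 ` {2 * u..2 * v}"
        then obtain r where r: "2 * u \<le> r" "r \<le> 2 * v" "p = y1 r" by auto
        then have "p = join_curves y1 y2 (r / 2)" "r / 2 \<in> {a..b}" using uv by (auto simp: join_curves_def)
        then show "p \<in> cdom c" using * by blast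
      qed
    qed (use uv * in auto)
    then have "abs_cont_on u v (\<lambda>s. (cmap c \<circ> y1) (2 * s + 0))"
      by (rule abs_cont_on_affine) auto
    then show ?thesis by (rule abs_cont_on_cong) (use uv in \<open>auto simp: join_curves_def\<close>)
  qed
  have right: "abs_cont_on u v ?f" if uv: "a \<le> u" "u \<le> v" "v \<le> b" "1/2 \<le> u" for u v
  proof -
    have "abs_cont_on (2 * u - 1) (2 * v - 1) (cmap c \<circ> y2)"
    proof (rule AC_D(2)[OF y2 c])
      show "y2 ` {2 * u - 1..2 * v - 1} \<subseteq> cdom c"
      proof
        fix p assume "p \<in> y2 ` {2 * u - 1..2 * v - 1}"
        then obtain r where r: "2 * u - 1 \<le> r" "r \<le> 2 * v - 1" "p = y2 r" by auto
        then have "p = join_curves y1 y2 ((r + 1) / 2)" "(r + 1) / 2 \<in> {a..b}"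
          using uv half[of "(r + 1) / 2"] by (auto simp: field_simps)
        then show "p \<in> cdom c" using * by blast
      qed
    qed (use uv * in auto)
    then have "abs_cont_on u v (\<lambda>s. (cmap c \<circ> y2) (2 * s + (- 1)))"
      by (rule abs_cont_on_affine) auto
    then show ?thesis by (rule abs_cont_on_cong) (use uv half in auto)
  qed
  show "abs_cont_on a b ?f"
  proof (cases "b \<le> 1/2 \<or> 1/2 \<le> a")
    case True
    then show ?thesis
    proof
      assume "b \<le> 1/2"
      show ?thesis by (rule left) (use * \<open>b \<le> 1/2\<close> in auto)
    next
      assume "1/2 \<le> a"
      show ?thesis by (rule right) (use * \<open>1/2 \<le> a\<close> in auto)
    qed
  next
    case False
    show ?thesis
    proof (rule abs_cont_on_combine)
      show "abs_cont_on a (1/2) ?f" by (rule left) (use * False in auto)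
      show "abs_cont_on (1/2) b ?f" by (rule right) (use * False in auto)
    qed (use False in auto)
  qed
qed

lemma const_AC: "(\<lambda>s. p) \<in> AC"
  unfolding AC_def
proof (intro CollectI conjI ballI allI impI)
  fix c a b
  show "abs_cont_on a b (cmap c \<circ> (\<lambda>s. p))"
    unfolding abs_cont_on_def by (auto intro: exI[of _ 1])
qed auto

lemma velocity_const: "0 \<le> s \<Longrightarrow> s \<le> 1 \<Longrightarrow> velocity (\<lambda>s. p) s = (\<lambda>c. 0)"
  using velocity_eq[where y="\<lambda>s. p" and s=s and w=0, OF chart_at_in]
  by (simp add: o_def tangent_vector_zero[OF chart_at_in])

end

context norm_manifold begin

section \<open>Local equivalence of the metric and the coordinate norm\<close>

definition cnorm :: "('q, 'e) chart \<Rightarrow> 'q \<Rightarrow> 'e \<Rightarrow> real" where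
  "cnorm c p w = R1 p (tangent_vector c p w)"

lemma cnorm_nonneg: "c \<in> charts_at p \<Longrightarrow> 0 \<le> cnorm c p w"
  unfolding cnorm_def by (rule R1_nonneg[OF tangent_vector_in])

lemma cnorm_scaleR: "c \<in> charts_at p \<Longrightarrow> cnorm c p (a *\<^sub>R w) = \<bar>a\<bar> * cnorm c p w"
  by (simp add: cnorm_def tangent_vector_scaleR R1_scaleR[OF tangent_vector_in])

lemma cnorm_eq_0_iff: "c \<in> charts_at p \<Longrightarrow> cnorm c p w = 0 \<longleftrightarrow> w = 0"
  unfolding cnorm_def by (simp add: R1_eq_0_iff[OF tangent_vector_in] tangent_vector_eq_0_iff)

lemma cnorm_pos: "c \<in> charts_at p \<Longrightarrow> w \<noteq> 0 \<Longrightarrow> 0 < cnorm c p w"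
  using cnorm_nonneg cnorm_eq_0_iff by (metis less_eq_real_def)

lemma cnorm_unit:
  assumes "c \<in> charts_at p" "w \<noteq> 0"
  shows "cnorm c p w = norm w * cnorm c p (w /\<^sub>R norm w)"
  using cnorm_scaleR[OF assms(1), of "norm w" "w /\<^sub>R norm w"] assms(2) by simp

lemma cnorm_continuous: "c \<in> atlas \<Longrightarrow> continuous_on (cdom c \<times> UNIV) (\<lambda>(p, w). cnorm c p w)"
  unfolding cnorm_def by (rule R1_continuous)

lemma sphere_nonempty: "sphere 0 1 \<noteq> ({} :: 'e set)"
proof -
  have "(SOME i. i \<in> Basis) \<in> (sphere 0 1 :: 'e set)" by (simp add: norm_Basis[OF SOME_Basis])
  then show ?thesis by blast
qed

text \<open>At p0 the norm has a positive minimum on the compact unit sphere, and compactness makes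
  its change in the base point uniform over the sphere. Since \<open>m\<close> is half that minimum,
  a change of size at most \<open>m\<close> still leaves \<open>m\<close>. Homogeneity extends the
  bounds to all vectors.\<close>

lemma cnorm_local_bounds:
  assumes c: "c \<in> charts_at p0"
  obtains m M U where "0 < m" "0 < M" "open U" "p0 \<in> U" "U \<subseteq> cdom c"
    "\<And>p w. p \<in> U \<Longrightarrow> m * norm w \<le> cnorm c p w" "\<And>p w. p \<in> U \<Longrightarrow> cnorm c p w \<le> M * norm w"
proof -
  let ?S = "sphere 0 1 :: 'e set"
  note cA = charts_atD[OF c]
  have cont: "continuous_on (cdom c \<times> ?S) (\<lambda>(p, w). cnorm c p w)"
    by (rule continuous_on_subset[OF cnorm_continuous[OF cA(1)]]) auto
  have contp: "continuous_on ?S (cnorm c p0)"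
    by (rule continuous_on_compose2[OF cont, of _ "\<lambda>w. (p0, w)", simplified]) (use cA in \<open>auto intro!: continuous_intros\<close>)
  obtain w0 where w0: "w0 \<in> ?S" "\<And>w. w \<in> ?S \<Longrightarrow> cnorm c p0 w0 \<le> cnorm c p0 w"
    using continuous_attains_inf[OF _ sphere_nonempty contp] by auto
  obtain w1 where w1: "w1 \<in> ?S" "\<And>w. w \<in> ?S \<Longrightarrow> cnorm c p0 w \<le> cnorm c p0 w1"
    using continuous_attains_sup[OF _ sphere_nonempty contp] by auto
  define m where "m = cnorm c p0 w0 / 2"
  define M where "M = cnorm c p0 w1 + m"
  have m: "0 < m" unfolding m_def using cnorm_pos[OF c, of w0] w0(1) by fastforce
  then have M: "0 < M" unfolding M_def using cnorm_nonneg[OF c, of w1] by simp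
  obtain X0 where X0: "p0 \<in> X0" "open X0"
    and X0d: "\<forall>p\<in>X0 \<inter> cdom c. \<forall>w\<in>?S. dist (case (p, w) of (p, w) \<Rightarrow> cnorm c p w)
      (case (p0, w) of (p, w) \<Rightarrow> cnorm c p w) \<le> m"
    by (rule continuous_on_prod_compactE[OF cont compact_sphere cA(2) m])
  have X0_dist: "dist (cnorm c p w) (cnorm c p0 w) \<le> m" if "p \<in> X0 \<inter> cdom c" "w \<in> ?S" for p w
    using X0d[rule_format, OF that] by simp
  have both: "m * norm w \<le> cnorm c p w \<and> cnorm c p w \<le> M * norm w" if p: "p \<in> X0 \<inter> cdom c" for p w
  proof (cases "w = 0")
    case True
    then show ?thesis using p cA cnorm_eq_0_iff[of c p 0] by (auto simp: charts_at_def)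
  next
    case False
    have cp: "c \<in> charts_at p" using p cA by (auto simp: charts_at_def)
    let ?w = "w /\<^sub>R norm w"
    have S: "?w \<in> ?S" using False by simp
    have "\<bar>cnorm c p ?w - cnorm c p0 ?w\<bar> \<le> m" using X0_dist[OF p S] by (simp add: dist_real_def)
    moreover have "2 * m \<le> cnorm c p0 ?w" using w0(2)[OF S] by (simp add: m_def)
    moreover have "cnorm c p0 ?w \<le> M - m" using w1(2)[OF S] by (simp add: M_def)
    ultimately have "m \<le> cnorm c p ?w" "cnorm c p ?w \<le> M" by linarith+
    then have "norm w * m \<le> norm w * cnorm c p ?w" "norm w * cnorm c p ?w \<le> norm w * M"
      by (auto intro!: mult_left_mono)
    then show ?thesis unfolding cnorm_unit[OF cp False] by (simp only: mult.commute)
  qed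
  show ?thesis
    by (rule that[of m M "X0 \<inter> cdom c"]) (use m M X0 both cA open_Int[OF X0(2) open_cdom[OF cA(1)]] in auto)
qed

section \<open>Integrability of the speed\<close>

lemma speed_nonneg: "0 \<le> speed y s"
  unfolding speed_def by (rule R1_nonneg[OF velocity_in])

lemma speed_const: "0 \<le> s \<Longrightarrow> s \<le> 1 \<Longrightarrow> speed (\<lambda>s. p) s = 0"
  using R1_eq_0_iff[OF velocity_in, of "\<lambda>s. p" s] by (simp add: speed_def velocity_const)

text \<open>The coordinate velocity is integrable but not continuous. Composing it with the jointly
  continuous \<open>cnorm\<close> preserves measurability, and homogeneity reduces the bound to the
  compact set {a..b} times the unit sphere.\<close>

lemma speed_local_integrable:
  assumes y: "y \<in> AC" and c: "c \<in> atlas" and ab: "0 \<le> a" "a \<le> b" "b \<le> 1" and im: "y ` {a..b} \<subseteq> cdom c"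
  shows "speed y absolutely_integrable_on {a..b}"
proof -
  obtain N x' where N: "negligible N" and x': "x' absolutely_integrable_on {a..b}"
    and vel: "\<And>s. s \<in> {a<..<b} - N \<Longrightarrow> velocity y s = tangent_vector c (y s) (x' s)"
    using AC_local_derivative[OF assms] by metis
  let ?F = "\<lambda>(s, w). cnorm c (y s) w"
  have cy: "continuous_on {a..b} y" using continuous_on_subset[OF AC_D(1)[OF y]] ab by auto
  have contF: "continuous_on ({a..b} \<times> UNIV) ?F"
  proof -
    have "continuous_on ({a..b} \<times> UNIV) (\<lambda>z. (y (fst z), snd z))"
      by (intro continuous_on_Pair continuous_on_compose2[OF cy] continuous_on_fst continuous_on_snd continuous_on_id) auto
    moreover have "(\<lambda>z. (y (fst z), snd z)) ` ({a..b} \<times> UNIV) \<subseteq> cdom c \<times> UNIV" using im by force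
    ultimately have "continuous_on ({a..b} \<times> UNIV)
        (\<lambda>z. case (y (fst z), snd z) of (p, w) \<Rightarrow> cnorm c p w)"
      by (rule continuous_on_compose2[OF cnorm_continuous[OF c]])
    then show ?thesis by (simp add: case_prod_unfold)
  qed
  have ch: "c \<in> charts_at (y s)" if "s \<in> {a..b}" for s using im that c by (auto simp: charts_at_def)
  have meas: "(\<lambda>s. ?F (s, x' s)) \<in> borel_measurable (lebesgue_on {a..b})"
  proof (rule measurable_compose[OF _ borel_measurable_continuous_on_restrict[OF contF]])
    have "(\<lambda>s. (s, x' s)) \<in> borel_measurable (lebesgue_on {a..b})"
    proof (rule borel_measurable_Pair)
      show "(\<lambda>s. s) \<in> borel_measurable (lebesgue_on {a..b})"
        by (rule continuous_imp_measurable_on_sets_lebesgue) (auto intro: continuous_intros)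
      show "x' \<in> borel_measurable (lebesgue_on {a..b})"
        using x' absolutely_integrable_measurable[of "{a..b}" x'] by simp
    qed
    then show "(\<lambda>s. (s, x' s)) \<in> lebesgue_on {a..b} \<rightarrow>\<^sub>M restrict_space borel ({a..b} \<times> UNIV)"
      by (intro measurable_restrict_space2) (auto simp: space_restrict_space)
  qed
  have "compact (?F ` ({a..b} \<times> sphere 0 1))"
    by (rule compact_continuous_image[OF continuous_on_subset[OF contF]]) (auto intro: compact_Times)
  from compact_imp_bounded[OF this] have "\<exists>M. \<forall>z\<in>?F ` ({a..b} \<times> sphere 0 1). norm z \<le> M"
    unfolding bounded_iff .
  then obtain M where M0: "\<forall>z\<in>?F ` ({a..b} \<times> sphere 0 1). norm z \<le> M" by (rule exE)
  have M: "\<bar>cnorm c (y s) w\<bar> \<le> M" if "s \<in> {a..b}" "norm w = 1" for s w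
    using bspec[OF M0 image_eqI[of _ ?F "(s, w)"]] that by simp
  have bound: "norm (?F (s, x' s)) \<le> M * norm (x' s)" if s: "s \<in> {a..b}" for s
  proof (cases "x' s = 0")
    case True
    then show ?thesis using cnorm_eq_0_iff[OF ch[OF s], of 0] by simp
  next
    case False
    have "cnorm c (y s) (x' s) = norm (x' s) * cnorm c (y s) (x' s /\<^sub>R norm (x' s))"
      by (rule cnorm_unit[OF ch[OF s] False])
    then show ?thesis using M[OF s, of "x' s /\<^sub>R norm (x' s)"] False
      by (simp add: abs_mult mult.commute mult_left_mono)
  qed
  have "(\<lambda>s. ?F (s, x' s)) absolutely_integrable_on {a..b}"
  proof (rule measurable_bounded_by_integrable_imp_absolutely_integrable[OF meas _ _ bound])
    show "(\<lambda>s. M * norm (x' s)) integrable_on {a..b}"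
      using x' unfolding absolutely_integrable_on_def by (intro integrable_on_mult_right) auto
  qed auto
  then show ?thesis
  proof (rule absolutely_integrable_spike)
    show "negligible (N \<union> {a, b})" using N by (auto intro: negligible_Un)
    fix s assume "s \<in> {a..b} - (N \<union> {a, b})"
    then show "speed y s = ?F (s, x' s)" using vel[of s] by (auto simp: speed_def cnorm_def)
  qed
qed

lemma speed_integrable:
  assumes y: "y \<in> AC"
  shows "speed y absolutely_integrable_on {0..1}"
proof -
  define Q where "Q u w \<longleftrightarrow> (0 \<le> u \<and> w \<le> 1 \<longrightarrow> speed y absolutely_integrable_on {u..w})" for u w
  have "Q 0 1"
  proof (rule Bolzano[of 0 1 Q])
    fix u v w assume "Q u v" "Q v w" "u \<le> v" "v \<le> w"
    then show "Q u w" unfolding Q_def by (auto intro: absolutely_integrable_on_combine[where c=v])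
  next
    fix s :: real assume s: "0 \<le> s" "s \<le> 1"
    obtain c where c: "c \<in> charts_at (y s)" using charts_at_nonempty by blast
    obtain d where d: "d > 0" "\<And>u v. 0 \<le> u \<Longrightarrow> u \<le> s \<Longrightarrow> s \<le> v \<Longrightarrow> v \<le> 1 \<Longrightarrow> v - u < d \<Longrightarrow> y ` {u..v} \<subseteq> cdom c"
      using curve_local_chart[OF AC_D(1)[OF y] s open_cdom[OF charts_atD(1)[OF c]] charts_atD(2)[OF c]] by metis
    show "\<exists>d>0. \<forall>u w. u \<le> s \<and> s \<le> w \<and> w - u < d \<longrightarrow> Q u w"
    proof (rule exI[of _ d], intro conjI allI impI d(1))
      fix u w assume uw: "u \<le> s \<and> s \<le> w \<and> w - u < d"
      show "Q u w" unfolding Q_def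
        using speed_local_integrable[OF y charts_atD(1)[OF c], of u w] d(2)[of u w] uw by auto
    qed
  qed simp
  then show ?thesis by (simp add: Q_def)
qed

lemma weighted_speed_integrable:
  fixes \<phi> :: "'q \<Rightarrow> real"
  assumes y: "y \<in> AC" and \<phi>: "continuous_on UNIV \<phi>"
  shows "(\<lambda>s. \<phi> (y s) * speed y s) absolutely_integrable_on {0..1}"
proof (rule absolutely_integrable_bounded_measurable_product_real[OF _ _ _ speed_integrable[OF y]])
  have cont: "continuous_on {0..1} (\<lambda>s. \<phi> (y s))"
    by (rule continuous_on_compose2[OF \<phi> AC_D(1)[OF y]]) auto
  then show "(\<lambda>s. \<phi> (y s)) \<in> borel_measurable (lebesgue_on {0..1})"
    by (rule continuous_imp_measurable_on_sets_lebesgue) auto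
  show "bounded ((\<lambda>s. \<phi> (y s)) ` {0..1})"
    by (rule compact_imp_bounded[OF compact_continuous_image[OF cont compact_Icc]])
qed auto

text \<open>Change of variables: the factor by which the reparametrisation rescales the speed is the
  Jacobian. The times sent to irregular points of \<open>z\<close> form a null set, being the affine
  image of one.\<close>

lemma weighted_speed_affine:
  fixes \<phi> :: "'q \<Rightarrow> real"
  assumes z: "z \<in> AC" and y: "continuous_on {0..1} y" and ab: "0 \<le> a" "a \<le> b" "b \<le> 1" and m: "m \<noteq> 0"
    and im: "(\<lambda>s. m * s + e) ` {a..b} = {u..v}" "{u..v} \<subseteq> {0..1}"
    and eq: "\<And>s. a \<le> s \<Longrightarrow> s \<le> b \<Longrightarrow> y s = z (m * s + e)"
    and I: "((\<lambda>r. \<phi> (z r) * speed z r) has_integral I) {u..v}"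
  shows "((\<lambda>s. \<phi> (y s) * speed y s) has_integral I) {a..b}"
proof -
  let ?B = "{s \<in> {0..1}. \<not> regular_point z s}"
  let ?N = "(\<lambda>r. (r - e) / m) ` ?B \<union> {a, b}"
  have N: "negligible ?N"
  proof (rule negligible_Un)
    show "negligible ((\<lambda>r. (r - e) / m) ` ?B)"
      by (rule negligible_differentiable_image_negligible[OF _ AC_regular_ae[OF z]])
        (auto intro!: derivative_intros differentiable_at_imp_differentiable_on simp: m)
  qed simp
  show ?thesis
  proof (rule has_integral_spike[OF N _ has_integral_affine_real[OF I m im(1)]])
    fix s assume s: "s \<in> {a..b} - ?N"
    have sab: "a < s" "s < b" using s by auto
    have "m * s + e \<in> {0..1}" using im s by blast
    moreover have "m * s + e \<notin> ?B"
    proof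
      assume *: "m * s + e \<in> ?B"
      have "s = ((m * s + e) - e) / m" using m by simp
      then have "s \<in> (\<lambda>r. (r - e) / m) ` ?B" using * by blast
      then show False using s by blast
    qed
    ultimately have reg: "regular_point z (m * s + e)" by blast
    have "velocity y s = (\<lambda>c. m *\<^sub>R velocity z (m * s + e) c)"
      by (rule velocity_affine[OF reg _ _ y sab eq AC_D(1)[OF z]]) (use ab sab in auto)
    moreover have "y s = z (m * s + e)" using eq sab by simp
    ultimately have "speed y s = \<bar>m\<bar> * speed z (m * s + e)"
      unfolding speed_def using R1_scaleR[OF velocity_in, of z "m * s + e" m] by simp
    then show "\<phi> (y s) * speed y s = \<bar>m\<bar> * (\<phi> (z (m * s + e)) * speed z (m * s + e))"
      using eq sab by simp
  qed
qed

text \<open>The weight 1 gives the length behind \<open>dissip_dist\<close>, the weight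
  \<open>slope t\<close> the functional minimised in \<open>S0\<close>; one calculus serves
  both.\<close>

definition wlen :: "('q \<Rightarrow> real) \<Rightarrow> (real \<Rightarrow> 'q) \<Rightarrow> real" where
  "wlen \<phi> y = integral {0..1} (\<lambda>s. \<phi> (y s) * speed y s)"

lemma wlen_has_integral:
  "y \<in> AC \<Longrightarrow> continuous_on UNIV \<phi> \<Longrightarrow> ((\<lambda>s. \<phi> (y s) * speed y s) has_integral wlen \<phi> y) {0..1}"
  unfolding wlen_def using weighted_speed_integrable set_lebesgue_integral_eq_integral(1) by (metis integrable_integral)

lemma wlen_eq_LINT:
  "y \<in> AC \<Longrightarrow> continuous_on UNIV \<phi> \<Longrightarrow> (LINT s:{0..1}|lebesgue. \<phi> (y s) * speed y s) = wlen \<phi> y"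
  unfolding wlen_def by (rule set_lebesgue_integral_eq_integral(2)[OF weighted_speed_integrable])

lemma wlen_one_eq_LINT: "y \<in> AC \<Longrightarrow> (LINT s:{0..1}|lebesgue. speed y s) = wlen (\<lambda>_. 1) y"
  using wlen_eq_LINT[of y "\<lambda>_. 1"] by simp

lemma wlen_nonneg: "(\<And>p. 0 \<le> \<phi> p) \<Longrightarrow> 0 \<le> wlen \<phi> y"
  unfolding wlen_def
  by (cases "(\<lambda>s. \<phi> (y s) * speed y s) integrable_on {0..1}")
    (auto intro!: integral_nonneg simp: speed_nonneg not_integrable_integral)

section \<open>Lengths of joined, restricted and reversed curves\<close>

lemma wlen_join:
  assumes y1: "y1 \<in> AC" and y2: "y2 \<in> AC" and eq: "y1 1 = y2 0" and \<phi>: "continuous_on UNIV \<phi>"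
  shows "wlen \<phi> (join_curves y1 y2) = wlen \<phi> y1 + wlen \<phi> y2"
proof -
  let ?y = "join_curves y1 y2"
  note yc = AC_D(1)[OF join_curves_AC[OF y1 y2 eq]]
  have "((\<lambda>s. \<phi> (?y s) * speed ?y s) has_integral wlen \<phi> y1) {0..1/2}"
  proof (rule weighted_speed_affine[OF y1 yc, where m=2 and e=0 and u=0 and v=1])
    show "(\<lambda>s. 2 * s + 0) ` {0..1 / 2} = {0..1::real}"
      using image_affinity_atLeastAtMost[of 2 0 0 "1/2::real"] by simp
  qed (use wlen_has_integral[OF y1 \<phi>] in \<open>auto simp: join_curves_def\<close>)
  moreover have "((\<lambda>s. \<phi> (?y s) * speed ?y s) has_integral wlen \<phi> y2) {1/2..1}"
  proof (rule weighted_speed_affine[OF y2 yc, where m=2 and e="-1" and u=0 and v=1])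
    show "(\<lambda>s. 2 * s + - 1) ` {1 / 2..1} = {0..1::real}"
      using image_affinity_atLeastAtMost[of 2 "-1" "1/2" "1::real"] by simp
    fix s :: real assume "1/2 \<le> s" "s \<le> 1"
    then show "?y s = y2 (2 * s + - 1)" by (intro join_curves_right) (use eq in auto)
  qed (use wlen_has_integral[OF y2 \<phi>] in auto)
  ultimately have "((\<lambda>s. \<phi> (?y s) * speed ?y s) has_integral (wlen \<phi> y1 + wlen \<phi> y2)) {0..1}"
    by (rule has_integral_combine[rotated 2]) auto
  then show ?thesis unfolding wlen_def[of _ ?y] by (rule integral_unique)
qed

lemma wlen_subcurve:
  assumes y: "y \<in> AC" and ab: "0 \<le> a" "a < b" "b \<le> 1" and \<phi>: "continuous_on UNIV \<phi>"
  shows "(\<lambda>s. y ((b - a) * s + a)) \<in> admissible (y a) (y b)"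
    and "wlen \<phi> (\<lambda>s. y ((b - a) * s + a)) = integral {a..b} (\<lambda>s. \<phi> (y s) * speed y s)"
proof -
  let ?z = "\<lambda>s. y ((b - a) * s + a)"
  have img: "(\<lambda>s. (b - a) * s + a) ` {0..1} = {a..b}"
    using image_affinity_atLeastAtMost[of "b - a" a 0 1] ab by simp
  have z: "?z \<in> AC"
  proof (rule AC_affine[OF y])
    fix s :: real assume "0 \<le> s" "s \<le> 1"
    then have "(b - a) * s + a \<in> {a..b}" unfolding img[symmetric] by auto
    then show "0 \<le> (b - a) * s + a \<and> (b - a) * s + a \<le> 1" using ab by auto
  qed (use ab in auto)
  then show "?z \<in> admissible (y a) (y b)" by (simp add: admissible_def)
  have "(\<lambda>s. \<phi> (y s) * speed y s) integrable_on {a..b}"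
    by (rule integrable_on_subinterval[OF has_integral_integrable[OF wlen_has_integral[OF y \<phi>]]]) (use ab in auto)
  then have "((\<lambda>s. \<phi> (y s) * speed y s) has_integral integral {a..b} (\<lambda>s. \<phi> (y s) * speed y s)) {a..b}"
    by (rule integrable_integral)
  then have "((\<lambda>s. \<phi> (?z s) * speed ?z s) has_integral integral {a..b} (\<lambda>s. \<phi> (y s) * speed y s)) {0..1}"
    by (intro weighted_speed_affine[OF y AC_D(1)[OF z], where m="b - a" and e=a and u=a and v=b])
      (use ab img in auto)
  then show "wlen \<phi> ?z = integral {a..b} (\<lambda>s. \<phi> (y s) * speed y s)" unfolding wlen_def by (rule integral_unique)
qed

lemma wlen_reverse:
  assumes y: "y \<in> admissible p q" and \<phi>: "continuous_on UNIV \<phi>"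
  shows "(\<lambda>s. y (- 1 * s + 1)) \<in> admissible q p" "wlen \<phi> (\<lambda>s. y (- 1 * s + 1)) = wlen \<phi> y"
proof -
  let ?z = "\<lambda>s. y (- 1 * s + 1)"
  have yA: "y \<in> AC" using y by (simp add: admissible_def)
  have z: "?z \<in> AC" by (rule AC_affine[OF yA]) auto
  then show "?z \<in> admissible q p" using y by (simp add: admissible_def)
  have "((\<lambda>s. \<phi> (?z s) * speed ?z s) has_integral wlen \<phi> y) {0..1}"
  proof (rule weighted_speed_affine[OF yA AC_D(1)[OF z], where m="-1" and e=1 and u=0 and v=1])
    show "(\<lambda>s. - 1 * s + 1) ` {0..1} = {0..1::real}"
      using image_affinity_atLeastAtMost[of "-1" 1 0 "1::real"] by simp
  qed (use wlen_has_integral[OF yA \<phi>] in auto)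
  then show "wlen \<phi> ?z = wlen \<phi> y" unfolding wlen_def[of _ ?z] by (rule integral_unique)
qed

lemma wlen_const: "wlen \<phi> (\<lambda>s. p) = 0"
proof -
  have "((\<lambda>s. \<phi> p * speed (\<lambda>s. p) s) has_integral 0) {0..1}"
    by (rule has_integral_eq[OF _ has_integral_0]) (auto simp: speed_const)
  then show ?thesis unfolding wlen_def by (rule integral_unique)
qed

lemma const_admissible: "(\<lambda>s. p) \<in> admissible p p"
  by (simp add: admissible_def const_AC)

end

section \<open>The dissipation distance\<close>

context norm_manifold begin

definition wdist :: "('q \<Rightarrow> real) \<Rightarrow> 'q \<Rightarrow> 'q \<Rightarrow> real" where
  "wdist \<phi> p q = (INF y\<in>admissible p q. wlen \<phi> y)"

lemma dissip_dist_eq_wdist: "dissip_dist = wdist (\<lambda>_. 1)"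
  unfolding dissip_dist_def wdist_def
  by (intro ext INF_cong refl wlen_one_eq_LINT) (simp add: admissible_def)

lemma wdist_le: "(\<And>p. 0 \<le> \<phi> p) \<Longrightarrow> y \<in> admissible p q \<Longrightarrow> wdist \<phi> p q \<le> wlen \<phi> y"
  unfolding wdist_def by (rule cINF_lower) (auto intro!: bdd_belowI[of _ 0] wlen_nonneg)

lemma dissip_dist_le: "y \<in> admissible p q \<Longrightarrow> dissip_dist p q \<le> wlen (\<lambda>_. 1) y"
  unfolding dissip_dist_eq_wdist by (rule wdist_le) auto

text \<open>Absolute continuity has to be checked in every other chart c' too. There the segment
  becomes its image under a transition map, which is locally Lipschitz.\<close>

lemma line_AC:
  assumes c: "c \<in> atlas" and line: "\<And>s. 0 \<le> s \<Longrightarrow> s \<le> 1 \<Longrightarrow> x0 + s *\<^sub>R w \<in> cmap c ` cdom c"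
  shows "(\<lambda>s. cinv c (x0 + s *\<^sub>R w)) \<in> AC"
  unfolding AC_def
proof (intro CollectI conjI ballI allI impI)
  show "continuous_on {0..1} (\<lambda>s. cinv c (x0 + s *\<^sub>R w))"
    by (rule continuous_on_compose2[OF continuous_on_cinv[OF c]]) (use line in \<open>auto intro!: continuous_intros\<close>)
  fix c' a b assume c': "c' \<in> atlas"
    and *: "0 \<le> a \<and> a \<le> b \<and> b \<le> 1 \<and> (\<lambda>s. cinv c (x0 + s *\<^sub>R w)) ` {a..b} \<subseteq> cdom c'"
  have "abs_cont_on a b (\<lambda>s. s)" unfolding abs_cont_on_def
  proof (intro allI impI)
    fix e :: real assume "e > 0"
    have "(\<Sum>K\<in>D. norm (Sup K - Inf K)) = (\<Sum>K\<in>D. Sup K - Inf K)" if D: "D division_of S" for D S :: "_ set"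
    proof (rule sum.cong)
      fix K :: "real set" assume "K \<in> D"
      then show "norm (Sup K - Inf K) = Sup K - Inf K" by (rule division_of_realE[OF D]) auto
    qed simp
    with \<open>e > 0\<close> show "\<exists>d>0. \<forall>D S. D division_of S \<and> S \<subseteq> {a..b} \<and> (\<Sum>K\<in>D. Sup K - Inf K) < d \<longrightarrow>
       (\<Sum>K\<in>D. norm (Sup K - Inf K)) < e" by (intro exI[of _ e]) auto
  qed
  then have "abs_cont_on a b (\<lambda>s. x0 + s *\<^sub>R w)"
  proof (rule abs_cont_on_lipschitz_le)
    show "0 < norm w + 1" by (rule add_nonneg_pos) auto
    fix x y :: real
    have "(x0 + y *\<^sub>R w) - (x0 + x *\<^sub>R w) = (y - x) *\<^sub>R w" by (simp add: scaleR_diff_left)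
    then have "norm ((x0 + y *\<^sub>R w) - (x0 + x *\<^sub>R w)) = norm w * norm (y - x)" by simp
    also have "\<dots> \<le> (norm w + 1) * norm (y - x)" by (rule mult_right_mono) auto
    finally show "norm ((x0 + y *\<^sub>R w) - (x0 + x *\<^sub>R w)) \<le> (norm w + 1) * norm (y - x)" .
  qed
  then have "abs_cont_on a b ((cmap c' \<circ> cinv c) \<circ> (\<lambda>s. x0 + s *\<^sub>R w))"
  proof (rule abs_cont_on_compose_local_lipschitz)
    fix s assume s: "a \<le> s" "s \<le> b"
    have 1: "x0 + s *\<^sub>R w \<in> cmap c ` cdom c" using line[of s] s * by auto
    have "cinv c (x0 + s *\<^sub>R w) \<in> cdom c'" using * s by auto
    then have 2: "x0 + s *\<^sub>R w \<in> cmap c ` (cdom c \<inter> cdom c')"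
      using cmap_cinv[OF c 1] cinv_in_cdom[OF c 1] by (metis IntI imageI)
    show "\<exists>r>0. \<exists>L. \<forall>y\<in>ball (x0 + s *\<^sub>R w) r. \<forall>z\<in>ball (x0 + s *\<^sub>R w) r.
        norm ((cmap c' \<circ> cinv c) y - (cmap c' \<circ> cinv c) z) \<le> L * norm (y - z)"
      by (rule C1_imp_local_lipschitz[where g'="\<lambda>x. frechet_derivative (cmap c' \<circ> cinv c) (at x)",
            OF open_overlap_image[OF c c'] 2 transition_has_derivative_at[OF c c']
            transition_derivative_continuous[OF c c']])
  qed (use * in auto)
  then show "abs_cont_on a b (cmap c' \<circ> (\<lambda>s. cinv c (x0 + s *\<^sub>R w)))" by (simp add: o_def)
qed

text \<open>The source of upper bounds for the distance. It is used to compare the topologies and to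
  test stability in a given direction.\<close>

lemma dissip_dist_line_le:
  assumes c: "c \<in> atlas" and line: "\<And>s. 0 \<le> s \<Longrightarrow> s \<le> 1 \<Longrightarrow> x0 + s *\<^sub>R w \<in> cmap c ` cdom c"
    and C: "\<And>s. 0 \<le> s \<Longrightarrow> s \<le> 1 \<Longrightarrow> cnorm c (cinv c (x0 + s *\<^sub>R w)) w \<le> C"
  shows "dissip_dist (cinv c x0) (cinv c (x0 + w)) \<le> C"
proof -
  let ?y = "\<lambda>s. cinv c (x0 + s *\<^sub>R w)"
  have y: "?y \<in> AC" by (rule line_AC[OF c line])
  have sp: "speed ?y s = cnorm c (?y s) w" if s: "0 \<le> s" "s \<le> 1" for s
  proof -
    have "velocity ?y s = tangent_vector c (?y s) w"
    proof (rule velocity_eq[where y="?y", OF _ s AC_D(1)[OF y]])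
      show "c \<in> charts_at (cinv c (x0 + s *\<^sub>R w))"
        using cinv_in_cdom[OF c line[OF s]] c by (auto simp: charts_at_def)
      have "((\<lambda>s. x0 + s *\<^sub>R w) has_vector_derivative w) (at s within {0..1})"
        by (auto intro!: derivative_eq_intros)
      then show "((cmap c \<circ> (\<lambda>s. cinv c (x0 + s *\<^sub>R w))) has_vector_derivative w) (at s within {0..1})"
        by (rule has_vector_derivative_transform[rotated 2]) (use s line cmap_cinv[OF c] in auto)
    qed
    then show ?thesis by (simp add: speed_def cnorm_def)
  qed
  have "?y \<in> admissible (cinv c x0) (cinv c (x0 + w))" using y by (simp add: admissible_def)
  then have "dissip_dist (cinv c x0) (cinv c (x0 + w)) \<le> wlen (\<lambda>_. 1) ?y" by (rule dissip_dist_le)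
  also have "\<dots> \<le> C"
  proof (rule has_integral_le)
    show "(speed ?y has_integral wlen (\<lambda>_. 1) ?y) {0..1}" using wlen_has_integral[OF y, of "\<lambda>_. 1"] by simp
    show "((\<lambda>s::real. C) has_integral C) {0..1}" using has_integral_const_real[of C 0 1] by simp
  qed (auto simp: sp C)
  finally show ?thesis .
qed

lemma norm_integral_le_ae:
  fixes f :: "real \<Rightarrow> 'b::euclidean_space"
  assumes f: "(f has_integral I) S" and g: "(g has_integral J) S" and N: "negligible N"
    and le: "\<And>s. s \<in> S - N \<Longrightarrow> norm (f s) \<le> g s"
  shows "norm I \<le> J"
proof -
  let ?f = "\<lambda>s. if s \<in> N then 0 else f s" and ?g = "\<lambda>s. if s \<in> N then 0 else g s"
  have "(?f has_integral I) S" by (rule has_integral_spike[OF N _ f]) auto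
  moreover have "(?g has_integral J) S" by (rule has_integral_spike[OF N _ g]) auto
  ultimately show ?thesis
    using integral_norm_bound_integral[of ?f S ?g] le by (auto simp: has_integral_iff)
qed

text \<open>While the curve stays in the chart ball of radius \<open>r\<close>, its coordinate
  displacement is at most its length divided by \<open>m\<close>. A curve shorter than m * r / 2
  moves by less than r / 2 in coordinates and cannot reach the boundary.\<close>

lemma escape_length:
  assumes U: "open U" "p0 \<in> U"
  obtains \<delta> where "\<delta> > 0"
    "\<And>y s. y \<in> AC \<Longrightarrow> y 0 = p0 \<Longrightarrow> 0 \<le> s \<Longrightarrow> s \<le> 1 \<Longrightarrow> y s \<notin> U \<Longrightarrow> \<delta> \<le> wlen (\<lambda>_. 1) y"
proof -
  obtain c where c: "c \<in> charts_at p0" using charts_at_nonempty by blast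
  note cA = charts_atD[OF c]
  obtain m M U1 where m: "0 < m" and U1: "open U1" "p0 \<in> U1" "U1 \<subseteq> cdom c"
    and lower: "\<And>p w. p \<in> U1 \<Longrightarrow> m * norm w \<le> cnorm c p w"
    using cnorm_local_bounds[OF c] by metis
  define x0 where "x0 = cmap c p0"
  have "open (cmap c ` cdom c \<inter> cinv c -` (U \<inter> U1))"
    by (rule continuous_open_preimage[OF continuous_on_cinv[OF cA(1)] open_chart_image[OF cA(1)] open_Int[OF U(1) U1(1)]])
  moreover have "x0 \<in> cmap c ` cdom c \<inter> cinv c -` (U \<inter> U1)"
    using U U1 cA by (auto simp: x0_def cinv_cmap)
  ultimately obtain r where r: "r > 0" "cball x0 r \<subseteq> cmap c ` cdom c \<inter> cinv c -` (U \<inter> U1)"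
    using open_contains_cball by blast
  define W where "W = cdom c \<inter> cmap c -` ball x0 r"
  have Wo: "open W" unfolding W_def
    by (rule continuous_open_preimage[OF continuous_on_cmap[OF cA(1)] open_cdom[OF cA(1)] open_ball])
  have WU: "p \<in> U \<inter> U1" if "p \<in> W" for p
  proof -
    have "cmap c p \<in> cball x0 r" using that by (auto simp: W_def)
    then have "cinv c (cmap c p) \<in> U \<inter> U1" using r(2) by blast
    then show ?thesis using that cA by (auto simp: W_def cinv_cmap)
  qed
  have p0W: "p0 \<in> W" using r cA by (auto simp: W_def x0_def)
  define K where "K = cinv c ` cball x0 (r/2)"
  have sub: "cball x0 (r/2) \<subseteq> cball x0 r" using r(1) by (intro subset_cball) simp
  have KW: "K \<subseteq> W"
  proof
    fix p assume "p \<in> K"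
    then obtain x where x: "x \<in> cball x0 (r/2)" "p = cinv c x" by (auto simp: K_def)
    then have im: "x \<in> cmap c ` cdom c" using sub r(2) by blast
    then show "p \<in> W" using x r(1) cmap_cinv[OF cA(1) im] cinv_in_cdom[OF cA(1) im] by (auto simp: W_def)
  qed
  have "compact K" unfolding K_def
    by (rule compact_continuous_image[OF continuous_on_subset[OF continuous_on_cinv[OF cA(1)]] compact_cball])
      (use sub r(2) in blast)
  then have Kc: "closed K" by (rule compact_imp_closed)
  show ?thesis
  proof (rule that[of "m * r / 2"])
    fix y s assume y: "y \<in> AC" "y 0 = p0" and s: "0 \<le> s" "s \<le> 1" "y s \<notin> U"
    show "m * r / 2 \<le> wlen (\<lambda>_. 1) y"
    proof (rule ccontr)
      assume "\<not> m * r / 2 \<le> wlen (\<lambda>_. 1) y"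
      then have short: "wlen (\<lambda>_. 1) y < m * r / 2" by simp
      \<comment> \<open>The infimum \<open>s1\<close> is the first exit time from \<open>W\<close>.
        Before it the curve stays in the closed set \<open>K\<close>, so y s1 lies in
        \<open>K\<close> as well, although \<open>K\<close> is contained in
        \<open>W\<close>.\<close>
      define B where "B = {0..1} \<inter> y -` (- W)"
      have Bc: "closed B" unfolding B_def
        by (rule continuous_closed_preimage[OF AC_D(1)[OF y(1)] closed_atLeastAtMost]) (use Wo in auto)
      have sB: "s \<in> B" using s WU by (auto simp: B_def)
      have Bb: "bdd_below B" by (auto simp: B_def intro: bdd_belowI[of _ 0])
      define s1 where "s1 = Inf B"
      have s1B: "s1 \<in> B" unfolding s1_def by (rule closed_contains_Inf[OF _ Bb Bc]) (use sB in blast)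
      then have s1: "0 \<le> s1" "s1 \<le> 1" "y s1 \<notin> W" by (auto simp: B_def)
      have before: "y s \<in> W" if "0 \<le> s" "s < s1" for s
      proof (rule ccontr)
        assume "y s \<notin> W"
        then have "s \<in> B" using that s1 by (auto simp: B_def)
        then show False using cInf_lower[OF _ Bb, of s] that by (simp add: s1_def)
      qed
      have "s1 \<noteq> 0" using s1(3) y(2) p0W by auto
      then have s1p: "0 < s1" using s1 by simp
      have inK: "y s \<in> K" if s: "0 \<le> s" "s < s1" for s
      proof -
        have im: "y ` {0..s} \<subseteq> cdom c" using before s by (force simp: W_def)
        obtain N x' where N: "negligible N" and x': "x' absolutely_integrable_on {0..s}"
          and vel: "\<And>r. r \<in> {0<..<s} - N \<Longrightarrow> velocity y r = tangent_vector c (y r) (x' r)"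
          and int: "\<And>u v. 0 \<le> u \<Longrightarrow> u \<le> v \<Longrightarrow> v \<le> s \<Longrightarrow> (x' has_integral (cmap c (y v) - cmap c (y u))) {u..v}"
          by (rule AC_local_derivative[OF y(1) cA(1) order_refl s(1) _ im]) (use s s1 in auto)
        have ints: "speed y integrable_on {0..1}"
          using wlen_has_integral[OF y(1), of "\<lambda>_. 1"] by (auto simp: has_integral_iff)
        then have ints': "speed y integrable_on {0..s}"
          by (rule integrable_on_subinterval) (use s s1 in auto)
        have "norm (cmap c (y s) - cmap c (y 0)) \<le> (1 / m) * integral {0..s} (speed y)"
        proof (rule norm_integral_le_ae)
          show "(x' has_integral (cmap c (y s) - cmap c (y 0))) {0..s}" using int[of 0 s] s by simp
          show "((\<lambda>r. (1 / m) * speed y r) has_integral (1 / m) * integral {0..s} (speed y)) {0..s}"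
            using integrable_integral[OF ints'] by (rule has_integral_mult_right)
          show "negligible (N \<union> {0, s})" using N by (auto intro: negligible_Un)
          fix r assume r: "r \<in> {0..s} - (N \<union> {0, s})"
          then have "speed y r = cnorm c (y r) (x' r)" using vel[of r] by (simp add: speed_def cnorm_def)
          moreover have "y r \<in> U1" using before[of r] WU r s by auto
          ultimately show "norm (x' r) \<le> (1 / m) * speed y r"
            using lower[of "y r" "x' r"] m by (simp add: field_simps)
        qed
        also have "\<dots> \<le> (1 / m) * wlen (\<lambda>_. 1) y"
          unfolding wlen_def using m s s1 ints ints'
          by (intro mult_left_mono) (auto intro!: integral_subset_le simp: speed_nonneg)
        also have "\<dots> < r / 2" using short m by (simp add: field_simps)
        finally have "cmap c (y s) \<in> cball x0 (r/2)" by (simp add: x0_def y(2) dist_norm norm_minus_commute)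
        then show ?thesis using before[OF s] cA unfolding K_def W_def by (metis IntD1 cinv_cmap imageI)
      qed
      have "y ` closure {0..<s1} \<subseteq> K"
        by (rule image_closure_subset[OF continuous_on_subset[OF AC_D(1)[OF y(1)]] Kc])
          (use inK s1p s1 in auto)
      then have "y s1 \<in> K" using s1p by auto
      then show False using KW s1(3) by blast
    qed
  qed (use m r in simp)
qed

end

context rate_independent_system begin

section \<open>The distance is a metric for the manifold topology\<close>

lemma wdist_approx:
  assumes "0 < e"
  obtains y where "y \<in> admissible p q" "wlen \<phi> y < wdist \<phi> p q + e"
proof -
  have "\<exists>x\<in>wlen \<phi> ` admissible p q. x < wdist \<phi> p q + e"
    using cInf_lessD[of "wlen \<phi> ` admissible p q" "wdist \<phi> p q + e"] admissible_nonempty assms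
    unfolding wdist_def by auto
  then show ?thesis using that by blast
qed

lemma wdist_nonneg: "(\<And>p. 0 \<le> \<phi> p) \<Longrightarrow> 0 \<le> wdist \<phi> p q"
  unfolding wdist_def by (rule cINF_greatest[OF admissible_nonempty]) (rule wlen_nonneg)

lemma wdist_refl: "(\<And>p. 0 \<le> \<phi> p) \<Longrightarrow> wdist \<phi> p p = 0"
  using wdist_le[of \<phi> _ p p, OF _ const_admissible] wdist_nonneg[of \<phi> p p] by (simp add: wlen_const)

lemma dissip_dist_approx:
  assumes "0 < e"
  obtains y where "y \<in> admissible p q" "wlen (\<lambda>_. 1) y < dissip_dist p q + e"
  using wdist_approx[OF assms] unfolding dissip_dist_eq_wdist by metis

lemma dissip_dist_nonneg: "0 \<le> dissip_dist p q"
  unfolding dissip_dist_eq_wdist by (rule wdist_nonneg) simp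

lemma dissip_dist_refl [simp]: "dissip_dist p p = 0"
  unfolding dissip_dist_eq_wdist by (rule wdist_refl) simp

lemma dissip_dist_triangle: "dissip_dist p r \<le> dissip_dist p q + dissip_dist q r"
proof (rule field_le_epsilon)
  fix e :: real assume "0 < e"
  then have e: "0 < e / 2" by simp
  obtain y1 where y1: "y1 \<in> admissible p q" "wlen (\<lambda>_. 1) y1 < dissip_dist p q + e / 2"
    using dissip_dist_approx[OF e] by metis
  obtain y2 where y2: "y2 \<in> admissible q r" "wlen (\<lambda>_. 1) y2 < dissip_dist q r + e / 2"
    using dissip_dist_approx[OF e] by metis
  have A: "y1 \<in> AC" "y2 \<in> AC" "y1 1 = y2 0" using y1 y2 by (auto simp: admissible_def)
  have "join_curves y1 y2 \<in> admissible p r"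
    using y1 y2 join_curves_AC[OF A] by (simp add: admissible_def join_curves_def)
  from dissip_dist_le[OF this] have "dissip_dist p r \<le> wlen (\<lambda>_. 1) y1 + wlen (\<lambda>_. 1) y2"
    using wlen_join[OF A] by simp
  then show "dissip_dist p r \<le> dissip_dist p q + dissip_dist q r + e" using y1 y2 by simp
qed

lemma dissip_dist_commute_le: "dissip_dist p q \<le> dissip_dist q p"
proof (rule field_le_epsilon)
  fix e :: real assume e: "0 < e"
  obtain y where y: "y \<in> admissible q p" "wlen (\<lambda>_. 1) y < dissip_dist q p + e"
    using dissip_dist_approx[OF e] by metis
  show "dissip_dist p q \<le> dissip_dist q p + e"
    using dissip_dist_le[OF wlen_reverse(1)[OF y(1) continuous_on_const]]
      wlen_reverse(2)[OF y(1) continuous_on_const[of UNIV 1]] y(2) by simp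
qed

lemma dissip_dist_commute: "dissip_dist p q = dissip_dist q p"
  using dissip_dist_commute_le by (simp add: antisym)

lemma dissip_dist_small_imp_in:
  assumes U: "open U" "p \<in> U"
  obtains \<delta> where "\<delta> > 0" "\<And>q. dissip_dist p q < \<delta> \<Longrightarrow> q \<in> U"
    "\<And>y s. y \<in> AC \<Longrightarrow> y 0 = p \<Longrightarrow> wlen (\<lambda>_. 1) y < \<delta> \<Longrightarrow> 0 \<le> s \<Longrightarrow> s \<le> 1 \<Longrightarrow> y s \<in> U"
proof -
  obtain \<delta> where \<delta>: "\<delta> > 0"
    "\<And>y s. y \<in> AC \<Longrightarrow> y 0 = p \<Longrightarrow> 0 \<le> s \<Longrightarrow> s \<le> 1 \<Longrightarrow> y s \<notin> U \<Longrightarrow> \<delta> \<le> wlen (\<lambda>_. 1) y"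
    using escape_length[OF U] by metis
  show ?thesis
  proof (rule that[OF \<delta>(1)])
    fix q assume "dissip_dist p q < \<delta>"
    then obtain y where y: "y \<in> admissible p q" "wlen (\<lambda>_. 1) y < dissip_dist p q + (\<delta> - dissip_dist p q)"
      using dissip_dist_approx[of "\<delta> - dissip_dist p q"] by (metis diff_gt_0_iff_gt)
    then show "q \<in> U" using \<delta>(2)[of y 1] by (fastforce simp: admissible_def)
  next
    fix y s assume "y \<in> AC" "y 0 = p" "wlen (\<lambda>_. 1) y < \<delta>" "0 \<le> s" "s \<le> (1::real)"
    then show "y s \<in> U" using \<delta>(2)[of y s] by fastforce
  qed
qed

lemma dissip_dist_eq_0_iff [simp]: "dissip_dist p q = 0 \<longleftrightarrow> p = q"
proof
  assume *: "dissip_dist p q = 0"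
  show "p = q"
  proof (rule ccontr)
    assume "p \<noteq> q"
    then obtain \<delta> where "\<delta> > 0" "\<And>q'. dissip_dist p q' < \<delta> \<Longrightarrow> q' \<in> - {q}"
      using dissip_dist_small_imp_in[of "- {q}" p] by (metis Compl_iff closed_singleton open_Compl singletonD)
    from this(2)[of q] this(1) * show False by simp
  qed
qed simp

lemma Metric_space_dissip_dist: "Metric_space UNIV dissip_dist"
  by unfold_locales (auto simp: dissip_dist_nonneg dissip_dist_commute intro: dissip_dist_triangle)

text \<open>The straight chart segment from \<open>p\<close> to a nearby point has length at most
  \<open>M\<close> times the coordinate distance.\<close>

lemma eventually_dissip_dist_less:
  assumes "0 < e"
  shows "eventually (\<lambda>q. dissip_dist p q < e) (nhds p)"
proof -
  obtain c where c: "c \<in> charts_at p" using charts_at_nonempty by blast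
  note cA = charts_atD[OF c]
  obtain m M U1 where M: "0 < M" and U1: "open U1" "p \<in> U1" "U1 \<subseteq> cdom c"
    and upper: "\<And>p w. p \<in> U1 \<Longrightarrow> cnorm c p w \<le> M * norm w"
    using cnorm_local_bounds[OF c] by metis
  define x0 where "x0 = cmap c p"
  have "open (cmap c ` cdom c \<inter> cinv c -` U1)"
    by (rule continuous_open_preimage[OF continuous_on_cinv[OF cA(1)] open_chart_image[OF cA(1)] U1(1)])
  moreover have "x0 \<in> cmap c ` cdom c \<inter> cinv c -` U1"
    using U1 cA by (auto simp: x0_def cinv_cmap)
  ultimately obtain r where r: "r > 0" "ball x0 r \<subseteq> cmap c ` cdom c \<inter> cinv c -` U1"
    using open_contains_ball by blast
  define \<rho> where "\<rho> = min r (e / M)"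
  have \<rho>: "\<rho> > 0" using r M assms by (simp add: \<rho>_def)
  have "open (cdom c \<inter> cmap c -` ball x0 \<rho>)"
    by (rule continuous_open_preimage[OF continuous_on_cmap[OF cA(1)] open_cdom[OF cA(1)] open_ball])
  moreover have "p \<in> cdom c \<inter> cmap c -` ball x0 \<rho>" using cA \<rho> by (simp add: x0_def)
  ultimately have "eventually (\<lambda>q. q \<in> cdom c \<inter> cmap c -` ball x0 \<rho>) (nhds p)"
    by (rule eventually_nhds_in_open)
  then show ?thesis
  proof (rule eventually_mono)
    fix q assume q: "q \<in> cdom c \<inter> cmap c -` ball x0 \<rho>"
    define w where "w = cmap c q - x0"
    have w: "norm w < \<rho>" using q by (simp add: w_def dist_norm norm_minus_commute)
    have inb: "x0 + s *\<^sub>R w \<in> ball x0 r" if "0 \<le> s" "s \<le> 1" for s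
    proof -
      have "norm (s *\<^sub>R w) \<le> 1 * norm w" using that by (simp add: mult_left_le_one_le)
      then show ?thesis using w by (simp add: dist_norm \<rho>_def)
    qed
    have "dissip_dist (cinv c x0) (cinv c (x0 + w)) \<le> M * norm w"
    proof (rule dissip_dist_line_le[OF cA(1)])
      fix s :: real assume s: "0 \<le> s" "s \<le> 1"
      show "x0 + s *\<^sub>R w \<in> cmap c ` cdom c" using inb[OF s] r(2) by blast
      show "cnorm c (cinv c (x0 + s *\<^sub>R w)) w \<le> M * norm w" by (rule upper) (use inb[OF s] r(2) in blast)
    qed
    also have "\<dots> < e" using w M by (simp add: \<rho>_def field_simps)
    finally show "dissip_dist p q < e" using q cA by (simp add: w_def x0_def cinv_cmap)
  qed
qed

text \<open>Short chart segments give one inclusion of the topologies, \<open>escape_length\<close>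
  the other. Only through this do limits provided by completeness of \<open>dissip_dist\<close>
  become the limits that occur in \<open>left_lim\<close> and \<open>right_lim\<close>.\<close>

lemma tendsto_iff_dissip_dist: "(f \<longlongrightarrow> p) F \<longleftrightarrow> ((\<lambda>x. dissip_dist p (f x)) \<longlongrightarrow> 0) F"
proof
  assume f: "(f \<longlongrightarrow> p) F"
  show "((\<lambda>x. dissip_dist p (f x)) \<longlongrightarrow> 0) F"
  proof (rule tendstoI)
    fix e :: real assume "0 < e"
    from eventually_dissip_dist_less[OF this, of p] f
    have "eventually (\<lambda>x. dissip_dist p (f x) < e) F" unfolding filterlim_iff by blast
    then show "eventually (\<lambda>x. dist (dissip_dist p (f x)) 0 < e) F"
      by (simp add: dissip_dist_nonneg)
  qed
next
  assume d: "((\<lambda>x. dissip_dist p (f x)) \<longlongrightarrow> 0) F"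
  show "(f \<longlongrightarrow> p) F"
  proof (rule topological_tendstoI)
    fix U assume "open U" "p \<in> U"
    then obtain \<delta> where \<delta>: "\<delta> > 0" "\<And>q. dissip_dist p q < \<delta> \<Longrightarrow> q \<in> U"
      using dissip_dist_small_imp_in by metis
    show "eventually (\<lambda>x. f x \<in> U) F"
      using order_tendstoD(2)[OF d \<delta>(1)] by (rule eventually_mono) (rule \<delta>(2))
  qed
qed

lemma tendsto_dissip_dist:
  assumes f: "(f \<longlongrightarrow> p) F" and g: "(g \<longlongrightarrow> q) F"
  shows "((\<lambda>x. dissip_dist (f x) (g x)) \<longlongrightarrow> dissip_dist p q) F"
proof -
  have "((\<lambda>x. dissip_dist p (f x) + dissip_dist q (g x)) \<longlongrightarrow> 0) F"
    using f g tendsto_add[of _ 0 F _ 0] unfolding tendsto_iff_dissip_dist by force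
  moreover have "\<forall>x. norm (dissip_dist (f x) (g x) - dissip_dist p q) \<le> dissip_dist p (f x) + dissip_dist q (g x)"
  proof
    fix x
    show "norm (dissip_dist (f x) (g x) - dissip_dist p q) \<le> dissip_dist p (f x) + dissip_dist q (g x)"
    using dissip_dist_triangle[of "f x" "g x" p] dissip_dist_triangle[of p "g x" q]
      dissip_dist_triangle[of p q "f x"] dissip_dist_triangle[of "f x" q "g x"]
      dissip_dist_commute[of p "f x"] dissip_dist_commute[of q "g x"]
      unfolding real_norm_def by linarith
  qed
  ultimately have "((\<lambda>x. dissip_dist (f x) (g x) - dissip_dist p q) \<longlongrightarrow> 0) F"
    by (rule Lim_null_comparison[OF always_eventually, rotated])
  then show ?thesis by (rule LIM_zero_cancel)
qed

lemma Cauchy_converges: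
  fixes X :: "nat \<Rightarrow> 'q"
  assumes "\<And>e. e > 0 \<Longrightarrow> \<exists>N. \<forall>n\<ge>N. \<forall>n'\<ge>N. dissip_dist (X n) (X n') < e"
  obtains l where "X \<longlonglongrightarrow> l"
proof -
  interpret M: Metric_space UNIV dissip_dist by (rule Metric_space_dissip_dist)
  have "M.MCauchy X" unfolding M.MCauchy_def using assms by blast
  then obtain l where "limitin M.mtopology X l sequentially"
    using complete unfolding M.mcomplete_def by blast
  then have "\<forall>e>0. \<exists>N. \<forall>n\<ge>N. dissip_dist (X n) l < e" by (simp add: M.limit_metric_sequentially)
  then have "(\<lambda>n. dissip_dist l (X n)) \<longlonglongrightarrow> 0"
    by (simp add: LIMSEQ_iff dissip_dist_nonneg dissip_dist_commute)
  then show ?thesis using that by (simp add: tendsto_iff_dissip_dist)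
qed

end

section \<open>Energy and slope\<close>

lemma SUP_le_SUP_add:
  fixes f g :: "'w \<Rightarrow> real"
  assumes "A \<noteq> {}" "bdd_above (g ` A)" "\<And>w. w \<in> A \<Longrightarrow> f w \<le> g w + e"
  shows "(SUP w\<in>A. f w) \<le> (SUP w\<in>A. g w) + e"
proof (rule cSUP_least[OF assms(1)])
  fix w assume w: "w \<in> A"
  have "g w \<le> (SUP w\<in>A. g w)" by (rule cSUP_upper[OF w assms(2)])
  then show "f w \<le> (SUP w\<in>A. g w) + e" using assms(3)[OF w] by linarith
qed

text \<open>Compactness of \<open>C\<close> makes the change in \<open>x\<close> uniform in
  \<open>w\<close>, and a uniform bound passes to suprema. It is applied to the slope as a supremum
  over the unit sphere.\<close>

lemma continuous_on_SUP_compact: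
  fixes h :: "'x::topological_space \<times> 'w::topological_space \<Rightarrow> real"
  assumes h: "continuous_on (U \<times> C) h" and C: "compact C" "C \<noteq> {}"
  shows "continuous_on U (\<lambda>x. SUP w\<in>C. h (x, w))"
proof -
  have bdd: "bdd_above ((\<lambda>w. h (x, w)) ` C)" if x: "x \<in> U" for x
  proof -
    have "continuous_on C (\<lambda>w. h (x, w))"
      by (rule continuous_on_compose2[OF h]) (use x in \<open>auto intro!: continuous_intros\<close>)
    then have "compact ((\<lambda>w. h (x, w)) ` C)" using C(1) by (rule compact_continuous_image)
    then show ?thesis by (intro bounded_imp_bdd_above compact_imp_bounded)
  qed
  show ?thesis unfolding continuous_on_def
  proof
    fix x0 assume x0: "x0 \<in> U"
    show "((\<lambda>x. SUP w\<in>C. h (x, w)) \<longlongrightarrow> (SUP w\<in>C. h (x0, w))) (at x0 within U)"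
    proof (rule tendstoI)
      fix e :: real assume e: "e > 0"
      then have e2: "e / 2 > 0" by simp
      obtain X0 where X0: "x0 \<in> X0" "open X0" and d: "\<forall>x\<in>X0 \<inter> U. \<forall>w\<in>C. dist (h (x, w)) (h (x0, w)) \<le> e / 2"
        by (rule continuous_on_prod_compactE[OF h C(1) x0 e2])
      have "dist (SUP w\<in>C. h (x, w)) (SUP w\<in>C. h (x0, w)) < e" if x: "x \<in> X0" "x \<in> U" for x
      proof -
        have dd: "\<bar>h (x, w) - h (x0, w)\<bar> \<le> e / 2" if "w \<in> C" for w
          using d x that by (simp add: dist_real_def)
        have "(SUP w\<in>C. h (x, w)) \<le> (SUP w\<in>C. h (x0, w)) + e / 2"
        proof (rule SUP_le_SUP_add[OF C(2) bdd[OF x0]])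
          fix w assume "w \<in> C"
          from dd[OF this] show "h (x, w) \<le> h (x0, w) + e / 2" by linarith
        qed
        moreover have "(SUP w\<in>C. h (x0, w)) \<le> (SUP w\<in>C. h (x, w)) + e / 2"
        proof (rule SUP_le_SUP_add[OF C(2) bdd[OF x(2)]])
          fix w assume "w \<in> C"
          from dd[OF this] show "h (x0, w) \<le> h (x, w) + e / 2" by linarith
        qed
        ultimately show ?thesis using e by (simp add: dist_real_def)
      qed
      then show "eventually (\<lambda>x. dist (SUP w\<in>C. h (x, w)) (SUP w\<in>C. h (x0, w)) < e) (at x0 within U)"
        unfolding eventually_at_topological using X0 by blast
    qed
  qed
qed

context rate_independent_system begin

text \<open>A single derivative per chart, continuous in time and coordinates together. Its values
  on (1, 0) and (0, w) are the time and state derivatives, so joint continuity of the power and of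
  the slope can both be read off from it.\<close>

definition DE :: "('q, 'e) chart \<Rightarrow> real \<times> 'e \<Rightarrow> (real \<times> 'e) \<Rightarrow>\<^sub>L real" where
  "DE c = (SOME D. continuous_on ({0..T} \<times> cmap c ` cdom c) D \<and>
     (\<forall>x\<in>{0..T} \<times> cmap c ` cdom c. ((\<lambda>(t, x). E t (cinv c x)) has_derivative blinfun_apply (D x))
        (at x within {0..T} \<times> cmap c ` cdom c)))"

lemma DE:
  assumes "c \<in> atlas"
  shows "continuous_on ({0..T} \<times> cmap c ` cdom c) (DE c)"
    and "x \<in> {0..T} \<times> cmap c ` cdom c \<Longrightarrow> ((\<lambda>(t, x). E t (cinv c x)) has_derivative blinfun_apply (DE c x))
        (at x within {0..T} \<times> cmap c ` cdom c)"
  using someI_ex[OF E_C1[OF assms, unfolded C1_on_def]] unfolding DE_def[symmetric] by blast+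

lemma E_chart_has_derivative:
  assumes c: "c \<in> atlas" and t: "t \<in> {0..T}" and x: "x \<in> cmap c ` cdom c"
  shows "((\<lambda>x. E t (cinv c x)) has_derivative (\<lambda>h. blinfun_apply (DE c (t, x)) (0, h))) (at x)"
proof -
  let ?S = "cmap c ` cdom c"
  have "((\<lambda>(t, x). E t (cinv c x)) \<circ> (\<lambda>x. (t, x)) has_derivative blinfun_apply (DE c (t, x)) \<circ> (\<lambda>h. (0, h))) (at x within ?S)"
  proof (rule diff_chain_within)
    show "((\<lambda>x. (t, x)) has_derivative (\<lambda>h. (0, h))) (at x within ?S)"
      by (auto intro!: derivative_eq_intros)
    have "(Pair t ` ?S) \<subseteq> {0..T} \<times> ?S" using t by auto
    then show "((\<lambda>(t, x). E t (cinv c x)) has_derivative blinfun_apply (DE c (t, x))) (at (t, x) within Pair t ` ?S)"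
      by (rule has_derivative_subset[rotated]) (use DE(2)[OF c, of "(t, x)"] t x in auto)
  qed
  then have "((\<lambda>x. E t (cinv c x)) has_derivative (\<lambda>h. blinfun_apply (DE c (t, x)) (0, h))) (at x within ?S)"
    by (simp add: o_def)
  then show ?thesis using at_within_open[OF x open_chart_image[OF c]] by simp
qed

lemma DE_snd_continuous:
  assumes c: "c \<in> atlas" and t: "t \<in> {0..T}"
  shows "continuous_on (cmap c ` cdom c) (\<lambda>x. blinfun_apply (DE c (t, x)) (0, v))"
proof -
  have "continuous_on (cmap c ` cdom c) (\<lambda>x. DE c (t, x))"
    by (rule continuous_on_compose2[OF DE(1)[OF c]]) (use t in \<open>auto intro!: continuous_intros\<close>)
  then show ?thesis by (intro continuous_intros)
qed

lemma continuous_on_charts: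
  fixes f :: "'a::t2_space \<times> 'q \<Rightarrow> 'b::topological_space"
  assumes "\<And>c. c \<in> atlas \<Longrightarrow> continuous_on (A \<times> cdom c) f"
  shows "continuous_on (A \<times> UNIV) f"
  unfolding continuous_on_eq_continuous_within
proof
  fix z assume z: "z \<in> A \<times> (UNIV :: 'q set)"
  obtain c where c: "c \<in> charts_at (snd z)" using charts_at_nonempty by blast
  note cA = charts_atD[OF c]
  have "at z within A \<times> cdom c = at z within A \<times> UNIV"
    by (rule at_within_nhd[of z "UNIV \<times> cdom c"])
      (use z cA open_Times[OF open_UNIV open_cdom[OF cA(1)]] in auto)
  moreover have "continuous (at z within A \<times> cdom c) f"
    using assms[OF cA(1)] z cA(2) unfolding continuous_on_eq_continuous_within by (cases z) auto
  ultimately show "continuous (at z within A \<times> UNIV) f" by simp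
qed

lemma chart_pair_continuous:
  assumes c: "c \<in> atlas"
  shows "continuous_on (A \<times> cdom c) (\<lambda>(t, p). (t, cmap c p))"
  unfolding case_prod_unfold
  by (intro continuous_on_Pair continuous_on_fst continuous_on_id continuous_on_compose2[OF continuous_on_cmap[OF c]]
      continuous_on_snd) auto

lemma E_continuous: "continuous_on ({0..T} \<times> UNIV) (\<lambda>(t, p). E t p)"
proof (rule continuous_on_charts)
  fix c assume c: "c \<in> atlas"
  have "continuous_on ({0..T} \<times> cmap c ` cdom c) (\<lambda>(t, x). E t (cinv c x))"
    unfolding continuous_on_eq_continuous_within using DE(2)[OF c] has_derivative_continuous by blast
  then have "continuous_on ({0..T} \<times> cdom c) (\<lambda>z. (\<lambda>(t, x). E t (cinv c x)) ((\<lambda>(t, p). (t, cmap c p)) z))"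
    by (rule continuous_on_compose2[OF _ chart_pair_continuous[OF c]]) auto
  then show "continuous_on ({0..T} \<times> cdom c) (\<lambda>(t, p). E t p)"
    by (rule continuous_on_eq) (auto simp: cinv_cmap[OF c])
qed

lemma E_has_time_derivative:
  assumes c: "c \<in> charts_at p" and t: "t \<in> {0..T}"
  shows "((\<lambda>s. E s p) has_vector_derivative blinfun_apply (DE c (t, cmap c p)) (1, 0)) (at t within {0..T})"
proof -
  note cA = charts_atD[OF c]
  let ?S = "cmap c ` cdom c" and ?x = "cmap c p"
  have "((\<lambda>(t, x). E t (cinv c x)) \<circ> (\<lambda>s. (s, ?x)) has_derivative blinfun_apply (DE c (t, ?x)) \<circ> (\<lambda>h. (h, 0))) (at t within {0..T})"
  proof (rule diff_chain_within)
    show "((\<lambda>s. (s, ?x)) has_derivative (\<lambda>h. (h, 0))) (at t within {0..T})"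
      by (auto intro!: derivative_eq_intros)
    have "((\<lambda>s. (s, ?x)) ` {0..T}) \<subseteq> {0..T} \<times> ?S" using cA by auto
    then show "((\<lambda>(t, x). E t (cinv c x)) has_derivative blinfun_apply (DE c (t, ?x))) (at (t, ?x) within (\<lambda>s. (s, ?x)) ` {0..T})"
      by (rule has_derivative_subset[rotated]) (use DE(2)[OF cA(1), of "(t, ?x)"] t cA in auto)
  qed
  then have "((\<lambda>s. E s p) has_derivative (\<lambda>h. blinfun_apply (DE c (t, ?x)) (h, 0))) (at t within {0..T})"
    using cA by (simp add: o_def cinv_cmap)
  moreover have "(\<lambda>h. blinfun_apply (DE c (t, ?x)) (h, 0)) = (\<lambda>h. h *\<^sub>R blinfun_apply (DE c (t, ?x)) (1, 0))"
  proof
    fix h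
    show "blinfun_apply (DE c (t, ?x)) (h, 0) = h *\<^sub>R blinfun_apply (DE c (t, ?x)) (1, 0)"
      using blinfun.scaleR_right[of "DE c (t, ?x)" h "(1, 0)"] by simp
  qed
  ultimately show ?thesis unfolding has_vector_derivative_def by simp
qed

lemma dtE_eq:
  assumes c: "c \<in> charts_at p" and t: "t \<in> {0..T}"
  shows "dtE t p = blinfun_apply (DE c (t, cmap c p)) (1, 0)"
  unfolding dtE_def
  by (rule vector_derivative_within_cbox[of 0 T, simplified]) (use T_pos t E_has_time_derivative[OF c t] in auto)

lemma dtE_continuous: "continuous_on ({0..T} \<times> UNIV) (\<lambda>(t, p). dtE t p)"
proof (rule continuous_on_charts)
  fix c assume c: "c \<in> atlas"
  have "continuous_on ({0..T} \<times> cdom c) (\<lambda>z. DE c ((\<lambda>(t, p). (t, cmap c p)) z))"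
    by (rule continuous_on_compose2[OF DE(1)[OF c] chart_pair_continuous[OF c]]) auto
  then have "continuous_on ({0..T} \<times> cdom c) (\<lambda>z. blinfun_apply (DE c ((\<lambda>(t, p). (t, cmap c p)) z)) (1, 0))"
    by (intro continuous_intros)
  then show "continuous_on ({0..T} \<times> cdom c) (\<lambda>(t, p). dtE t p)"
    by (rule continuous_on_eq) (auto intro!: dtE_eq[symmetric] simp: charts_at_def c)
qed

lemma dtE_has_integral:
  assumes "0 \<le> t0" "t0 \<le> t1" "t1 \<le> T"
  shows "((\<lambda>s. dtE s p) has_integral (E t1 p - E t0 p)) {t0..t1}"
proof (rule fundamental_theorem_of_calculus[OF assms(2)])
  fix s assume s: "s \<in> {t0..t1}"
  then have sT: "s \<in> {0..T}" using assms by auto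
  obtain c where c: "c \<in> charts_at p" using charts_at_nonempty by blast
  have "((\<lambda>s. E s p) has_vector_derivative dtE s p) (at s within {0..T})"
    using E_has_time_derivative[OF c sT] dtE_eq[OF c sT] by simp
  then show "((\<lambda>s. E s p) has_vector_derivative dtE s p) (at s within {t0..t1})"
    by (rule has_vector_derivative_within_subset) (use assms in auto)
qed

lemma dqE_eq:
  assumes c: "c \<in> charts_at p" and t: "t \<in> {0..T}" and v: "v \<in> tangent_space p"
  shows "dqE t p v = blinfun_apply (DE c (t, cmap c p)) (0, v c)"
proof -
  let ?c = "chart_at p"
  have c': "?c \<in> charts_at p" by (rule chart_at_in)
  note cA = charts_atD[OF c] and cA' = charts_atD[OF c']
  have x: "(cmap c \<circ> cinv ?c) (cmap ?c p) = cmap c p" using cA cA' by (simp add: cinv_cmap)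
  have "((\<lambda>x. E t (cinv c x)) \<circ> (cmap c \<circ> cinv ?c) has_derivative
      (\<lambda>h. blinfun_apply (DE c (t, cmap c p)) (0, h)) \<circ> transition_deriv ?c c p) (at (cmap ?c p))"
    by (rule diff_chain_at[OF transition_has_derivative[OF c' c]])
      (use E_chart_has_derivative[OF cA(1) t, of "cmap c p"] cA x in auto)
  moreover have "eventually (\<lambda>x. ((\<lambda>x. E t (cinv c x)) \<circ> (cmap c \<circ> cinv ?c)) x = E t (cinv ?c x)) (at (cmap ?c p))"
    unfolding eventually_at_filter
    by (rule eventually_mono[OF eventually_in_overlap_image[OF c' c]]) (auto simp: cinv_cmap cA cA')
  ultimately have "((\<lambda>x. E t (cinv ?c x)) has_derivative
      (\<lambda>h. blinfun_apply (DE c (t, cmap c p)) (0, h)) \<circ> transition_deriv ?c c p) (at (cmap ?c p))"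
    by (rule has_derivative_transform_eventually) (use cA cA' in \<open>auto simp: cinv_cmap\<close>)
  from frechet_derivative_at[OF this]
  have "dqE t p v = blinfun_apply (DE c (t, cmap c p)) (0, transition_deriv ?c c p (v ?c))"
    unfolding dqE_def by (metis comp_apply)
  moreover have "transition_deriv ?c c p (v ?c) = v c"
    using v c c' unfolding tangent_space_def mem_Collect_eq by metis
  ultimately show ?thesis by simp
qed

section \<open>The slope in charts\<close>

definition ratio :: "('q, 'e) chart \<Rightarrow> (real \<times> 'q) \<times> 'e \<Rightarrow> real" where
  "ratio c z = blinfun_apply (DE c (fst (fst z), cmap c (snd (fst z)))) (0, snd z) / cnorm c (snd (fst z)) (snd z)"

lemma ratio_continuous:
  assumes c: "c \<in> atlas"
  shows "continuous_on (({0..T} \<times> cdom c) \<times> sphere 0 1) (ratio c)"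
  unfolding ratio_def[abs_def]
proof (rule continuous_on_divide)
  let ?A = "({0..T} \<times> cdom c) \<times> (sphere 0 1 :: 'e set)"
  have "continuous_on ({0..T} \<times> cdom c) (\<lambda>z. DE c ((\<lambda>(t, p). (t, cmap c p)) z))"
    by (rule continuous_on_compose2[OF DE(1)[OF c] chart_pair_continuous[OF c]]) auto
  then have "continuous_on ?A (\<lambda>z. DE c ((\<lambda>(t, p). (t, cmap c p)) (fst z)))"
    by (rule continuous_on_compose2) (auto intro!: continuous_intros)
  then have "continuous_on ?A (\<lambda>z. DE c (fst (fst z), cmap c (snd (fst z))))"
    by (simp add: case_prod_unfold)
  then show "continuous_on ?A (\<lambda>z. blinfun_apply (DE c (fst (fst z), cmap c (snd (fst z)))) (0, snd z))"
    by (intro continuous_intros)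
  have "continuous_on ?A (\<lambda>z. (snd (fst z), snd z))" by (intro continuous_intros)
  then have "continuous_on ?A (\<lambda>z. case (snd (fst z), snd z) of (p, w) \<Rightarrow> cnorm c p w)"
    by (rule continuous_on_compose2[OF cnorm_continuous[OF c]]) auto
  then show "continuous_on ?A (\<lambda>z. cnorm c (snd (fst z)) (snd z))" by simp
  show "\<forall>z\<in>?A. cnorm c (snd (fst z)) (snd z) \<noteq> 0"
  proof
    fix z assume "z \<in> ?A"
    then have "c \<in> charts_at (snd (fst z))" "snd z \<noteq> 0" using c by (auto simp: charts_at_def)
    then show "cnorm c (snd (fst z)) (snd z) \<noteq> 0" by (simp add: cnorm_eq_0_iff)
  qed
qed

text \<open>The quotient is homogeneous of degree zero, so unit coordinate vectors suffice. This
  makes the index set compact and independent of the base point.\<close>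

lemma slope_eq:
  assumes c: "c \<in> charts_at p" and t: "t \<in> {0..T}"
  shows "slope t p = (SUP w\<in>sphere 0 1. ratio c ((t, p), w))"
proof -
  have "(\<lambda>v. dqE t p v / R1 p v) ` (tangent_space p - {\<lambda>c. 0}) = (\<lambda>w. ratio c ((t, p), w)) ` sphere 0 1"
  proof (intro equalityI subsetI)
    fix x assume "x \<in> (\<lambda>v. dqE t p v / R1 p v) ` (tangent_space p - {\<lambda>c. 0})"
    then obtain v where v: "v \<in> tangent_space p" "v \<noteq> (\<lambda>c. 0)" and x: "x = dqE t p v / R1 p v" by blast
    define w where "w = v c"
    have vw: "v = tangent_vector c p w" using tangent_vector_of_coord[OF c v(1)] by (simp add: w_def)
    have w0: "w \<noteq> 0" using v(2) vw tangent_vector_eq_0_iff[OF c] by simp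
    have R: "R1 p v = norm w * cnorm c p (w /\<^sub>R norm w)"
      using cnorm_unit[OF c w0] unfolding vw cnorm_def .
    have "(0::real, w) = norm w *\<^sub>R (0, w /\<^sub>R norm w)" using w0 by simp
    then have "dqE t p v = norm w * blinfun_apply (DE c (t, cmap c p)) (0, w /\<^sub>R norm w)"
      unfolding dqE_eq[OF c t v(1)] w_def[symmetric] by (metis blinfun.scaleR_right real_scaleR_def)
    then have "x = ratio c ((t, p), w /\<^sub>R norm w)" unfolding x R ratio_def using w0 by simp
    moreover have "w /\<^sub>R norm w \<in> sphere 0 1" using w0 by simp
    ultimately show "x \<in> (\<lambda>w. ratio c ((t, p), w)) ` sphere 0 1" by blast
  next
    fix x assume "x \<in> (\<lambda>w. ratio c ((t, p), w)) ` sphere 0 1"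
    then obtain w where w: "w \<in> sphere 0 1" "x = ratio c ((t, p), w)" by blast
    let ?v = "tangent_vector c p w"
    have "w \<noteq> 0" using w(1) by auto
    then have v: "?v \<in> tangent_space p" "?v \<noteq> (\<lambda>c. 0)"
      using tangent_vector_in[OF c] tangent_vector_eq_0_iff[OF c] by auto
    have "x = dqE t p ?v / R1 p ?v"
      unfolding w(2) dqE_eq[OF c t v(1)] ratio_def tangent_vector_coord[OF c] cnorm_def by simp
    then show "x \<in> (\<lambda>v. dqE t p v / R1 p v) ` (tangent_space p - {\<lambda>c. 0})" using v by blast
  qed
  then show ?thesis unfolding slope_def by simp
qed

lemma ratio_bdd:
  assumes c: "c \<in> charts_at p" and t: "t \<in> {0..T}"
  shows "bdd_above ((\<lambda>w. ratio c ((t, p), w)) ` sphere 0 1)"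
proof -
  have "continuous_on (sphere 0 1) (\<lambda>w. ratio c ((t, p), w))"
    by (rule continuous_on_compose2[OF ratio_continuous[OF charts_atD(1)[OF c]]])
      (use t charts_atD(2)[OF c] in \<open>auto intro!: continuous_intros\<close>)
  then have "compact ((\<lambda>w. ratio c ((t, p), w)) ` sphere 0 1)"
    using compact_sphere by (rule compact_continuous_image)
  then show ?thesis by (intro bounded_imp_bdd_above compact_imp_bounded)
qed

lemma DE_le_slope:
  assumes c: "c \<in> charts_at p" and t: "t \<in> {0..T}"
  shows "blinfun_apply (DE c (t, cmap c p)) (0, w) \<le> slope t p * cnorm c p w"
proof (cases "w = 0")
  case True
  have "blinfun_apply (DE c (t, cmap c p)) (0, 0) = 0" using blinfun.zero_right by (metis zero_prod_def)
  then show ?thesis using True cnorm_eq_0_iff[OF c, of 0] by simp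
next
  case False
  let ?u = "w /\<^sub>R norm w"
  have u: "?u \<in> sphere 0 1" "?u \<noteq> 0" using False by auto
  have "ratio c ((t, p), ?u) \<le> slope t p"
    unfolding slope_eq[OF c t] by (rule cSUP_upper[OF u(1) ratio_bdd[OF c t]])
  then have "blinfun_apply (DE c (t, cmap c p)) (0, ?u) \<le> slope t p * cnorm c p ?u"
    using cnorm_pos[OF c u(2)] by (simp add: ratio_def field_simps)
  then have "norm w * blinfun_apply (DE c (t, cmap c p)) (0, ?u) \<le> norm w * (slope t p * cnorm c p ?u)"
    by (rule mult_left_mono) simp
  moreover have "(0::real, w) = norm w *\<^sub>R (0, ?u)" using False by simp
  then have "blinfun_apply (DE c (t, cmap c p)) (0, w) = norm w * blinfun_apply (DE c (t, cmap c p)) (0, ?u)"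
    by (metis blinfun.scaleR_right real_scaleR_def)
  ultimately show ?thesis unfolding cnorm_unit[OF c False] by (simp add: algebra_simps)
qed

lemma slope_leI:
  assumes c: "c \<in> charts_at p" and t: "t \<in> {0..T}"
    and le: "\<And>w. blinfun_apply (DE c (t, cmap c p)) (0, w) \<le> b * cnorm c p w"
  shows "slope t p \<le> b"
  unfolding slope_eq[OF c t]
proof (rule cSUP_least[OF sphere_nonempty])
  fix w :: 'e assume "w \<in> sphere 0 1"
  then have "w \<noteq> 0" by auto
  then show "ratio c ((t, p), w) \<le> b"
    using le[of w] cnorm_pos[OF c] by (simp add: ratio_def field_simps)
qed

text \<open>The vectors \<open>w\<close> and \<open>- w\<close> have equal norm and opposite
  pairings with the differential, so one of the two quotients is nonnegative.\<close>

lemma slope_nonneg: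
  assumes t: "t \<in> {0..T}"
  shows "0 \<le> slope t p"
proof -
  obtain c where c: "c \<in> charts_at p" using charts_at_nonempty by blast
  obtain w :: 'e where w: "w \<in> sphere 0 1" using sphere_nonempty by blast
  then have w0: "w \<noteq> 0" by auto
  have "(0::real, - w) = - (0, w)" by simp
  then have "blinfun_apply (DE c (t, cmap c p)) (0, - w) = - blinfun_apply (DE c (t, cmap c p)) (0, w)"
    by (metis blinfun.minus_right)
  moreover have "cnorm c p (- w) = cnorm c p w" using cnorm_scaleR[OF c, of "-1" w] by simp
  ultimately have "0 \<le> slope t p * cnorm c p w"
    using DE_le_slope[OF c t, of w] DE_le_slope[OF c t, of "- w"] by simp
  then show ?thesis using cnorm_pos[OF c w0] by (simp add: zero_le_mult_iff)
qed

lemma slope_continuous: "continuous_on ({0..T} \<times> UNIV) (\<lambda>(t, p). slope t p)"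
proof (rule continuous_on_charts)
  fix c assume c: "c \<in> atlas"
  have "continuous_on ({0..T} \<times> cdom c) (\<lambda>z. SUP w\<in>sphere 0 1. ratio c (z, w))"
    by (rule continuous_on_SUP_compact[OF ratio_continuous[OF c] compact_sphere sphere_nonempty])
  then show "continuous_on ({0..T} \<times> cdom c) (\<lambda>(t, p). slope t p)"
    by (rule continuous_on_eq) (auto intro!: slope_eq[symmetric] simp: charts_at_def c)
qed

lemma slope_continuous_state: "t \<in> {0..T} \<Longrightarrow> continuous_on UNIV (slope t)"
  using continuous_on_compose2[OF slope_continuous, of UNIV "\<lambda>p. (t, p)"] by (force intro!: continuous_intros)

section \<open>Energy differences along curves\<close>

lemma energy_le_slope_local:
  assumes y: "y \<in> AC" and c: "c \<in> atlas" and ab: "0 \<le> a" "a \<le> b" "b \<le> 1" and im: "y ` {a..b} \<subseteq> cdom c"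
    and t: "t \<in> {0..T}"
  shows "\<bar>E t (y b) - E t (y a)\<bar> \<le> integral {a..b} (\<lambda>s. slope t (y s) * speed y s)"
proof -
  obtain N x' where N: "negligible N"
    and der: "\<And>s. s \<in> {a<..<b} - N \<Longrightarrow> ((cmap c \<circ> y) has_vector_derivative x' s) (at s)"
    and vel: "\<And>s. s \<in> {a<..<b} - N \<Longrightarrow> velocity y s = tangent_vector c (y s) (x' s)"
    using AC_local_derivative[OF y c ab im] by metis
  have ch: "c \<in> charts_at (y s)" if "s \<in> {a..b}" for s using im that c by (auto simp: charts_at_def)
  let ?e = "\<lambda>x. E t (cinv c x)"
  let ?G = "\<lambda>s. blinfun_apply (DE c (t, cmap c (y s))) (0, x' s)"
  have ac: "abs_cont_on a b (?e \<circ> (cmap c \<circ> y))"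
  proof (rule abs_cont_on_compose_local_lipschitz[OF AC_D(2)[OF y c ab im] ab(2)])
    fix s assume "a \<le> s" "s \<le> b"
    then have "y s \<in> cdom c" using im by (simp add: image_subset_iff)
    then have "(cmap c \<circ> y) s \<in> cmap c ` cdom c" by simp
    then show "\<exists>r>0. \<exists>L. \<forall>p\<in>ball ((cmap c \<circ> y) s) r. \<forall>z\<in>ball ((cmap c \<circ> y) s) r.
        norm (?e p - ?e z) \<le> L * norm (p - z)"
      by (rule C1_imp_local_lipschitz[where g'="\<lambda>x h. blinfun_apply (DE c (t, x)) (0, h)",
          OF open_chart_image[OF c] _ E_chart_has_derivative[OF c t] DE_snd_continuous[OF c t]])
  qed
  have "(?G has_integral ((?e \<circ> (cmap c \<circ> y)) b - (?e \<circ> (cmap c \<circ> y)) a)) {a..b}"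
  proof (rule has_integral_deriv_abs_cont_on[OF ac ab(2) N])
    fix s assume s: "s \<in> {a<..<b} - N"
    have "y s \<in> cdom c" using im s by (simp add: image_subset_iff)
    then have im': "(cmap c \<circ> y) s \<in> cmap c ` cdom c" by simp
    have "(?e \<circ> (cmap c \<circ> y) has_derivative (\<lambda>h. blinfun_apply (DE c (t, (cmap c \<circ> y) s)) (0, h)) \<circ> (\<lambda>h. h *\<^sub>R x' s)) (at s)"
      using der[OF s] E_chart_has_derivative[OF c t im'] unfolding has_vector_derivative_def by (rule diff_chain_at)
    moreover have "blinfun_apply (DE c (t, (cmap c \<circ> y) s)) (0, h *\<^sub>R x' s) = h *\<^sub>R ?G s" for h
      using blinfun.scaleR_right[of "DE c (t, (cmap c \<circ> y) s)" h "(0, x' s)"] by simp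
    ultimately show "(?e \<circ> (cmap c \<circ> y) has_vector_derivative ?G s) (at s)"
      unfolding has_vector_derivative_def o_def by simp
  qed
  moreover have "(?e \<circ> (cmap c \<circ> y)) b = E t (y b)" "(?e \<circ> (cmap c \<circ> y)) a = E t (y a)"
    using im ab by (auto simp: cinv_cmap[OF c] image_subset_iff)
  ultimately have "(?G has_integral (E t (y b) - E t (y a))) {a..b}" by simp
  moreover have "((\<lambda>s. slope t (y s) * speed y s) has_integral integral {a..b} (\<lambda>s. slope t (y s) * speed y s)) {a..b}"
  proof (rule integrable_integral[OF integrable_on_subinterval])
    show "(\<lambda>s. slope t (y s) * speed y s) integrable_on {0..1}"
      using wlen_has_integral[OF y slope_continuous_state[OF t]] by (rule has_integral_integrable)
  qed (use ab in auto)
  ultimately have "norm (E t (y b) - E t (y a)) \<le> integral {a..b} (\<lambda>s. slope t (y s) * speed y s)"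
  proof (rule norm_integral_le_ae)
    show "negligible (N \<union> {a, b})" using N by (auto intro: negligible_Un)
    fix s assume s: "s \<in> {a..b} - (N \<union> {a, b})"
    then have c': "c \<in> charts_at (y s)" using ch by auto
    have "speed y s = cnorm c (y s) (x' s)" using vel[of s] s by (simp add: speed_def cnorm_def)
    moreover have "?G s \<le> slope t (y s) * cnorm c (y s) (x' s)" by (rule DE_le_slope[OF c' t])
    moreover have "(0::real, - x' s) = - (0, x' s)" by simp
    then have "blinfun_apply (DE c (t, cmap c (y s))) (0, - x' s) = - ?G s" by (metis blinfun.minus_right)
    \<comment> \<open>The slope is a supremum without absolute value, so the estimate from below
      comes from the opposite direction.\<close>
    then have "- ?G s \<le> slope t (y s) * cnorm c (y s) (- x' s)" using DE_le_slope[OF c' t, of "- x' s"] by simp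
    moreover have "cnorm c (y s) (- x' s) = cnorm c (y s) (x' s)" using cnorm_scaleR[OF c', of "-1" "x' s"] by simp
    ultimately show "norm (?G s) \<le> slope t (y s) * speed y s" by simp
  qed
  then show ?thesis by simp
qed

lemma energy_le_slope:
  assumes y: "y \<in> AC" and ab: "0 \<le> a" "a \<le> b" "b \<le> 1" and t: "t \<in> {0..T}"
  shows "\<bar>E t (y b) - E t (y a)\<bar> \<le> integral {a..b} (\<lambda>s. slope t (y s) * speed y s)"
proof -
  let ?f = "\<lambda>s. slope t (y s) * speed y s"
  define Q where "Q u w \<longleftrightarrow> (0 \<le> u \<and> w \<le> 1 \<longrightarrow> \<bar>E t (y w) - E t (y u)\<bar> \<le> integral {u..w} ?f)" for u w
  have "Q a b"
  proof (rule Bolzano[OF ab(2), of Q])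
    fix u v w assume Q: "Q u v" "Q v w" "u \<le> v" "v \<le> w"
    show "Q u w" unfolding Q_def
    proof
      assume uw: "0 \<le> u \<and> w \<le> 1"
      have "?f integrable_on {0..1}"
        using wlen_has_integral[OF y slope_continuous_state[OF t]] by (rule has_integral_integrable)
      then have "?f integrable_on {u..w}" by (rule integrable_on_subinterval) (use uw in auto)
      from Henstock_Kurzweil_Integration.integral_combine[OF Q(3,4) this]
      show "\<bar>E t (y w) - E t (y u)\<bar> \<le> integral {u..w} ?f"
        using Q uw unfolding Q_def by auto
    qed
  next
    fix s :: real assume "a \<le> s" "s \<le> b"
    then have s: "0 \<le> s" "s \<le> 1" using ab by auto
    obtain c where c: "c \<in> charts_at (y s)" using charts_at_nonempty by blast
    obtain d where d: "d > 0" "\<And>u v. 0 \<le> u \<Longrightarrow> u \<le> s \<Longrightarrow> s \<le> v \<Longrightarrow> v \<le> 1 \<Longrightarrow> v - u < d \<Longrightarrow> y ` {u..v} \<subseteq> cdom c"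
      using curve_local_chart[OF AC_D(1)[OF y] s open_cdom[OF charts_atD(1)[OF c]] charts_atD(2)[OF c]] by metis
    show "\<exists>d>0. \<forall>u w. u \<le> s \<and> s \<le> w \<and> w - u < d \<longrightarrow> Q u w"
    proof (rule exI[of _ d], intro conjI allI impI d(1))
      fix u w assume uw: "u \<le> s \<and> s \<le> w \<and> w - u < d"
      show "Q u w" unfolding Q_def
        using energy_le_slope_local[OF y charts_atD(1)[OF c] _ _ _ _ t, of u w] d(2)[of u w] uw by auto
    qed
  qed
  then show ?thesis using ab by (simp add: Q_def)
qed

lemma S0_eq_wdist:
  assumes t: "t \<in> {0..T}"
  shows "S0 t p q = wdist (slope t) p q"
  unfolding S0_def wdist_def
  by (rule INF_cong[OF refl]) (simp add: wlen_eq_LINT slope_continuous_state[OF t] admissible_def)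

lemma energy_le_S0:
  assumes t: "t \<in> {0..T}"
  shows "\<bar>E t q - E t p\<bar> \<le> S0 t p q"
  unfolding S0_eq_wdist[OF t] wdist_def
proof (rule cINF_greatest[OF admissible_nonempty])
  fix y assume y: "y \<in> admissible p q"
  then show "\<bar>E t q - E t p\<bar> \<le> wlen (slope t) y"
    using energy_le_slope[of y 0 1, OF _ _ _ _ t] unfolding wlen_def by (simp add: admissible_def)
qed

text \<open>Stability is tested against the points reached from \<open>p\<close> along a short chart
  segment in direction \<open>- w\<close>. Their distance is at most \<open>h\<close> times the norm
  of \<open>w\<close> up to a small \<open>e\<close>, by continuity of the norm in the base point.
  Dividing by \<open>h\<close> and letting it tend to 0 bounds the pairing with
  \<open>w\<close>.\<close>

lemma slope_le_one_of_stable: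
  assumes t: "t \<in> {0..T}" and stable: "\<And>q. E t p \<le> E t q + dissip_dist p q"
  shows "slope t p \<le> 1"
proof -
  obtain c where c: "c \<in> charts_at p" using charts_at_nonempty by blast
  note cA = charts_atD[OF c]
  show ?thesis
  proof (rule slope_leI[OF c t])
    fix w :: 'e
    define x0 where "x0 = cmap c p"
    have x0: "x0 \<in> cmap c ` cdom c" "cinv c x0 = p" using cA by (auto simp: x0_def cinv_cmap)
    let ?v = "- w"
    let ?D = "blinfun_apply (DE c (t, x0))"
    have D: "?D (0, ?v) = - ?D (0, w)"
      using blinfun.minus_right[of "DE c (t, x0)" "(0, w)"] by simp
    have "?D (0, w) \<le> cnorm c p ?v"
    proof (rule field_le_epsilon)
      fix e :: real assume e: "e > 0"
      then have e2: "e / 2 > 0" by simp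
      have "continuous_on (cmap c ` cdom c) (\<lambda>x. case (cinv c x, ?v) of (p, w) \<Rightarrow> cnorm c p w)"
        by (rule continuous_on_compose2[OF cnorm_continuous[OF cA(1)]])
          (auto intro!: continuous_intros continuous_on_cinv[OF cA(1)] cinv_in_cdom[OF cA(1)])
      then have "isCont (\<lambda>x. cnorm c (cinv c x) ?v) x0"
        using x0(1) open_chart_image[OF cA(1)] continuous_on_eq_continuous_at by auto
      then obtain r1 where r1: "r1 > 0" "\<And>x. dist x x0 < r1 \<Longrightarrow> dist (cnorm c (cinv c x) ?v) (cnorm c p ?v) < e / 2"
        unfolding continuous_at_eps_delta using e2 x0(2) by metis
      obtain r2 where r2: "r2 > 0" "ball x0 r2 \<subseteq> cmap c ` cdom c"
        using x0(1) open_chart_image[OF cA(1)] open_contains_ball by blast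
      have ev: "((\<lambda>h. E t (cinv c (x0 + h *\<^sub>R ?v))) has_real_derivative ?D (0, ?v)) (at 0)"
      proof -
        have "((\<lambda>x. E t (cinv c x)) \<circ> (\<lambda>h. x0 + h *\<^sub>R ?v) has_derivative (\<lambda>h. ?D (0, h)) \<circ> (\<lambda>h. h *\<^sub>R ?v)) (at 0)"
          by (rule diff_chain_at) (use E_chart_has_derivative[OF cA(1) t x0(1)] in \<open>auto intro!: derivative_eq_intros\<close>)
        moreover have "?D (0, h *\<^sub>R ?v) = ?D (0, ?v) * h" for h
          using blinfun.scaleR_right[of "DE c (t, x0)" h "(0, ?v)"] by simp
        ultimately show ?thesis by (simp add: o_def has_field_derivative_def)
      qed
      then have "((\<lambda>h. (E t (cinv c (x0 + h *\<^sub>R ?v)) - E t p) / h) \<longlongrightarrow> ?D (0, ?v)) (at 0)"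
        using x0(2) by (simp add: has_field_derivative_iff)
      then have "((\<lambda>h. (E t (cinv c (x0 + h *\<^sub>R ?v)) - E t p) / h) \<longlongrightarrow> ?D (0, ?v)) (at_right 0)"
        by (rule tendsto_within_subset) simp
      moreover have "eventually (\<lambda>h. - (cnorm c p ?v + e) \<le> (E t (cinv c (x0 + h *\<^sub>R ?v)) - E t p) / h) (at_right 0)"
      proof -
        \<comment> \<open>For h < \<eta> the segment stays in both balls; the summand 1 avoids a
          zero denominator for w = 0.\<close>
        define \<eta> where "\<eta> = min r1 r2 / (norm w + 1)"
        have \<eta>: "\<eta> > 0" using r1 r2 by (simp add: \<eta>_def add_nonneg_pos)
        have "- (cnorm c p ?v + e) \<le> (E t (cinv c (x0 + h *\<^sub>R ?v)) - E t p) / h" if h: "0 < h" "h < \<eta>" for h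
        proof -
          have small: "x0 + s *\<^sub>R (h *\<^sub>R ?v) \<in> ball x0 r1 \<inter> ball x0 r2" if s: "0 \<le> s" "s \<le> 1" for s
          proof -
            have "norm (s *\<^sub>R (h *\<^sub>R ?v)) \<le> 1 * (h * norm w)"
              using s h by (simp add: mult_left_le_one_le)
            also have "\<dots> \<le> h * (norm w + 1)" using h by simp
            also have "\<dots> < min r1 r2" using h by (simp add: \<eta>_def pos_less_divide_eq add_nonneg_pos)
            finally show ?thesis by (simp add: dist_norm)
          qed
          have ch: "c \<in> charts_at (cinv c x)" if "x \<in> cmap c ` cdom c" for x
            using cinv_in_cdom[OF cA(1) that] cA by (simp add: charts_at_def)
          have "dissip_dist (cinv c x0) (cinv c (x0 + h *\<^sub>R ?v)) \<le> h * (cnorm c p ?v + e)"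
          proof (rule dissip_dist_line_le[OF cA(1)])
            fix s :: real assume s: "0 \<le> s" "s \<le> 1"
            let ?x = "x0 + s *\<^sub>R (h *\<^sub>R ?v)"
            show im: "?x \<in> cmap c ` cdom c" using small[OF s] r2(2) by blast
            have "cnorm c (cinv c ?x) ?v \<le> cnorm c p ?v + e"
            proof -
              have "dist ?x x0 < r1" using IntD1[OF small[OF s]] by (simp only: mem_ball dist_commute)
              from r1(2)[OF this] show ?thesis using e unfolding dist_real_def by linarith
            qed
            then show "cnorm c (cinv c ?x) (h *\<^sub>R ?v) \<le> h * (cnorm c p ?v + e)"
              using cnorm_scaleR[OF ch[OF im], of h ?v] h by (simp add: mult_left_mono)
          qed
          then have "E t p \<le> E t (cinv c (x0 + h *\<^sub>R ?v)) + h * (cnorm c p ?v + e)"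
            using stable[of "cinv c (x0 + h *\<^sub>R ?v)"] x0(2) by simp
          then show ?thesis using h by (simp add: field_simps)
        qed
        then show ?thesis unfolding eventually_at_right_field using \<eta> by blast
      qed
      ultimately have "- (cnorm c p ?v + e) \<le> ?D (0, ?v)"
        by (intro tendsto_lowerbound) auto
      then show "?D (0, w) \<le> cnorm c p ?v + e" using D by simp
    qed
    moreover have "cnorm c p ?v = cnorm c p w" using cnorm_scaleR[OF c, of "-1" w] by simp
    ultimately show "blinfun_apply (DE c (t, cmap c p)) (0, w) \<le> 1 * cnorm c p w" by (simp add: x0_def)
  qed
qed

end

section \<open>Functions of bounded variation\<close>

lemma infsum_emeasure_singletons:
  assumes X: "countable X" and sets: "\<And>x. x \<in> X \<Longrightarrow> {x} \<in> sets M"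
  shows "(\<Sum>\<^sub>\<infinity>x\<in>X. emeasure M {x}) = emeasure M X"
proof (cases "finite X")
  case True
  then show ?thesis using emeasure_eq_sum_singleton[OF True sets] by simp
next
  case False
  let ?f = "from_nat_into X" and ?g = "\<lambda>x. emeasure M {x}"
  have bij: "bij_betw ?f UNIV X" using bij_betw_from_nat_into[OF X False] .
  have "infsum ?g X = infsum (\<lambda>n. ?g (?f n)) UNIV"
    by (rule infsum_reindex_bij_betw[OF bij, symmetric])
  also have "\<dots> = (\<Sum>n. ?g (?f n))"
  proof -
    have "(\<lambda>n. ?g (?f n)) summable_on UNIV" by (rule nonneg_summable_on_complete) simp
    from has_sum_imp_sums[OF has_sum_infsum[OF this]] show ?thesis by (simp add: sums_unique)
  qed
  also have "\<dots> = emeasure M (\<Union>n. {?f n})"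
  proof (rule suminf_emeasure)
    show "disjoint_family (\<lambda>n. {?f n})"
      using bij by (auto simp: disjoint_family_on_def bij_betw_def inj_on_def)
    show "range (\<lambda>n. {?f n}) \<subseteq> sets M" using bij sets by (auto simp: bij_betw_def)
  qed
  also have "(\<Union>n. {?f n}) = X" using bij by (auto simp: bij_betw_def)
  finally show ?thesis .
qed

text \<open>Serves to approach an endpoint through times at which the variation measure is
  prescribed: \<open>D\<close> will be \<open>cont_set q\<close> or its reflection.\<close>

lemma decseq_dense:
  fixes a b :: real
  assumes ab: "a < b" and dense: "\<And>u v. a \<le> u \<Longrightarrow> u < v \<Longrightarrow> v \<le> b \<Longrightarrow> \<exists>x\<in>D. u < x \<and> x < v"
  obtains s where "decseq s" "\<And>n. s n \<in> D" "\<And>n. a < s n" "\<And>n::nat. s n < b" "s \<longlonglongrightarrow> a"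
proof -
  have "\<exists>s. \<forall>n. (s n \<in> D \<and> a < s n \<and> s n < a + (b - a) / real (n + 1)) \<and> s (Suc n) \<le> s n"
  proof (rule dependent_nat_choice)
    show "\<exists>x. x \<in> D \<and> a < x \<and> x < a + (b - a) / real (0 + 1)"
      using dense[of a b] ab by auto
    fix x n assume x: "x \<in> D \<and> a < x \<and> x < a + (b - a) / real (n + 1)"
    let ?v = "min x (a + (b - a) / real (Suc n + 1))"
    have "(b - a) / real (Suc n + 1) > 0" "(b - a) / real (Suc n + 1) \<le> b - a"
      using ab divide_left_mono[of 1 "real (Suc n + 1)" "b - a"] by simp_all
    then have "a < ?v" "?v \<le> b" using x by auto
    from dense[OF order_refl this] show "\<exists>y. (y \<in> D \<and> a < y \<and> y < a + (b - a) / real (Suc n + 1)) \<and> y \<le> x"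
      by auto
  qed
  then obtain s where s: "\<And>n. s n \<in> D" "\<And>n. a < s n" "\<And>n. s n < a + (b - a) / real (n + 1)" "\<And>n. s (Suc n) \<le> s n"
    by blast
  have "(\<lambda>n. a + (b - a) / real (n + 1)) \<longlonglongrightarrow> a + 0"
    by (intro tendsto_add tendsto_const) (use LIMSEQ_ignore_initial_segment[OF lim_const_over_n[of "b - a"], of 1] in simp)
  then have lim: "s \<longlonglongrightarrow> a"
    by (intro tendsto_sandwich[OF always_eventually always_eventually tendsto_const[of a], of s "\<lambda>n. a + (b - a) / real (n + 1)"])
      (use s in \<open>auto simp: less_imp_le\<close>)
  have "s n < b" for n
  proof -
    have "(b - a) / real (n + 1) \<le> b - a" using ab divide_left_mono[of 1 "real (n + 1)" "b - a"] by simp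
    then show ?thesis using s(3)[of n] by linarith
  qed
  then show ?thesis using that[of s] s lim by (simp add: decseq_Suc_iff)
qed

lemma mono_on_left_limit:
  fixes f :: "real \<Rightarrow> real"
  assumes f: "mono_on {a..b} f" and t: "a < t" "t \<le> b"
  obtains W where "(f \<longlongrightarrow> W) (at_left t)" "\<And>s. a \<le> s \<Longrightarrow> s < t \<Longrightarrow> f s \<le> W" "W \<le> f t"
proof -
  let ?W = "Sup (f ` {a..<t})"
  have le: "f s \<le> f t" if "s \<in> {a..<t}" for s using mono_onD[OF f, of s t] that t by auto
  have bdd: "bdd_above (f ` {a..<t})" using le by (intro bdd_aboveI2)
  have up: "f s \<le> ?W" if "a \<le> s" "s < t" for s using cSUP_upper[OF _ bdd, of s] that by auto
  have "(f \<longlongrightarrow> ?W) (at_left t)"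
  proof (rule tendstoI)
    fix e :: real assume "e > 0"
    then obtain x where "x \<in> f ` {a..<t}" "?W - e < x"
      using less_cSupD[of "f ` {a..<t}" "?W - e"] t by auto
    then obtain s where s: "a \<le> s" "s < t" "?W - e < f s" by auto
    show "eventually (\<lambda>x. dist (f x) ?W < e) (at_left t)"
      unfolding eventually_at_left_field
    proof (intro exI[of _ s] conjI allI impI s(2))
      fix r assume r: "r > s" "r < t"
      then have "f s \<le> f r" using mono_onD[OF f, of s r] s t by auto
      moreover have "f r \<le> ?W" using up r s by auto
      ultimately show "dist (f r) ?W < e" using s(3) by (simp add: dist_real_def)
    qed
  qed
  moreover have "?W \<le> f t" using t le by (intro cSUP_least) auto
  ultimately show ?thesis using up that by blast
qed

lemma mono_on_right_limit:
  fixes f :: "real \<Rightarrow> real"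
  assumes f: "mono_on {a..b} f" and t: "a \<le> t" "t < b"
  obtains W where "(f \<longlongrightarrow> W) (at_right t)" "\<And>s. t < s \<Longrightarrow> s \<le> b \<Longrightarrow> W \<le> f s" "f t \<le> W"
proof -
  let ?W = "Inf (f ` {t<..b})"
  have le: "f t \<le> f s" if "s \<in> {t<..b}" for s using mono_onD[OF f, of t s] that t by auto
  have bdd: "bdd_below (f ` {t<..b})" using le by (intro bdd_belowI2)
  have up: "?W \<le> f s" if "t < s" "s \<le> b" for s using cINF_lower[OF bdd, of s] that by auto
  have "(f \<longlongrightarrow> ?W) (at_right t)"
  proof (rule tendstoI)
    fix e :: real assume "e > 0"
    then obtain x where "x \<in> f ` {t<..b}" "x < ?W + e"
      using cInf_lessD[of "f ` {t<..b}" "?W + e"] t by auto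
    then obtain s where s: "t < s" "s \<le> b" "f s < ?W + e" by auto
    show "eventually (\<lambda>x. dist (f x) ?W < e) (at_right t)"
      unfolding eventually_at_right_field
    proof (intro exI[of _ s] conjI allI impI s(1))
      fix r assume r: "r > t" "r < s"
      then have "f r \<le> f s" using mono_onD[OF f, of r s] s t by auto
      moreover have "?W \<le> f r" using up r s by auto
      ultimately show "dist (f r) ?W < e" using s(3) by (simp add: dist_real_def)
    qed
  qed
  moreover have "f t \<le> ?W" using t le by (intro cINF_greatest) auto
  ultimately show ?thesis using up that by blast
qed

context rate_independent_system begin

section \<open>Variation over intervals\<close>

lemma Var_mono: "A \<subseteq> B \<Longrightarrow> Var q A \<le> Var q B"
  unfolding Var_def by (rule SUP_subset_mono) auto

text \<open>The sums telescope to the increment of \<open>G\<close> between the first and the last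
  node. These need not be the endpoints, but \<open>G\<close> is monotone because distances are
  nonnegative.\<close>

lemma Var_le_increment:
  assumes ab: "a \<le> b"
    and G: "\<And>s s'. a \<le> s \<Longrightarrow> s \<le> s' \<Longrightarrow> s' \<le> b \<Longrightarrow> dissip_dist (q s) (q s') \<le> G s' - G s"
  shows "Var q {a..b} \<le> ennreal (G b - G a)"
  unfolding Var_def
proof (rule SUP_least)
  fix z assume "z \<in> {(n::nat, \<tau>::nat \<Rightarrow> real). (\<forall>j\<le>n. \<tau> j \<in> {a..b}) \<and> (\<forall>j<n. \<tau> j < \<tau> (Suc j))}"
  then obtain n \<tau> where z: "z = (n, \<tau>)" and \<tau>: "\<And>j. j \<le> n \<Longrightarrow> \<tau> j \<in> {a..b}" "\<And>j. j < n \<Longrightarrow> \<tau> j < \<tau> (Suc j)"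
    by auto
  have le: "dissip_dist (q (\<tau> j)) (q (\<tau> (Suc j))) \<le> G (\<tau> (Suc j)) - G (\<tau> j)" if "j < n" for j
    using G[of "\<tau> j" "\<tau> (Suc j)"] \<tau>(1)[of j] \<tau>(1)[of "Suc j"] \<tau>(2)[OF that] that by auto
  have "(\<Sum>j<n. ennreal (dissip_dist (q (\<tau> j)) (q (\<tau> (Suc j))))) = ennreal (\<Sum>j<n. dissip_dist (q (\<tau> j)) (q (\<tau> (Suc j))))"
    by (rule sum_ennreal) (rule dissip_dist_nonneg)
  also have "\<dots> \<le> ennreal (\<Sum>j<n. G (\<tau> (Suc j)) - G (\<tau> j))"
    by (intro ennreal_leI sum_mono le) auto
  also have "(\<Sum>j<n. G (\<tau> (Suc j)) - G (\<tau> j)) = G (\<tau> n) - G (\<tau> 0)"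
    by (rule sum_lessThan_telescope)
  also have "ennreal (G (\<tau> n) - G (\<tau> 0)) \<le> ennreal (G b - G a)"
  proof (rule ennreal_leI)
    have "a \<le> \<tau> 0" "\<tau> n \<le> b" "\<tau> 0 \<le> b" "a \<le> \<tau> n" using \<tau>(1)[of 0] \<tau>(1)[of n] by auto
    then show "G (\<tau> n) - G (\<tau> 0) \<le> G b - G a"
      using order_trans[OF dissip_dist_nonneg G[of a "\<tau> 0"]] order_trans[OF dissip_dist_nonneg G[of "\<tau> n" b]] by linarith
  qed
  finally show "(case z of (n, \<tau>) \<Rightarrow> \<Sum>j<n. ennreal (dissip_dist (q (\<tau> j)) (q (\<tau> (Suc j))))) \<le> ennreal (G b - G a)"
    by (simp add: z)
qed

text \<open>Appending s' to a partition of {a..s} works directly if its last node is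
  \<open>s\<close>. Otherwise \<open>s\<close> is inserted first, which only adds a nonnegative
  term.\<close>

lemma Var_superadditive:
  assumes s: "a \<le> s" "s \<le> s'"
  shows "Var q {a..s} + ennreal (dissip_dist (q s) (q s')) \<le> Var q {a..s'}"
proof (cases "s = s'")
  case False
  then have ss: "s < s'" using s by simp
  let ?P = "\<lambda>I. {(n::nat, \<tau>::nat \<Rightarrow> real). (\<forall>j\<le>n. \<tau> j \<in> I) \<and> (\<forall>j<n. \<tau> j < \<tau> (Suc j))}"
  let ?v = "\<lambda>(n, \<tau>). \<Sum>j<n. ennreal (dissip_dist (q (\<tau> j)) (q (\<tau> (Suc j))))"
  have app: "(Suc n, \<tau>(Suc n := x)) \<in> ?P {a..s'} \<and>
      ?v (Suc n, \<tau>(Suc n := x)) = ?v (n, \<tau>) + ennreal (dissip_dist (q (\<tau> n)) (q x))"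
    if "(n, \<tau>) \<in> ?P {a..s'}" "\<tau> n < x" "x \<le> s'" for n \<tau> x
  proof
    have P: "\<forall>j\<le>n. \<tau> j \<in> {a..s'}" "\<forall>j<n. \<tau> j < \<tau> (Suc j)" using that(1) by simp_all
    have "(\<tau>(Suc n := x)) j \<in> {a..s'}" if "j \<le> Suc n" for j
      using P(1)[rule_format, of j] P(1)[rule_format, of n] that \<open>\<tau> n < x\<close> \<open>x \<le> s'\<close>
      by (cases "j = Suc n") auto
    moreover have "(\<tau>(Suc n := x)) j < (\<tau>(Suc n := x)) (Suc j)" if "j < Suc n" for j
      using P(2)[rule_format, of j] that \<open>\<tau> n < x\<close> by (cases "j = n") auto
    ultimately show "(Suc n, \<tau>(Suc n := x)) \<in> ?P {a..s'}" by blast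
    have "(\<Sum>j<n. ennreal (dissip_dist (q ((\<tau>(Suc n := x)) j)) (q ((\<tau>(Suc n := x)) (Suc j)))))
        = (\<Sum>j<n. ennreal (dissip_dist (q (\<tau> j)) (q (\<tau> (Suc j)))))"
      by (rule sum.cong) auto
    then show "?v (Suc n, \<tau>(Suc n := x)) = ?v (n, \<tau>) + ennreal (dissip_dist (q (\<tau> n)) (q x))" by simp
  qed
  have "(0::nat, \<lambda>_::nat. s) \<in> ?P {a..s}" using s by simp
  then have ne: "?P {a..s} \<noteq> {}" by (rule ex_in_conv[THEN iffD1, OF exI])
  have "Var q {a..s} + ennreal (dissip_dist (q s) (q s')) = (SUP z\<in>?P {a..s}. ?v z + ennreal (dissip_dist (q s) (q s')))"
    unfolding Var_def by (rule ennreal_SUP_add_left[OF ne, symmetric])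
  also have "\<dots> \<le> Var q {a..s'}"
  proof (rule SUP_least)
    fix z assume zP: "z \<in> ?P {a..s}"
    obtain n \<tau> where z: "z = (n, \<tau>)" by (cases z)
    have P: "(n, \<tau>) \<in> ?P {a..s'}" using zP z ss by force
    have "\<tau> n \<le> s" using zP z by auto
    then consider "\<tau> n = s" | "\<tau> n < s" by linarith
    then show "?v z + ennreal (dissip_dist (q s) (q s')) \<le> Var q {a..s'}"
    proof cases
      case 1
      have A: "(Suc n, \<tau>(Suc n := s')) \<in> ?P {a..s'}" "?v (Suc n, \<tau>(Suc n := s')) = ?v (n, \<tau>) + ennreal (dissip_dist (q s) (q s'))"
        using app[OF P, of s'] 1 ss by auto
      show ?thesis unfolding z A(2)[symmetric] Var_def by (rule SUP_upper[OF A(1)])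
    next
      case 2
      let ?\<tau> = "\<tau>(Suc n := s)"
      have A: "(Suc n, ?\<tau>) \<in> ?P {a..s'}" "?v (Suc n, ?\<tau>) = ?v (n, \<tau>) + ennreal (dissip_dist (q (\<tau> n)) (q s))"
        using app[OF P 2] ss by auto
      have B: "(Suc (Suc n), ?\<tau>(Suc (Suc n) := s')) \<in> ?P {a..s'}"
        "?v (Suc (Suc n), ?\<tau>(Suc (Suc n) := s')) = ?v (Suc n, ?\<tau>) + ennreal (dissip_dist (q s) (q s'))"
        using app[OF A(1), of s'] ss by auto
      have "?v z + ennreal (dissip_dist (q s) (q s')) \<le> ?v (Suc n, ?\<tau>) + ennreal (dissip_dist (q s) (q s'))"
        unfolding z A(2) by (intro add_right_mono) simp
      also have "\<dots> \<le> Var q {a..s'}" unfolding B(2)[symmetric] Var_def by (rule SUP_upper[OF B(1)])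
      finally show ?thesis .
    qed
  qed
  finally show ?thesis .
qed simp

lemma Var_singleton: "Var q {t..t} = 0"
proof -
  have "Var q {t..t} \<le> ennreal (0 - 0)"
  proof (rule Var_le_increment[where G="\<lambda>_. 0"])
    fix s s' assume "t \<le> s" "s \<le> s'" "s' \<le> t"
    then have "s = s'" by simp
    then show "dissip_dist (q s) (q s') \<le> 0 - 0" by simp
  qed simp
  then show ?thesis by simp
qed

text \<open>The one-sided limits of \<open>V q\<close>, by the lemmas \<open>V_right_limit\<close> and \<open>V_left_limit\<close>.\<close>

definition Vp :: "(real \<Rightarrow> 'q) \<Rightarrow> real \<Rightarrow> real" where
  "Vp q t = V q t + dissip_dist (q t) (right_lim q t)"

definition Vm :: "(real \<Rightarrow> 'q) \<Rightarrow> real \<Rightarrow> real" where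
  "Vm q t = V q t - dissip_dist (left_lim q t) (q t)"

context
  fixes q assumes qBV: "q \<in> BV"
begin

section \<open>The variation function and one-sided limits\<close>

lemma Var_eq_V: "t \<le> T \<Longrightarrow> Var q {0..t} = ennreal (V q t)"
proof -
  assume "t \<le> T"
  then have "Var q {0..t} \<le> Var q {0..T}" by (intro Var_mono) auto
  also have "\<dots> < \<infinity>" using qBV by (simp add: BV_def)
  finally show ?thesis by (simp add: V_def)
qed

lemma V_nonneg: "0 \<le> V q t"
  by (simp add: V_def)

lemma V_0: "V q 0 = 0"
  using Var_singleton[of q 0] by (simp add: V_def)

lemma V_increment:
  assumes "0 \<le> s" "s \<le> s'" "s' \<le> T"
  shows "dissip_dist (q s) (q s') \<le> V q s' - V q s"
proof -
  have "ennreal (V q s + dissip_dist (q s) (q s')) \<le> ennreal (V q s')"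
    using Var_superadditive[OF assms(1,2), of q] assms Var_eq_V
    by (simp add: ennreal_plus V_nonneg dissip_dist_nonneg)
  then show ?thesis using V_nonneg by simp
qed

lemma V_mono: "mono_on {0..T} (V q)"
  unfolding mono_on_def using order_trans[OF dissip_dist_nonneg V_increment] by force

text \<open>The only upper bound on \<open>V\<close> that is needed: it replaces the refinement of partitions in the
  computation of its jumps.\<close>

lemma V_minimal:
  assumes t: "0 \<le> t" "t \<le> T"
    and G: "\<And>s s'. 0 \<le> s \<Longrightarrow> s \<le> s' \<Longrightarrow> s' \<le> t \<Longrightarrow> dissip_dist (q s) (q s') \<le> G s' - G s"
  shows "V q t \<le> G t - G 0"
proof -
  have "ennreal (V q t) \<le> ennreal (G t - G 0)"
    using Var_le_increment[OF t(1), of q G] G Var_eq_V[OF t(2)] by simp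
  moreover have "0 \<le> G t - G 0" using order_trans[OF dissip_dist_nonneg G[of 0 t]] t by simp
  ultimately show ?thesis by simp
qed

text \<open>Points \<open>x n\<close> satisfying the first conditions up to index \<open>n\<close>
  form a Cauchy sequence along \<open>q\<close>. Completeness provides its limit, and the Cauchy
  condition carries the convergence over to the filter. Stating it for a filter serves both
  sides.\<close>

lemma one_sided_limit_exists:
  assumes nt: "F \<noteq> bot"
    and cauchy: "\<And>e. e > 0 \<Longrightarrow> \<exists>P. eventually P F \<and> (\<forall>s s'. P s \<longrightarrow> P s' \<longrightarrow> dissip_dist (q s) (q s') < e)"
  obtains l where "(q \<longlongrightarrow> l) F"
proof -
  have "\<exists>P. eventually P F \<and> (\<forall>s s'. P s \<longrightarrow> P s' \<longrightarrow> dissip_dist (q s) (q s') < inverse (real (Suc n)))" for n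
    by (rule cauchy) simp
  then obtain P where P: "\<And>n. eventually (P n) F"
    "\<And>n s s'. P n s \<Longrightarrow> P n s' \<Longrightarrow> dissip_dist (q s) (q s') < inverse (real (Suc n))" by metis
  have "\<exists>x. \<forall>i\<le>n. P i x" for n :: nat
  proof -
    have "eventually (\<lambda>x. \<forall>i\<in>{..n}. P i x) F" by (rule eventually_ball_finite) (use P(1) in auto)
    from eventually_happens'[OF nt this] show ?thesis by auto
  qed
  then obtain x where x: "\<And>n i. i \<le> n \<Longrightarrow> P i (x n)" by metis
  have "\<exists>N. \<forall>n\<ge>N. \<forall>n'\<ge>N. dissip_dist (q (x n)) (q (x n')) < e" if "e > 0" for e
  proof -
    obtain N where N: "inverse (real (Suc N)) < e" using reals_Archimedean[OF \<open>e > 0\<close>] by blast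
    show ?thesis using P(2)[OF x x] N by (intro exI[of _ N]) (meson less_trans)
  qed
  then obtain l where l: "(\<lambda>n. q (x n)) \<longlonglongrightarrow> l" using Cauchy_converges by metis
  have "(q \<longlongrightarrow> l) F" unfolding tendsto_iff_dissip_dist
  proof (rule tendstoI)
    fix e :: real assume "e > 0"
    then have e: "e / 2 > 0" by simp
    obtain N where N: "inverse (real (Suc N)) < e / 2" using reals_Archimedean[OF e] by blast
    have "eventually (\<lambda>n. dissip_dist l (q (x n)) < e / 2) sequentially"
      using order_tendstoD(2)[OF l[unfolded tendsto_iff_dissip_dist] e] .
    moreover have "eventually (\<lambda>n. N \<le> n) sequentially" by (rule eventually_ge_at_top)
    ultimately have "eventually (\<lambda>n. dissip_dist l (q (x n)) < e / 2 \<and> N \<le> n) sequentially"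
      by (rule eventually_conj)
    then obtain n where n: "dissip_dist l (q (x n)) < e / 2" "N \<le> n"
      using eventually_happens'[OF sequentially_bot] by blast
    show "eventually (\<lambda>s. dist (dissip_dist l (q s)) 0 < e) F"
      using P(1)[of N]
    proof (rule eventually_mono)
      fix s assume "P N s"
      then have "dissip_dist (q (x n)) (q s) < e / 2" using P(2)[OF x[OF n(2)]] N by (meson less_trans)
      then show "dist (dissip_dist l (q s)) 0 < e"
        using dissip_dist_triangle[of l "q s" "q (x n)"] n by (simp add: dissip_dist_nonneg)
    qed
  qed
  then show ?thesis by (rule that)
qed

text \<open>\<open>V q\<close> has a finite left limit and its increments dominate distances, so
  \<open>q\<close> is Cauchy from the left. Only now does the \<open>Lim\<close> in
  \<open>left_lim\<close> have a meaning.\<close>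

lemma left_lim_tendsto:
  assumes t: "0 < t" "t \<le> T"
  shows "(q \<longlongrightarrow> left_lim q t) (at_left t)"
proof -
  obtain W where W: "(V q \<longlongrightarrow> W) (at_left t)" "\<And>s. 0 \<le> s \<Longrightarrow> s < t \<Longrightarrow> V q s \<le> W"
    using mono_on_left_limit[OF V_mono t] by metis
  obtain l where l: "(q \<longlongrightarrow> l) (at_left t)"
  proof (rule one_sided_limit_exists)
    show "at_left t \<noteq> bot" by simp
    fix e :: real assume e: "e > 0"
    let ?P = "\<lambda>s. 0 < s \<and> s < t \<and> W - e < V q s"
    have "eventually (\<lambda>s. W - e < V q s) (at_left t)" using order_tendstoD(1)[OF W(1)] e by simp
    moreover have "eventually (\<lambda>s. 0 < s \<and> s < t) (at_left t)"
      unfolding eventually_at_left_field using t by auto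
    ultimately have "eventually ?P (at_left t)" by eventually_elim auto
    moreover have "dissip_dist (q s) (q s') < e" if "?P s" "?P s'" for s s'
    proof (cases "s \<le> s'")
      case True
      then show ?thesis using V_increment[of s s'] W(2)[of s'] that t by force
    next
      case False
      then show ?thesis using V_increment[of s' s] W(2)[of s] that t dissip_dist_commute[of "q s" "q s'"] by force
    qed
    ultimately show "\<exists>P. eventually P (at_left t) \<and> (\<forall>s s'. P s \<longrightarrow> P s' \<longrightarrow> dissip_dist (q s) (q s') < e)"
      by blast
  qed
  have "Lim (at_left t) q = l" by (rule tendsto_Lim[OF _ l]) simp
  then show ?thesis using l t by (simp add: left_lim_def)
qed

lemma right_lim_tendsto:
  assumes t: "0 \<le> t" "t < T"
  shows "(q \<longlongrightarrow> right_lim q t) (at_right t)"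
proof -
  obtain W where W: "(V q \<longlongrightarrow> W) (at_right t)" "\<And>s. t < s \<Longrightarrow> s \<le> T \<Longrightarrow> W \<le> V q s"
    using mono_on_right_limit[OF V_mono t] by metis
  obtain l where l: "(q \<longlongrightarrow> l) (at_right t)"
  proof (rule one_sided_limit_exists)
    show "at_right t \<noteq> bot" by simp
    fix e :: real assume e: "e > 0"
    let ?P = "\<lambda>s. t < s \<and> s < T \<and> V q s < W + e"
    have "eventually (\<lambda>s. V q s < W + e) (at_right t)" using order_tendstoD(2)[OF W(1)] e by simp
    moreover have "eventually (\<lambda>s. t < s \<and> s < T) (at_right t)"
      unfolding eventually_at_right_field using t by auto
    ultimately have "eventually ?P (at_right t)" by eventually_elim auto
    moreover have "dissip_dist (q s) (q s') < e" if "?P s" "?P s'" for s s'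
    proof (cases "s \<le> s'")
      case True
      then show ?thesis using V_increment[of s s'] W(2)[of s] that t by force
    next
      case False
      then show ?thesis using V_increment[of s' s] W(2)[of s'] that t dissip_dist_commute[of "q s" "q s'"] by force
    qed
    ultimately show "\<exists>P. eventually P (at_right t) \<and> (\<forall>s s'. P s \<longrightarrow> P s' \<longrightarrow> dissip_dist (q s) (q s') < e)"
      by blast
  qed
  have "Lim (at_right t) q = l" by (rule tendsto_Lim[OF _ l]) simp
  then show ?thesis using l t by (simp add: right_lim_def)
qed

text \<open>That \<open>V q\<close> jumps by at least the distance follows from
  \<open>V_increment\<close> in the limit; that it jumps by no more follows from
  \<open>V_minimal\<close>.\<close>

lemma V_left_limit:
  assumes t: "0 < t" "t \<le> T"
  shows "(V q \<longlongrightarrow> Vm q t) (at_left t)"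
proof -
  obtain W where W: "(V q \<longlongrightarrow> W) (at_left t)" "\<And>s. 0 \<le> s \<Longrightarrow> s < t \<Longrightarrow> V q s \<le> W"
    using mono_on_left_limit[OF V_mono t] by metis
  note ql = left_lim_tendsto[OF t]
  let ?d = "dissip_dist (left_lim q t) (q t)"
  have ev: "eventually (\<lambda>r. s < r \<and> r < t) (at_left t)" if "s < t" for s
    unfolding eventually_at_left_field using that by auto
  have "?d \<le> V q t - W"
  proof (rule tendsto_le[OF _ tendsto_diff[OF tendsto_const W(1)] tendsto_dissip_dist[OF ql tendsto_const]])
    show "eventually (\<lambda>r. dissip_dist (q r) (q t) \<le> V q t - V q r) (at_left t)"
      using ev[OF t(1)] by eventually_elim (use V_increment t in auto)
  qed simp
  moreover have "V q t \<le> W + ?d"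
  proof -
    have toW: "dissip_dist (q s) (left_lim q t) \<le> W - V q s" if s: "0 \<le> s" "s < t" for s
    proof (rule tendsto_le[OF _ tendsto_diff[OF W(1) tendsto_const] tendsto_dissip_dist[OF tendsto_const ql]])
      show "eventually (\<lambda>r. dissip_dist (q s) (q r) \<le> V q r - V q s) (at_left t)"
        using ev[OF s(2)] by eventually_elim (use V_increment t s in auto)
    qed simp
    \<comment> \<open>\<open>?G\<close> agrees with \<open>V q\<close> before \<open>t\<close> and
      has at \<open>t\<close> the value that the triangle inequality through the left limit
      justifies; its increments still dominate all distances.\<close>
    let ?G = "\<lambda>s. if s < t then V q s else W + ?d"
    have "V q t \<le> ?G t - ?G 0"
    proof (rule V_minimal)
      fix s s' assume s: "0 \<le> s" "s \<le> s'" "s' \<le> t"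
      consider "s' < t" | "s < t" "s' = t" | "s = t" "s' = t" using s by linarith
      then show "dissip_dist (q s) (q s') \<le> ?G s' - ?G s"
      proof cases
        case 1 then show ?thesis using V_increment[of s s'] s t by simp
      next
        case 2 then show ?thesis using toW[of s] dissip_dist_triangle[of "q s" "q t" "left_lim q t"] s by simp
      qed simp
    qed (use t in auto)
    then show ?thesis using t V_0 by simp
  qed
  ultimately have "W = Vm q t" by (simp add: Vm_def)
  then show ?thesis using W(1) by simp
qed

lemma V_right_limit:
  assumes t: "0 \<le> t" "t < T"
  shows "(V q \<longlongrightarrow> Vp q t) (at_right t)"
proof -
  obtain W where W: "(V q \<longlongrightarrow> W) (at_right t)" "\<And>s. t < s \<Longrightarrow> s \<le> T \<Longrightarrow> W \<le> V q s"
    using mono_on_right_limit[OF V_mono t] by metis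
  note qr = right_lim_tendsto[OF t]
  let ?d = "dissip_dist (q t) (right_lim q t)"
  have ev: "eventually (\<lambda>r. t < r \<and> r < s) (at_right t)" if "t < s" for s
    unfolding eventually_at_right_field using that by auto
  have "?d \<le> W - V q t"
  proof (rule tendsto_le[OF _ tendsto_diff[OF W(1) tendsto_const] tendsto_dissip_dist[OF tendsto_const qr]])
    show "eventually (\<lambda>r. dissip_dist (q t) (q r) \<le> V q r - V q t) (at_right t)"
      using ev[OF t(2)] by eventually_elim (use V_increment t in auto)
  qed simp
  moreover have "W \<le> V q t + ?d"
  proof -
    have toW: "dissip_dist (right_lim q t) (q s) \<le> V q s - W" if s: "t < s" "s \<le> T" for s
    proof (rule tendsto_le[OF _ tendsto_diff[OF tendsto_const W(1)] tendsto_dissip_dist[OF qr tendsto_const]])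
      show "eventually (\<lambda>r. dissip_dist (q r) (q s) \<le> V q s - V q r) (at_right t)"
        using ev[OF s(1)] by eventually_elim (use V_increment t s in auto)
    qed simp
    \<comment> \<open>\<open>?G\<close> removes from all values after \<open>t\<close> the excess of
      the right jump of \<open>V q\<close> over the distance. By the triangle inequality through the
      right limit it still dominates distances, so minimality forces the excess to be at most
      0.\<close>
    let ?G = "\<lambda>r. if r \<le> t then V q r else V q r - (W - V q t - ?d)"
    have "V q T \<le> ?G T - ?G 0"
    proof (rule V_minimal)
      fix s s' assume s: "0 \<le> s" "s \<le> s'" "s' \<le> T"
      consider "s' \<le> t" | "s \<le> t" "t < s'" | "t < s" using s by linarith
      then show "dissip_dist (q s) (q s') \<le> ?G s' - ?G s"
      proof cases
        case 2
        then show ?thesis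
          using toW[of s'] V_increment[of s t] dissip_dist_triangle[of "q s" "q s'" "q t"]
            dissip_dist_triangle[of "q t" "q s'" "right_lim q t"] s t by simp
      qed (use V_increment[of s s'] s t in auto)
    qed (use T_pos in auto)
    then show ?thesis using t V_0 by simp
  qed
  ultimately have "W = Vp q t" by (simp add: Vp_def)
  then show ?thesis using W(1) by simp
qed

lemma V_le_Vp: "V q t \<le> Vp q t" and Vm_le_V: "Vm q t \<le> V q t"
  by (simp_all add: Vp_def Vm_def dissip_dist_nonneg)

lemma Vp_le_V:
  assumes "0 \<le> s" "s < t" "t \<le> T"
  shows "Vp q s \<le> V q t"
proof (rule tendsto_upperbound[OF V_right_limit])
  show "eventually (\<lambda>r. V q r \<le> V q t) (at_right s)"
    unfolding eventually_at_right_field using assms mono_onD[OF V_mono] by (intro exI[of _ t]) auto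
qed (use assms in auto)

lemma V_le_Vm:
  assumes "0 \<le> s" "s < t" "t \<le> T"
  shows "V q s \<le> Vm q t"
proof (rule tendsto_lowerbound[OF V_left_limit])
  show "eventually (\<lambda>r. V q s \<le> V q r) (at_left t)"
    unfolding eventually_at_left_field using assms mono_onD[OF V_mono] by (intro exI[of _ s]) auto
qed (use assms in auto)

lemma Vp_le_Vm:
  assumes "0 \<le> s" "s < t" "t \<le> T"
  shows "Vp q s \<le> Vm q t"
  using Vp_le_V[of s "(s + t) / 2"] V_le_Vm[of "(s + t) / 2" t] assms by (simp add: field_simps)

lemma cont_setD:
  assumes "t \<in> cont_set q"
  shows "t \<in> {0..T}" "Vm q t = V q t" "Vp q t = V q t"
  using assms by (auto simp: cont_set_def Vm_def Vp_def)

lemma Vm_0: "Vm q 0 = 0"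
  by (simp add: Vm_def left_lim_def V_0)

lemma Vp_T: "Vp q T = V q T"
  by (simp add: Vp_def right_lim_def)

text \<open>The jumps of \<open>V q\<close> are the distances to the one-sided limits of
  \<open>q\<close>, so every jump of \<open>q\<close> is a discontinuity of the monotone function
  \<open>V q\<close>.\<close>

lemma jump_set_countable: "countable (jump_set q)"
proof -
  have "jump_set q \<subseteq> {a \<in> {0..T}. \<not> continuous (at a within {0..T}) (V q)}"
  proof
    fix t assume t: "t \<in> jump_set q"
    then have tT: "0 \<le> t" "t \<le> T" by (auto simp: jump_set_def)
    have "\<not> continuous (at t within {0..T}) (V q)"
    proof
      assume c: "continuous (at t within {0..T}) (V q)"
      have "left_lim q t = q t"
      proof (cases "t = 0")
        case False
        then have t0: "0 < t" using tT by simp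
        have "(V q \<longlongrightarrow> V q t) (at t within {0..t})"
          using c unfolding continuous_within by (rule tendsto_within_subset) (use tT in auto)
        then have "(V q \<longlongrightarrow> V q t) (at_left t)" using at_within_Icc_at_left[OF t0] by simp
        with V_left_limit[OF t0 tT(2)] have "Vm q t = V q t"
          using tendsto_unique[OF trivial_limit_at_left_real] by blast
        then show ?thesis by (simp add: Vm_def)
      qed (simp add: left_lim_def)
      moreover have "q t = right_lim q t"
      proof (cases "t = T")
        case False
        then have t0: "t < T" using tT by simp
        have "(V q \<longlongrightarrow> V q t) (at t within {t..T})"
          using c unfolding continuous_within by (rule tendsto_within_subset) (use tT in auto)
        then have "(V q \<longlongrightarrow> V q t) (at_right t)" using at_within_Icc_at_right[OF t0] by simp
        with V_right_limit[OF tT(1) t0] have "Vp q t = V q t"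
          using tendsto_unique[OF trivial_limit_at_right_real] by blast
        then show ?thesis by (simp add: Vp_def)
      qed (simp add: right_lim_def)
      ultimately have "t \<in> cont_set q" using tT by (simp add: cont_set_def)
      then show False using t by (simp add: jump_set_def)
    qed
    then show "t \<in> {a \<in> {0..T}. \<not> continuous (at a within {0..T}) (V q)}" using tT by simp
  qed
  then show ?thesis using mono_on_ctble_discont[OF V_mono] countable_subset by blast
qed

lemma cont_set_dense:
  assumes "0 \<le> a" "a < b" "b \<le> T"
  shows "\<exists>x\<in>cont_set q. a < x \<and> x < b"
proof -
  have "\<not> {a<..<b} \<subseteq> jump_set q"
    using uncountable_open_interval[of a b] assms(2) jump_set_countable countable_subset by blast
  then obtain x where "x \<in> {a<..<b}" "x \<notin> jump_set q" by blast
  then show ?thesis using assms by (intro bexI[of _ x]) (auto simp: jump_set_def)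
qed

lemma V_continuous_at_cont_set:
  assumes t: "t \<in> cont_set q" and "0 < t" "t < T"
  shows "isCont (V q) t" "isCont q t"
proof -
  have lr: "left_lim q t = q t" "right_lim q t = q t" using t by (auto simp: cont_set_def)
  show "isCont q t" unfolding isCont_def
    using left_lim_tendsto[of t] right_lim_tendsto[of t] assms lr by (intro filterlim_split_at) auto
  show "isCont (V q) t" unfolding isCont_def
    using V_left_limit[of t] V_right_limit[of t] assms cont_setD[OF t] by (intro filterlim_split_at) auto
qed

end

end

section \<open>The variation measure\<close>

context rate_independent_system begin

text \<open>The property under the \<open>THE\<close> in \<open>var_measure\<close>, named so that
  existence and uniqueness can be proved for it.\<close>

definition is_var_measure :: "(real \<Rightarrow> 'q) \<Rightarrow> real measure \<Rightarrow> bool" where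
  "is_var_measure q \<mu> \<longleftrightarrow> sets \<mu> = sets (restrict_space borel {0..T}) \<and>
        (\<forall>s\<in>cont_set q. \<forall>t\<in>cont_set q. s \<le> t \<longrightarrow> emeasure \<mu> {s..t} = ennreal (V q t - V q s)) \<and>
        (\<forall>t\<in>jump_set q.
           emeasure \<mu> {t} = ennreal (dissip_dist (left_lim q t) (q t) + dissip_dist (q t) (right_lim q t)))"

lemma sets_restrict_T: "A \<in> sets borel \<Longrightarrow> A \<subseteq> {0..T} \<Longrightarrow> A \<in> sets (restrict_space borel {0..T})"
  by (simp add: sets_restrict_space_iff)

lemma cont_or_jump: "t \<in> {0..T} \<Longrightarrow> t \<in> cont_set q \<or> t \<in> jump_set q"
  by (simp add: jump_set_def)

context
  fixes q assumes qBV: "q \<in> BV"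
begin

lemma is_var_measure_singleton:
  assumes \<mu>: "is_var_measure q \<mu>" and t: "t \<in> {0..T}"
  shows "emeasure \<mu> {t} = ennreal (Vp q t - Vm q t)"
  using cont_or_jump[OF t, of q]
proof
  assume c: "t \<in> cont_set q"
  then have "emeasure \<mu> {t..t} = ennreal (V q t - V q t)"
    using \<mu> unfolding is_var_measure_def by (metis order_refl)
  then show ?thesis using cont_setD[OF qBV c] by simp
next
  assume "t \<in> jump_set q"
  then show ?thesis using \<mu> by (simp add: is_var_measure_def Vp_def Vm_def add.commute)
qed

text \<open>The open interval is exhausted by closed intervals with endpoints in
  \<open>cont_set q\<close>, whose measure is prescribed; the one-sided limits of \<open>V q\<close>
  then give the value.\<close>

lemma is_var_measure_Ioo:
  assumes \<mu>: "is_var_measure q \<mu>" and ab: "0 \<le> a" "a < b" "b \<le> T"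
  shows "emeasure \<mu> {a<..<b} = ennreal (Vm q b - Vp q a)"
proof -
  have b: "0 < b" "b \<le> T" and a: "0 \<le> a" "a < T" using ab by auto
  let ?m = "(a + b) / 2"
  obtain s where s: "decseq s" "\<And>n. s n \<in> cont_set q" "\<And>n. a < s n" "\<And>n::nat. s n < ?m" "s \<longlonglongrightarrow> a"
    by (rule decseq_dense[of a ?m "cont_set q"]) (use ab cont_set_dense[OF qBV] in auto)
  \<comment> \<open>A sequence increasing to \<open>b\<close> is obtained by reflecting
    \<open>cont_set q\<close> at the origin and applying \<open>decseq_dense\<close> at
    \<open>- b\<close>.\<close>
  have dense: "\<exists>x\<in>uminus ` cont_set q. u < x \<and> x < v" if uv: "- b \<le> u" "u < v" "v \<le> - ?m" for u v
  proof -
    have "0 \<le> ?m" using ab by simp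
    then have "\<exists>x\<in>cont_set q. - v < x \<and> x < - u"
      by (intro cont_set_dense[OF qBV]) (use ab uv \<open>0 \<le> ?m\<close> in linarith)+
    then obtain x where "x \<in> cont_set q" "- v < x" "x < - u" by blast
    then show ?thesis by (intro bexI[of _ "- x"]) auto
  qed
  have bm: "- b < - ?m" using ab by simp
  obtain r where r: "decseq r" "\<And>n. r n \<in> uminus ` cont_set q" "\<And>n. - b < r n" "\<And>n::nat. r n < - ?m" "r \<longlonglongrightarrow> - b"
    by (rule decseq_dense[OF bm dense]) (assumption | rule that)+
  define t where "t n = - r n" for n
  have t: "incseq t" "\<And>n. t n \<in> cont_set q" "\<And>n. t n < b" "\<And>n. ?m < t n" "t \<longlonglongrightarrow> b"
  proof -
    show "incseq t" using r(1) by (simp add: t_def incseq_def decseq_def)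
    show "t n \<in> cont_set q" "t n < b" "?m < t n" for n using r(2,3,4)[of n] by (auto simp: t_def)
    show "t \<longlonglongrightarrow> b" using tendsto_minus[OF r(5)] by (simp add: t_def[abs_def])
  qed
  have sets: "sets \<mu> = sets (restrict_space borel {0..T})" using \<mu> by (simp add: is_var_measure_def)
  have union: "(\<Union>n. {s n..t n}) = {a<..<b}"
  proof (intro equalityI subsetI)
    fix x assume "x \<in> (\<Union>n. {s n..t n})"
    then obtain n where n: "s n \<le> x" "x \<le> t n" by auto
    then show "x \<in> {a<..<b}" using s(3)[of n] t(3)[of n] by auto
  next
    fix x assume x: "x \<in> {a<..<b}"
    then have "eventually (\<lambda>n. s n < x) sequentially" "eventually (\<lambda>n. x < t n) sequentially"
      using order_tendstoD(2)[OF s(5)] order_tendstoD(1)[OF t(5)] by auto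
    then have "eventually (\<lambda>n. s n < x \<and> x < t n) sequentially" by (rule eventually_conj)
    then obtain n where "s n < x \<and> x < t n" using eventually_happens'[OF sequentially_bot] by blast
    then show "x \<in> (\<Union>n. {s n..t n})" by (auto intro!: exI[of _ n])
  qed
  have "(\<lambda>n. emeasure \<mu> {s n..t n}) \<longlonglongrightarrow> emeasure \<mu> (\<Union>n. {s n..t n})"
  proof (rule Lim_emeasure_incseq)
    have "{s n..t n} \<in> sets \<mu>" for n
      unfolding sets by (rule sets_restrict_T) (use s(3)[of n] t(3)[of n] ab in auto)
    then show "range (\<lambda>n. {s n..t n}) \<subseteq> sets \<mu>" by (rule image_subsetI)
    show "incseq (\<lambda>n. {s n..t n})"
      using s(1) t(1) by (auto simp: incseq_def decseq_def intro: order_trans)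
  qed
  moreover have "emeasure \<mu> {s n..t n} = ennreal (V q (t n) - V q (s n))" for n
  proof -
    have "s n \<le> t n" using s(4)[of n] t(4)[of n] by linarith
    then show ?thesis using \<mu> s(2) t(2) by (simp add: is_var_measure_def)
  qed
  moreover have "(\<lambda>n. ennreal (V q (t n) - V q (s n))) \<longlonglongrightarrow> ennreal (Vm q b - Vp q a)"
  proof (intro tendsto_ennrealI tendsto_diff)
    have "filterlim t (at_left b) sequentially"
      using t by (auto simp: filterlim_at intro!: always_eventually)
    then show "(\<lambda>n. V q (t n)) \<longlonglongrightarrow> Vm q b"
      by (rule filterlim_compose[OF V_left_limit[OF qBV b]])
    have "filterlim s (at_right a) sequentially"
      using s by (auto simp: filterlim_at intro!: always_eventually)
    then show "(\<lambda>n. V q (s n)) \<longlonglongrightarrow> Vp q a"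
      by (rule filterlim_compose[OF V_right_limit[OF qBV a]])
  qed
  ultimately show ?thesis unfolding union by (simp add: LIMSEQ_unique)
qed

text \<open>Half-lines determine a Borel measure on the line. Intersected with {0..T} they decompose
  into an open interval and atoms at 0 or \<open>T\<close>, whose measures are already known;
  pushing forward to the line makes this applicable.\<close>

lemma is_var_measure_unique:
  assumes \<mu>: "is_var_measure q \<mu>" and \<nu>: "is_var_measure q \<nu>"
  shows "\<mu> = \<nu>"
proof -
  have sets: "sets \<mu> = sets (restrict_space borel {0..T})" "sets \<nu> = sets (restrict_space borel {0..T})"
    using \<mu> \<nu> by (auto simp: is_var_measure_def)
  have sp: "space \<mu> = {0..T}" "space \<nu> = {0..T}"
    using sets[THEN sets_eq_imp_space_eq] by (auto simp: space_restrict_space)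
  have idm: "(\<lambda>x. x) \<in> \<mu> \<rightarrow>\<^sub>M borel" "(\<lambda>x. x) \<in> \<nu> \<rightarrow>\<^sub>M borel"
    by (auto simp: measurable_cong_sets[OF sets(1) refl] measurable_cong_sets[OF sets(2) refl] intro: measurable_restrict_space1)
  have split: "emeasure M {x<..T} = emeasure M {x<..<T} + emeasure M {T}"
    if "sets M = sets (restrict_space borel {0..T})" "0 \<le> x" "x < T" for M :: "real measure" and x
  proof -
    have "{x<..T} = {x<..<T} \<union> {T}" using that by auto
    moreover have "{x<..<T} \<in> sets M" "{T} \<in> sets M"
      unfolding that(1) using that T_pos by (auto intro!: sets_restrict_T)
    ultimately show ?thesis by (simp add: plus_emeasure)
  qed
  have split0: "emeasure M {0..T} = emeasure M {0} + emeasure M {0<..T}"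
    if "sets M = sets (restrict_space borel {0..T})" for M :: "real measure"
  proof -
    have "{0..T} = {0} \<union> {0<..T}" using T_pos by auto
    moreover have "{0<..T} \<in> sets M" "{0} \<in> sets M"
      unfolding that using T_pos by (auto intro!: sets_restrict_T)
    ultimately show ?thesis by (simp add: plus_emeasure)
  qed
  have val: "emeasure M {x<..T} = ennreal (Vm q T - Vp q x) + ennreal (Vp q T - Vm q T)"
    if "is_var_measure q M" "0 \<le> x" "x < T" for M x
    using split[of M x] that is_var_measure_Ioo[OF that(1,2,3)] is_var_measure_singleton[OF that(1), of T] T_pos
    by (simp add: is_var_measure_def)
  have val0: "emeasure M {0..T} = ennreal (Vp q 0 - Vm q 0) + (ennreal (Vm q T - Vp q 0) + ennreal (Vp q T - Vm q T))"
    if "is_var_measure q M" for M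
    using split0[of M] val[OF that, of 0] is_var_measure_singleton[OF that, of 0] T_pos that
    by (simp add: is_var_measure_def)
  have val': "emeasure M ({x<..} \<inter> {0..T}) = (if x < 0 then ennreal (Vp q 0 - Vm q 0) + (ennreal (Vm q T - Vp q 0) + ennreal (Vp q T - Vm q T))
     else if x < T then ennreal (Vm q T - Vp q x) + ennreal (Vp q T - Vm q T) else 0)"
    if M: "is_var_measure q M" for M x
  proof -
    consider "x < 0" | "0 \<le> x" "x < T" | "T \<le> x" by linarith
    then show ?thesis
    proof cases
      case 1
      then have "{x<..} \<inter> {0..T} = {0..T}" by auto
      then show ?thesis using val0[OF M] 1 by simp
    next
      case 2
      then have "{x<..} \<inter> {0..T} = {x<..T}" by auto
      then show ?thesis using val[OF M 2] 2 by simp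
    next
      case 3
      then have "{x<..} \<inter> {0..T} = {}" by auto
      then show ?thesis using 3 T_pos by simp
    qed
  qed
  have "distr \<mu> borel (\<lambda>x. x) = distr \<nu> borel (\<lambda>x. x)"
  proof (rule measure_eqI_lessThan)
    fix x :: real
    show "emeasure (distr \<mu> borel (\<lambda>x. x)) {x<..} = emeasure (distr \<nu> borel (\<lambda>x. x)) {x<..}"
      using idm sp by (simp add: emeasure_distr val'[OF \<mu>] val'[OF \<nu>])
    show "emeasure (distr \<mu> borel (\<lambda>x. x)) {x<..} < \<infinity>"
      using idm sp by (simp add: emeasure_distr val'[OF \<mu>])
  qed auto
  then have *: "emeasure (distr \<mu> borel (\<lambda>x. x)) A = emeasure (distr \<nu> borel (\<lambda>x. x)) A" for A by simp
  show ?thesis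
  proof (rule measure_eqI)
    show "sets \<mu> = sets \<nu>" using sets by simp
    fix A assume "A \<in> sets \<mu>"
    then have A: "A \<in> sets borel" "A \<subseteq> {0..T}" unfolding sets by (auto simp: sets_restrict_space_iff)
    have "A \<inter> {0..T} = A" using A by auto
    then show "emeasure \<mu> A = emeasure \<nu> A" using *[of A] A idm sp by (simp add: emeasure_distr)
  qed
qed

text \<open>The Stieltjes measure of the right-continuous modification of \<open>V q\<close>,
  restricted to {0..T}.\<close>

lemma is_var_measure_exists: "\<exists>\<mu>. is_var_measure q \<mu>"
proof -
  \<comment> \<open>Inside the interval this is the right limit of \<open>V q\<close>, since
    \<open>interval_measure\<close> asks for right continuity. The value 0 to the left of 0 creates
    the atom of a jump at 0, and \<open>F\<close> is constant beyond \<open>T\<close>, where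
    \<open>Vp\<close> and \<open>V\<close> agree.\<close>
  define F where "F x = (if x < 0 then 0 else if T \<le> x then V q T else Vp q x)" for x
  have Fp: "F x = Vp q x" if "0 \<le> x" "x \<le> T" for x
    using that by (cases "x = T") (auto simp: F_def Vp_T[OF qBV])
  have Fm: "F x \<le> F y" if xy: "x \<le> y" for x y
  proof -
    consider "x < 0" "y < 0" | "x < 0" "0 \<le> y" | "0 \<le> x" "y \<le> T" "x < y" | "x = y" | "0 \<le> x" "x < T" "T < y" | "T \<le> x"
      using xy by linarith
    then show ?thesis
    proof cases
      case 2
      have "0 \<le> Vp q y" using V_nonneg[OF qBV, of y] V_le_Vp[OF qBV, of y] by linarith
      then show ?thesis using 2 V_nonneg[OF qBV, of T] by (simp add: F_def)
    next
      case 3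
      then show ?thesis using Fp[of x] Fp[of y] Vp_le_V[OF qBV, of x y] V_le_Vp[OF qBV, of y] by simp
    next
      case 5
      then show ?thesis using Vp_le_V[OF qBV, of x T] by (simp add: F_def)
    qed (use that T_pos in \<open>auto simp: F_def\<close>)
  qed
  have Fr: "continuous (at_right x) F" for x
  proof -
    consider "x < 0" | "0 \<le> x" "x < T" | "T \<le> x" by linarith
    then have "(F \<longlongrightarrow> F x) (at_right x)"
    proof cases
      case 1
      have "eventually (\<lambda>r. F r = F x) (at_right x)"
        unfolding eventually_at_right_field using 1 by (intro exI[of _ 0]) (auto simp: F_def)
      then show ?thesis by (rule tendsto_eventually)
    next
      case 3
      have "eventually (\<lambda>r. F r = F x) (at_right x)"
        unfolding eventually_at_right_field using 3 T_pos by (intro exI[of _ "x + 1"]) (auto simp: F_def)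
      then show ?thesis by (rule tendsto_eventually)
    next
      case 2
      show ?thesis
      proof (rule tendstoI)
        fix e :: real assume "e > 0"
        then have "eventually (\<lambda>r. V q r < Vp q x + e) (at_right x)"
          using order_tendstoD(2)[OF V_right_limit[OF qBV 2]] by simp
        then obtain b where b: "b > x" "\<And>r. x < r \<Longrightarrow> r < b \<Longrightarrow> V q r < Vp q x + e"
          unfolding eventually_at_right_field by blast
        show "eventually (\<lambda>r. dist (F r) (F x) < e) (at_right x)"
          unfolding eventually_at_right_field
        proof (intro exI[of _ "min b T"] conjI allI impI)
          fix r assume r: "x < r" "r < min b T"
          \<comment> \<open>\<open>Vp q r\<close> is bounded by \<open>V q\<close> at a strictly
            later time, which must still lie before \<open>b\<close>.\<close>
          let ?r = "(r + min b T) / 2"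
          have "Vp q r \<le> V q ?r" by (rule Vp_le_V[OF qBV]) (use r 2 in auto)
          moreover have "V q ?r < Vp q x + e" by (rule b(2)) (use r in auto)
          moreover have "Vp q x \<le> Vp q r" using Vp_le_V[OF qBV, of x r] V_le_Vp[OF qBV, of r] r 2 by simp
          ultimately show "dist (F r) (F x) < e" using Fp[of r] Fp[of x] r 2 by (simp add: dist_real_def)
        qed (use b 2 in auto)
      qed
    qed
    then show ?thesis by (simp add: continuous_within)
  qed
  let ?I = "interval_measure F"
  have Ioc: "emeasure ?I {u<..v} = ennreal (F v - F u)" if "u \<le> v" for u v
    by (rule emeasure_interval_measure_Ioc[OF that Fm Fr])
  have lim0: "(\<lambda>n. a - 1 / real (Suc n)) \<longlonglongrightarrow> a" for a :: real
    using tendsto_diff[OF tendsto_const LIMSEQ_inverse_real_of_nat, of a] by (simp add: inverse_eq_divide)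
  have Icc: "emeasure ?I {s..t} = ennreal (Vp q t - Vm q s)" if st: "0 \<le> s" "s \<le> t" "t \<le> T" for s t
  proof -
    have "(\<lambda>n. emeasure ?I {s - 1 / real (Suc n)<..t}) \<longlonglongrightarrow> emeasure ?I (\<Inter>n. {s - 1 / real (Suc n)<..t})"
    proof (rule Lim_emeasure_decseq)
      show "decseq (\<lambda>n. {s - 1 / real (Suc n)<..t})"
      proof (rule decseq_SucI)
        fix n
        have "1 / real (Suc (Suc n)) \<le> 1 / real (Suc n)" by (rule frac_le) auto
        then show "{s - 1 / real (Suc (Suc n))<..t} \<subseteq> {s - 1 / real (Suc n)<..t}"
          by (auto simp del: of_nat_Suc)
      qed
      fix n show "emeasure ?I {s - 1 / real (Suc n)<..t} \<noteq> \<infinity>"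
        using st by (subst Ioc) (auto intro: order_trans[of _ s])
    qed auto
    moreover have "(\<Inter>n. {s - 1 / real (Suc n)<..t}) = {s..t}"
    proof (intro equalityI subsetI)
      fix x assume x: "x \<in> (\<Inter>n. {s - 1 / real (Suc n)<..t})"
      then have "s - 1 / real (Suc n) \<le> x" for n by (auto intro: less_imp_le)
      then have "s \<le> x" by (intro LIMSEQ_le_const2[OF lim0]) auto
      then show "x \<in> {s..t}" using x by auto
    next
      fix x assume x: "x \<in> {s..t}"
      have "s - 1 / real (Suc n) < x" for n
      proof -
        have "0 < 1 / real (Suc n)" by simp
        then show ?thesis using x by (simp only: atLeastAtMost_iff) linarith
      qed
      then show "x \<in> (\<Inter>n. {s - 1 / real (Suc n)<..t})" using x by auto
    qed
    moreover have "emeasure ?I {s - 1 / real (Suc n)<..t} = ennreal (F t - F (s - 1 / real (Suc n)))" for n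
    proof (rule Ioc)
      have "0 < 1 / real (Suc n)" by simp
      then show "s - 1 / real (Suc n) \<le> t" using st by linarith
    qed
    moreover have "(\<lambda>n. ennreal (F t - F (s - 1 / real (Suc n)))) \<longlonglongrightarrow> ennreal (F t - Vm q s)"
    proof (intro tendsto_ennrealI tendsto_diff tendsto_const)
      have fl: "filterlim (\<lambda>n. s - 1 / real (Suc n)) (at_left s) sequentially"
        unfolding filterlim_at using lim0[of s] by (auto intro!: always_eventually)
      have "(F \<longlongrightarrow> Vm q s) (at_left s)"
      proof (cases "s = 0")
        case True
        have "eventually (\<lambda>r. F r = Vm q s) (at_left s)"
          unfolding eventually_at_left_field using True
          by (intro exI[of _ "-1"]) (auto simp: F_def Vm_0[OF qBV])
        then show ?thesis by (rule tendsto_eventually)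
      next
        case False
        then have s0: "0 < s" using st by simp
        have ev: "eventually (\<lambda>r. 0 < r \<and> r < s) (at_left s)"
          unfolding eventually_at_left_field using s0 by (intro exI[of _ 0]) auto
        show ?thesis
        proof (rule tendsto_sandwich[OF _ _ V_left_limit[OF qBV s0] tendsto_const])
          show "s \<le> T" using st by simp
          show "eventually (\<lambda>r. V q r \<le> F r) (at_left s)"
            using ev by eventually_elim (use Fp V_le_Vp[OF qBV] st in simp)
          show "eventually (\<lambda>r. F r \<le> Vm q s) (at_left s)"
            using ev by eventually_elim (use Fp Vp_le_Vm[OF qBV] st in simp)
        qed
      qed
      from filterlim_compose[OF this fl] show "(\<lambda>n. F (s - 1 / real (Suc n))) \<longlonglongrightarrow> Vm q s" .
    qed
    ultimately have "emeasure ?I {s..t} = ennreal (F t - Vm q s)" by (simp add: LIMSEQ_unique)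
    then show ?thesis using Fp[of t] st by simp
  qed
  have "is_var_measure q (restrict_space ?I {0..T})"
    unfolding is_var_measure_def
  proof (intro conjI ballI impI)
    show "sets (restrict_space ?I {0..T}) = sets (restrict_space borel {0..T})"
      by (simp add: sets_restrict_space)
    have em: "emeasure (restrict_space ?I {0..T}) A = emeasure ?I A" if "A \<subseteq> {0..T}" for A
      by (rule emeasure_restrict_space) (use that in auto)
    fix s t assume s: "s \<in> cont_set q" and t: "t \<in> cont_set q" and st: "s \<le> t"
    have "{s..t} \<subseteq> {0..T}" using cont_setD(1)[OF qBV s] cont_setD(1)[OF qBV t] by auto
    then show "emeasure (restrict_space ?I {0..T}) {s..t} = ennreal (V q t - V q s)"
      using em[of "{s..t}"] Icc[OF _ st] cont_setD[OF qBV s] cont_setD[OF qBV t] by simp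
  next
    fix t assume "t \<in> jump_set q"
    then have t: "0 \<le> t" "t \<le> T" by (auto simp: jump_set_def)
    have "emeasure (restrict_space ?I {0..T}) {t} = emeasure ?I {t}"
      by (rule emeasure_restrict_space) (use t in auto)
    also have "\<dots> = ennreal (Vp q t - Vm q t)" using Icc[of t t] t by simp
    finally show "emeasure (restrict_space ?I {0..T}) {t} =
        ennreal (dissip_dist (left_lim q t) (q t) + dissip_dist (q t) (right_lim q t))"
      by (simp add: Vp_def Vm_def add.commute)
  qed
  then show ?thesis by blast
qed

lemma is_var_measure_var_measure: "is_var_measure q (var_measure q)"
proof -
  have "var_measure q = (THE \<mu>. is_var_measure q \<mu>)" by (simp only: var_measure_def is_var_measure_def)
  then show ?thesis using is_var_measure_exists is_var_measure_unique theI[of "is_var_measure q"] by metis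
qed

lemma sets_var_measure: "sets (var_measure q) = sets (restrict_space borel {0..T})"
  using is_var_measure_var_measure by (simp add: is_var_measure_def)

lemma space_var_measure: "space (var_measure q) = {0..T}"
  using sets_eq_imp_space_eq[OF sets_var_measure] by (simp add: space_restrict_space)

lemma sets_var_measureI: "A \<in> sets borel \<Longrightarrow> A \<subseteq> {0..T} \<Longrightarrow> A \<in> sets (var_measure q)"
  unfolding sets_var_measure by (rule sets_restrict_T)

lemma jump_set_borel: "A \<subseteq> jump_set q \<Longrightarrow> A \<in> sets (var_measure q)"
proof (rule sets_var_measureI)
  assume A: "A \<subseteq> jump_set q"
  then show "A \<subseteq> {0..T}" by (auto simp: jump_set_def)
  have "countable A" using A jump_set_countable[OF qBV] by (rule countable_subset)
  then show "A \<in> sets borel" by (rule sets.countable[rotated]) auto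
qed

lemma cont_set_in_sets: "cont_set q \<in> sets (var_measure q)"
proof -
  have "cont_set q = {0..T} - jump_set q" by (auto simp: jump_set_def cont_set_def)
  moreover have "{0..T} \<in> sets (var_measure q)" by (rule sets_var_measureI) auto
  ultimately show ?thesis using jump_set_borel[of "jump_set q"] by auto
qed

lemma var_measure_cont_singleton: "t \<in> cont_set q \<Longrightarrow> emeasure (var_measure q) {t} = 0"
  using is_var_measure_singleton[OF is_var_measure_var_measure, of t] cont_setD[OF qBV, of t] by simp

lemma emeasure_diffuse: "A \<in> sets (var_measure q) \<Longrightarrow> emeasure (diffuse_measure q) A = emeasure (var_measure q) (A \<inter> cont_set q)"
proof -
  assume A: "A \<in> sets (var_measure q)"
  have "emeasure (diffuse_measure q) A = (\<integral>\<^sup>+x. indicator (cont_set q) x * indicator A x \<partial>var_measure q)"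
    unfolding diffuse_measure_def
    by (rule emeasure_density[OF borel_measurable_indicator[OF cont_set_in_sets] A])
  also have "\<dots> = (\<integral>\<^sup>+x. indicator (A \<inter> cont_set q) x \<partial>var_measure q)"
    by (rule nn_integral_cong) (auto simp: indicator_def)
  also have "\<dots> = emeasure (var_measure q) (A \<inter> cont_set q)"
    by (rule nn_integral_indicator[OF sets.Int[OF A cont_set_in_sets]])
  finally show ?thesis .
qed

text \<open>The open interval splits into its continuity points and its countably many atoms. At
  \<open>t0\<close> only the right half of the jump enters and at \<open>t1\<close> only the left
  half. Continuity points carry no mass, so the diffuse part may be taken over the closed interval,
  as in \<open>Sigma0\<close>.\<close>

lemma V_decomposition:
  assumes t: "0 \<le> t0" "t0 < t1" "t1 \<le> T"
  shows "ennreal (V q t1 - V q t0) = emeasure (diffuse_measure q) {t0..t1}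
     + ennreal (dissip_dist (q t0) (right_lim q t0)) + ennreal (dissip_dist (left_lim q t1) (q t1))
     + (\<Sum>\<^sub>\<infinity>t\<in>jump_set q \<inter> {t0<..<t1}. ennreal (dissip_dist (left_lim q t) (q t) + dissip_dist (q t) (right_lim q t)))"
proof -
  let ?\<mu> = "var_measure q" and ?J = "jump_set q \<inter> {t0<..<t1}" and ?C = "{t0<..<t1} \<inter> cont_set q"
  have J: "?J \<in> sets ?\<mu>" by (rule jump_set_borel) auto
  have Ioo: "{t0<..<t1} \<in> sets ?\<mu>" and Icc: "{t0..t1} \<in> sets ?\<mu>" and pts: "{t0} \<in> sets ?\<mu>" "{t1} \<in> sets ?\<mu>"
    using t by (auto intro!: sets_var_measureI)
  have C: "?C \<in> sets ?\<mu>" using Ioo cont_set_in_sets by blast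
  have "{t0<..<t1} = ?C \<union> ?J" using t by (auto simp: jump_set_def)
  moreover have "?C \<inter> ?J = {}" by (auto simp: jump_set_def)
  ultimately have 1: "emeasure ?\<mu> {t0<..<t1} = emeasure ?\<mu> ?C + emeasure ?\<mu> ?J"
    using C J by (metis plus_emeasure)
  have 2: "emeasure ?\<mu> ?J = (\<Sum>\<^sub>\<infinity>t\<in>?J. ennreal (dissip_dist (left_lim q t) (q t) + dissip_dist (q t) (right_lim q t)))"
  proof -
    have "emeasure ?\<mu> ?J = (\<Sum>\<^sub>\<infinity>t\<in>?J. emeasure ?\<mu> {t})"
      by (rule infsum_emeasure_singletons[symmetric])
        (auto intro!: jump_set_borel countable_Int1 jump_set_countable[OF qBV])
    also have "\<dots> = (\<Sum>\<^sub>\<infinity>t\<in>?J. ennreal (dissip_dist (left_lim q t) (q t) + dissip_dist (q t) (right_lim q t)))"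
      by (rule infsum_cong) (use is_var_measure_var_measure in \<open>auto simp: is_var_measure_def\<close>)
    finally show ?thesis .
  qed
  have pt: "emeasure ?\<mu> ({x} \<inter> cont_set q) = 0" for x
    using var_measure_cont_singleton[of x] by (cases "x \<in> cont_set q") (auto simp: Int_insert_left)
  have 3: "emeasure (diffuse_measure q) {t0..t1} = emeasure ?\<mu> ?C"
  proof -
    have "{t0..t1} \<inter> cont_set q = ?C \<union> (({t0} \<inter> cont_set q) \<union> ({t1} \<inter> cont_set q))" using t by auto
    moreover have "emeasure ?\<mu> (({t0} \<inter> cont_set q) \<union> ({t1} \<inter> cont_set q)) = 0"
      using emeasure_subadditive[of "{t0} \<inter> cont_set q" ?\<mu> "{t1} \<inter> cont_set q"] pt pts cont_set_in_sets by auto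
    ultimately show ?thesis
      using emeasure_Un_null_set[of ?C ?\<mu> "({t0} \<inter> cont_set q) \<union> ({t1} \<inter> cont_set q)"] C pts cont_set_in_sets
        emeasure_diffuse[OF Icc] by (auto simp: null_sets_def)
  qed
  have 4: "emeasure ?\<mu> {t0<..<t1} = ennreal (Vm q t1 - Vp q t0)"
    by (rule is_var_measure_Ioo[OF is_var_measure_var_measure t])
  have "V q t1 - V q t0 = (Vm q t1 - Vp q t0) + dissip_dist (q t0) (right_lim q t0) + dissip_dist (left_lim q t1) (q t1)"
    by (simp add: Vm_def Vp_def)
  then have "ennreal (V q t1 - V q t0) = ennreal (Vm q t1 - Vp q t0) + ennreal (dissip_dist (q t0) (right_lim q t0))
      + ennreal (dissip_dist (left_lim q t1) (q t1))"
    using Vp_le_Vm[OF qBV t] by (simp add: ennreal_plus dissip_dist_nonneg)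
  then show ?thesis using 1 2 3 4 by (simp add: add_ac)
qed

end

end

section \<open>Energy balance along a BV curve\<close>

lemma tendsto_at_left_within:
  fixes f :: "real \<Rightarrow> 'b::topological_space"
  assumes "(f \<longlongrightarrow> l) (at t within {a..b})" "a < t" "t \<le> b"
  shows "(f \<longlongrightarrow> l) (at_left t)"
proof -
  have "(f \<longlongrightarrow> l) (at t within {a..t})" using assms(1) by (rule tendsto_within_subset) (use assms in auto)
  then show ?thesis using at_within_Icc_at_left[OF assms(2)] by simp
qed

lemma tendsto_at_right_within:
  fixes f :: "real \<Rightarrow> 'b::topological_space"
  assumes "(f \<longlongrightarrow> l) (at t within {a..b})" "a \<le> t" "t < b"
  shows "(f \<longlongrightarrow> l) (at_right t)"
proof -
  have "(f \<longlongrightarrow> l) (at t within {t..b})" using assms(1) by (rule tendsto_within_subset) (use assms in auto)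
  then show ?thesis using at_within_Icc_at_right[OF assms(3)] by simp
qed

context rate_independent_system begin

lemma joint_tendsto:
  fixes f :: "real \<Rightarrow> 'q \<Rightarrow> real"
  assumes f: "continuous_on ({0..T} \<times> UNIV) (\<lambda>(t, p). f t p)"
    and s: "s \<in> {0..T}" and lim: "(\<tau> \<longlongrightarrow> s) F" "(c \<longlongrightarrow> p) F" and ev: "eventually (\<lambda>x. \<tau> x \<in> {0..T}) F"
  shows "((\<lambda>x. f (\<tau> x) (c x)) \<longlongrightarrow> f s p) F"
  using continuous_on_tendsto_compose[OF f tendsto_Pair[OF lim]] s ev by (auto elim: eventually_mono)

lemma joint_nbhd:
  fixes f :: "real \<Rightarrow> 'q \<Rightarrow> real"
  assumes f: "continuous_on ({0..T} \<times> UNIV) (\<lambda>(t, p). f t p)" and s: "s \<in> {0..T}" and e: "0 < e"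
  obtains \<rho> U where "\<rho> > 0" "open U" "p \<in> U"
    "\<And>r p'. r \<in> {0..T} \<Longrightarrow> \<bar>r - s\<bar> < \<rho> \<Longrightarrow> p' \<in> U \<Longrightarrow> \<bar>f r p' - f s p\<bar> < e"
proof -
  have "open (ball (f s p) e)" by simp
  then obtain W where W: "open W" "W \<inter> ({0..T} \<times> UNIV) = (\<lambda>(t, p). f t p) -` ball (f s p) e \<inter> ({0..T} \<times> UNIV)"
    using f[unfolded continuous_on_open_invariant] by blast
  have "(s, p) \<in> W" using W(2) s e by auto
  then obtain A U where AU: "open A" "open U" "s \<in> A" "p \<in> U" "A \<times> U \<subseteq> W"
    using W(1) open_prod_elim by (metis mem_Sigma_iff)
  obtain \<rho> where \<rho>: "\<rho> > 0" "ball s \<rho> \<subseteq> A" using AU open_contains_ball by blast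
  have "\<bar>f r p' - f s p\<bar> < e" if "r \<in> {0..T}" "\<bar>r - s\<bar> < \<rho>" "p' \<in> U" for r p'
  proof -
    have "r \<in> ball s \<rho>" using that by (simp add: dist_real_def abs_minus_commute)
    then have "(r, p') \<in> W \<inter> ({0..T} \<times> UNIV)" using AU \<rho> that by blast
    then have "f r p' \<in> ball (f s p) e" using W(2) by auto
    then show ?thesis by (simp add: dist_real_def abs_minus_commute)
  qed
  then show ?thesis using that \<rho>(1) AU by metis
qed

lemma eventually_in_T_left: "0 < t \<Longrightarrow> t \<le> T \<Longrightarrow> eventually (\<lambda>r. r \<in> {0..T}) (at_left t)"
  unfolding eventually_at_left_field by (intro exI[of _ 0]) auto

lemma eventually_in_T_right: "0 \<le> t \<Longrightarrow> t < T \<Longrightarrow> eventually (\<lambda>r. r \<in> {0..T}) (at_right t)"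
  unfolding eventually_at_right_field by (intro exI[of _ T]) auto

definition stable :: "real \<Rightarrow> 'q \<Rightarrow> bool" where
  "stable t p \<longleftrightarrow> (\<forall>p'. E t p \<le> E t p' + dissip_dist p p')"

definition power_integral :: "(real \<Rightarrow> 'q) \<Rightarrow> real \<Rightarrow> real" where
  "power_integral q t = integral {0..t} (\<lambda>s. dtE s (q s))"

context
  fixes q assumes qBV: "q \<in> BV"
begin

lemma curve_left_limit:
  assumes f: "continuous_on ({0..T} \<times> UNIV) (\<lambda>(t, p). f t p :: real)" and t: "0 < t" "t \<le> T"
  shows "((\<lambda>r. f r (q r)) \<longlongrightarrow> f t (left_lim q t)) (at_left t)"
  by (rule joint_tendsto[OF f _ tendsto_ident_at left_lim_tendsto[OF qBV t] eventually_in_T_left[OF t]]) (use t in auto)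

lemma curve_right_limit:
  assumes f: "continuous_on ({0..T} \<times> UNIV) (\<lambda>(t, p). f t p :: real)" and t: "0 \<le> t" "t < T"
  shows "((\<lambda>r. f r (q r)) \<longlongrightarrow> f t (right_lim q t)) (at_right t)"
  by (rule joint_tendsto[OF f _ tendsto_ident_at right_lim_tendsto[OF qBV t] eventually_in_T_right[OF t]]) (use t in auto)

section \<open>The power along a BV curve\<close>

lemma power_bounded:
  obtains B where "\<And>s. s \<in> {0..T} \<Longrightarrow> \<bar>dtE s (q s)\<bar> \<le> B"
proof -
  let ?g = "\<lambda>s. dtE s (q s)"
  define Q where "Q u w \<longleftrightarrow> (\<exists>B. \<forall>s\<in>{u..w} \<inter> {0..T}. \<bar>?g s\<bar> \<le> B)" for u w
  have "Q 0 T"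
  proof (rule Bolzano[of 0 T Q])
    fix u v w assume Q: "Q u v" "Q v w" "u \<le> v" "v \<le> w"
    obtain B1 where B1: "\<forall>s\<in>{u..v} \<inter> {0..T}. \<bar>?g s\<bar> \<le> B1" using Q(1) by (auto simp only: Q_def)
    obtain B2 where B2: "\<forall>s\<in>{v..w} \<inter> {0..T}. \<bar>?g s\<bar> \<le> B2" using Q(2) by (auto simp only: Q_def)
    have "\<bar>?g s\<bar> \<le> max B1 B2" if "s \<in> {u..w} \<inter> {0..T}" for s
    proof (cases "s \<le> v")
      case True
      then show ?thesis using B1[rule_format, of s] that by auto
    next
      case False
      then show ?thesis using B2[rule_format, of s] that by auto
    qed
    then show "Q u w" unfolding Q_def by blast
  next
    \<comment> \<open>Since \<open>q\<close> may jump at \<open>s\<close>, the power is bounded near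
      \<open>s\<close> by means of the two one-sided limits and the value at \<open>s\<close>
      itself.\<close>
    fix s assume s: "0 \<le> s" "s \<le> T"
    have "\<exists>l<s. \<forall>r. l < r \<and> r < s \<and> r \<in> {0..T} \<longrightarrow> \<bar>?g r\<bar> \<le> \<bar>dtE s (left_lim q s)\<bar> + 1"
    proof (cases "s = 0")
      case True
      then show ?thesis by (intro exI[of _ "-1"]) auto
    next
      case False
      then have "0 < s" using s by simp
      from tendstoD[OF curve_left_limit[OF dtE_continuous this s(2)], of 1]
      obtain b where "b < s" "\<And>r. b < r \<Longrightarrow> r < s \<Longrightarrow> \<bar>?g r - dtE s (left_lim q s)\<bar> < 1"
        unfolding eventually_at_left_field dist_real_def by auto
      then show ?thesis by (intro exI[of _ b]) (smt (verit))
    qed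
    then obtain l where l: "l < s" "\<And>r. l < r \<Longrightarrow> r < s \<Longrightarrow> r \<in> {0..T} \<Longrightarrow> \<bar>?g r\<bar> \<le> \<bar>dtE s (left_lim q s)\<bar> + 1"
      by blast
    have "\<exists>u>s. \<forall>r. s < r \<and> r < u \<and> r \<in> {0..T} \<longrightarrow> \<bar>?g r\<bar> \<le> \<bar>dtE s (right_lim q s)\<bar> + 1"
    proof (cases "s = T")
      case True
      then show ?thesis by (intro exI[of _ "T + 1"]) auto
    next
      case False
      then have "s < T" using s by simp
      from tendstoD[OF curve_right_limit[OF dtE_continuous s(1) this], of 1]
      obtain b where "b > s" "\<And>r. s < r \<Longrightarrow> r < b \<Longrightarrow> \<bar>?g r - dtE s (right_lim q s)\<bar> < 1"
        unfolding eventually_at_right_field dist_real_def by auto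
      then show ?thesis by (intro exI[of _ b]) (smt (verit))
    qed
    then obtain u where u: "s < u" "\<And>r. s < r \<Longrightarrow> r < u \<Longrightarrow> r \<in> {0..T} \<Longrightarrow> \<bar>?g r\<bar> \<le> \<bar>dtE s (right_lim q s)\<bar> + 1"
      by blast
    let ?B = "max \<bar>?g s\<bar> (max (\<bar>dtE s (left_lim q s)\<bar> + 1) (\<bar>dtE s (right_lim q s)\<bar> + 1))"
    show "\<exists>d>0. \<forall>a b. a \<le> s \<and> s \<le> b \<and> b - a < d \<longrightarrow> Q a b"
    proof (rule exI[of _ "min (s - l) (u - s)"], intro conjI allI impI)
      fix a b assume ab: "a \<le> s \<and> s \<le> b \<and> b - a < min (s - l) (u - s)"
      have "\<bar>?g r\<bar> \<le> ?B" if r: "r \<in> {a..b} \<inter> {0..T}" for r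
      proof -
        consider "r < s" | "r = s" | "s < r" by linarith
        then show ?thesis
        proof cases
          case 1
          have "\<bar>?g r\<bar> \<le> \<bar>dtE s (left_lim q s)\<bar> + 1" by (rule l(2)) (use 1 r ab in auto)
          then show ?thesis by linarith
        next
          case 3
          have "\<bar>?g r\<bar> \<le> \<bar>dtE s (right_lim q s)\<bar> + 1" by (rule u(2)) (use 3 r ab in auto)
          then show ?thesis by linarith
        qed simp
      qed
      then show "Q a b" unfolding Q_def by blast
    qed (use l u in auto)
  qed (use T_pos in simp)
  then obtain B where "\<forall>s\<in>{0..T} \<inter> {0..T}. \<bar>?g s\<bar> \<le> B" unfolding Q_def by blast
  then show ?thesis by (intro that[of B]) auto
qed

lemma power_integrable: "(\<lambda>s. dtE s (q s)) absolutely_integrable_on {0..T}"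
proof -
  let ?g = "\<lambda>s. dtE s (q s)"
  \<comment> \<open>Cut off to the open interval, because \<open>q\<close> is arbitrary outside
    {0..T}. Then \<open>h\<close> is continuous off the countable set of jumps and the two
    endpoints, hence Borel.\<close>
  define h where "h s = (if s \<in> {0<..<T} then ?g s else 0)" for s
  have "h \<in> borel_measurable borel"
  proof (rule borel_measurable_continuous_countable_exceptions)
    show "countable (jump_set q \<union> {0, T})" using jump_set_countable[OF qBV] by simp
    show "continuous_on (- (jump_set q \<union> {0, T})) h"
    proof (rule continuous_at_imp_continuous_on, rule ballI)
      fix x assume x: "x \<in> - (jump_set q \<union> {0, T})"
      consider "x \<in> {0<..<T}" | "x \<in> - {0..T}" using x by force
      then show "isCont h x"
      proof cases
        case 1
        then have c: "x \<in> cont_set q" using x cont_or_jump[of x q] by auto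
        have "isCont q x" using V_continuous_at_cont_set(2)[OF qBV c] 1 by simp
        then have "((\<lambda>r. dtE r (q r)) \<longlongrightarrow> dtE x (q x)) (at x)"
        proof (intro joint_tendsto[OF dtE_continuous])
          have "eventually (\<lambda>r. r \<in> {0<..<T}) (at x)" by (rule eventually_at_in_open') (use 1 in auto)
          then show "eventually (\<lambda>r. r \<in> {0..T}) (at x)" by (rule eventually_mono) auto
        qed (use 1 in \<open>auto simp: isCont_def\<close>)
        moreover have "eventually (\<lambda>r. h r = ?g r) (nhds x)"
          using eventually_nhds_in_open[of "{0<..<T}" x] 1 by (auto simp: h_def elim!: eventually_mono)
        ultimately show ?thesis using isCont_cong[of h ?g x] by (simp add: isCont_def)
      next
        case 2
        have "eventually (\<lambda>r. h r = (\<lambda>_. 0) r) (nhds x)"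
        proof (rule eventually_mono)
          show "eventually (\<lambda>r. r \<in> - {0..T}) (nhds x)"
            by (rule eventually_nhds_in_open[OF _ 2]) (simp add: open_Compl)
        qed (auto simp: h_def)
        then show ?thesis using isCont_cong[of h "\<lambda>_. 0" x] by simp
      qed
    qed
  qed
  then have hm: "h \<in> borel_measurable (lebesgue_on {0..T})"
    by (intro measurable_restrict_space1 borel_measurable_if_D) (simp add: measurable_completion)
  obtain B where B: "\<And>s. s \<in> {0..T} \<Longrightarrow> \<bar>?g s\<bar> \<le> B" using power_bounded by blast
  have B0: "0 \<le> B" using B[of 0] T_pos by auto
  have "h absolutely_integrable_on {0..T}"
    by (rule measurable_bounded_by_integrable_imp_absolutely_integrable[OF hm, of "\<lambda>_. B"])
      (use B B0 in \<open>auto simp: h_def\<close>)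
  then show ?thesis
    by (rule absolutely_integrable_spike[of _ _ "{0, T}"]) (auto simp: h_def)
qed

lemma power_integrable_sub: "0 \<le> a \<Longrightarrow> b \<le> T \<Longrightarrow> (\<lambda>s. dtE s (q s)) absolutely_integrable_on {a..b}"
  by (rule absolutely_integrable_on_subinterval[OF power_integrable]) auto

lemma power_has_integral:
  assumes "0 \<le> a" "a \<le> b" "b \<le> T"
  shows "((\<lambda>s. dtE s (q s)) has_integral (power_integral q b - power_integral q a)) {a..b}"
proof -
  have i: "(\<lambda>s. dtE s (q s)) integrable_on {0..b}"
    using set_lebesgue_integral_eq_integral(1)[OF power_integrable_sub[of 0 b]] assms by simp
  have "integral {0..a} (\<lambda>s. dtE s (q s)) + integral {a..b} (\<lambda>s. dtE s (q s)) = integral {0..b} (\<lambda>s. dtE s (q s))"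
    by (rule Henstock_Kurzweil_Integration.integral_combine[OF assms(1,2) i])
  moreover have "(\<lambda>s. dtE s (q s)) integrable_on {a..b}"
    by (rule integrable_on_subinterval[OF i]) (use assms in auto)
  ultimately show ?thesis unfolding power_integral_def by (simp add: has_integral_iff)
qed

lemma power_LINT:
  assumes "0 \<le> a" "a \<le> b" "b \<le> T"
  shows "(LINT s:{a..b}|lebesgue. dtE s (q s)) = power_integral q b - power_integral q a"
  using set_lebesgue_integral_eq_integral(2)[OF power_integrable_sub[of a b]] power_has_integral[OF assms] assms
  by (simp add: has_integral_iff)

lemma power_integral_0: "power_integral q 0 = 0"
  by (simp add: power_integral_def)

lemma power_integral_continuous: "continuous_on {0..T} (power_integral q)"
  unfolding power_integral_def[abs_def]
  by (rule indefinite_integral_continuous_1) (use set_lebesgue_integral_eq_integral(1)[OF power_integrable] in simp)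

text \<open>For a frozen state \<open>p\<close> the work is an energy difference by the fundamental
  theorem. The lemma measures the error of freezing the state along \<open>q\<close>.\<close>

lemma power_difference_le:
  assumes ab: "0 \<le> a" "a \<le> b" "b \<le> T" and le: "\<And>r. a < r \<Longrightarrow> r < b \<Longrightarrow> \<bar>dtE r (q r) - dtE r p\<bar> \<le> C"
  shows "(power_integral q b - power_integral q a) - (E b p - E a p) \<le> C * (b - a)"
proof -
  have "norm ((power_integral q b - power_integral q a) - (E b p - E a p)) \<le> (b - a) * C"
  proof (rule norm_integral_le_ae[OF has_integral_diff[OF power_has_integral[OF ab] dtE_has_integral[OF ab]]])
    show "((\<lambda>r. C) has_integral (b - a) * C) {a..b}" using has_integral_const_real[of C a b] ab by simp
    show "negligible {a, b}" by simp
  qed (use le in auto)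
  then show ?thesis by (simp add: mult.commute abs_le_iff)
qed

lemma energetic_solution_iff:
  "energetic_solution q \<longleftrightarrow>
     (\<forall>t\<in>{0..T}. stable t (q t) \<and> E t (q t) + V q t = E 0 (q 0) + power_integral q t)"
proof -
  have "(ereal (E t (q t)) + enn2ereal (Var q {0..t}) = ereal (E 0 (q 0) + (LINT s:{0..t}|lebesgue. dtE s (q s))))
    \<longleftrightarrow> E t (q t) + V q t = E 0 (q 0) + power_integral q t" if "t \<in> {0..T}" for t
    using that Var_eq_V[OF qBV, of t] power_LINT[of 0 t] V_nonneg[OF qBV, of t] by (simp add: power_integral_0 enn2ereal_ennreal)
  then show ?thesis unfolding energetic_solution_def stable_def by blast
qed

section \<open>Comparison of \<open>Sigma0\<close> with the variation\<close>

lemma Sigma0_le: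
  assumes t: "0 \<le> t0" "t0 < t1" "t1 \<le> T"
    and slope: "\<And>r. r \<in> {0..T} \<Longrightarrow> slope r (q r) \<le> 1"
    and S: "\<And>r. r \<in> {0..T} \<Longrightarrow> S0 r (left_lim q r) (q r) \<le> dissip_dist (left_lim q r) (q r)"
      "\<And>r. r \<in> {0..T} \<Longrightarrow> S0 r (q r) (right_lim q r) \<le> dissip_dist (q r) (right_lim q r)"
  shows "Sigma0 q t0 t1 \<le> ennreal (V q t1 - V q t0)"
  unfolding Sigma0_def V_decomposition[OF qBV t]
proof (intro add_mono)
  have I: "{t0..t1} \<in> sets (diffuse_measure q)"
    unfolding diffuse_measure_def sets_density by (rule sets_var_measureI[OF qBV]) (use t in auto)
  have "(\<integral>\<^sup>+ r\<in>{t0..t1}. ennreal (slope r (q r)) \<partial>diffuse_measure q) \<le> (\<integral>\<^sup>+ r. indicator {t0..t1} r \<partial>diffuse_measure q)"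
    by (rule nn_integral_mono) (use slope t in \<open>auto simp: indicator_def ennreal_le_1\<close>)
  also have "\<dots> = emeasure (diffuse_measure q) {t0..t1}" by (rule nn_integral_indicator[OF I])
  finally show "(\<integral>\<^sup>+ r\<in>{t0..t1}. ennreal (slope r (q r)) \<partial>diffuse_measure q) \<le> emeasure (diffuse_measure q) {t0..t1}" .
  show "(\<Sum>\<^sub>\<infinity>t\<in>jump_set q \<inter> {t0<..<t1}. ennreal (S0 t (left_lim q t) (q t) + S0 t (q t) (right_lim q t)))
      \<le> (\<Sum>\<^sub>\<infinity>t\<in>jump_set q \<inter> {t0<..<t1}. ennreal (dissip_dist (left_lim q t) (q t) + dissip_dist (q t) (right_lim q t)))"
    by (intro infsum_mono nonneg_summable_on_complete ennreal_leI add_mono S) (use t in auto)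
qed (use S t in \<open>auto intro!: ennreal_leI\<close>)

text \<open>The complement of the support is a union of relatively open null sets, and by Lindelof
  countably many of them suffice.\<close>

lemma not_support_null: "{0..T} - var_support q \<in> null_sets (var_measure q)"
proof -
  let ?F = "{U :: real set. open U \<and> emeasure (var_measure q) (U \<inter> {0..T}) = 0}"
  obtain F' where F': "F' \<subseteq> ?F" "countable F'" "\<Union>F' = \<Union>?F"
    using Lindelof[of ?F] by auto
  have "(\<Union>U\<in>F'. U \<inter> {0..T}) \<in> null_sets (var_measure q)"
  proof (rule null_sets_UN'[OF F'(2)])
    fix U assume "U \<in> F'"
    then have "open U" "emeasure (var_measure q) (U \<inter> {0..T}) = 0" using F'(1) by auto
    then show "U \<inter> {0..T} \<in> null_sets (var_measure q)"
      by (auto simp: null_sets_def intro!: sets_var_measureI[OF qBV])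
  qed
  moreover have "{0..T} - var_support q = (\<Union>U\<in>F'. U \<inter> {0..T})"
  proof -
    have "{0..T} - var_support q = \<Union>?F \<inter> {0..T}" by (auto simp: var_support_def)
    then show ?thesis using F'(3) by auto
  qed
  ultimately show ?thesis by simp
qed

lemma Sigma0_ge:
  assumes t: "0 \<le> t0" "t0 < t1" "t1 \<le> T"
    and slope: "\<And>r. r \<in> var_support q \<Longrightarrow> 1 \<le> slope r (q r)"
    and S: "\<And>r. r \<in> {0..T} \<Longrightarrow> dissip_dist (left_lim q r) (q r) \<le> S0 r (left_lim q r) (q r)"
      "\<And>r. r \<in> {0..T} \<Longrightarrow> dissip_dist (q r) (right_lim q r) \<le> S0 r (q r) (right_lim q r)"
  shows "ennreal (V q t1 - V q t0) \<le> Sigma0 q t0 t1"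
  unfolding Sigma0_def V_decomposition[OF qBV t]
proof (intro add_mono)
  have I: "{t0..t1} \<in> sets (diffuse_measure q)"
    unfolding diffuse_measure_def sets_density by (rule sets_var_measureI[OF qBV]) (use t in auto)
  have "AE r in var_measure q. r \<notin> {0..T} - var_support q"
    using not_support_null by (rule AE_not_in)
  \<comment> \<open>The slope bound is known on the support only, which carries the whole
    measure.\<close>
  then have "AE r in var_measure q. 1 \<le> slope r (q r)"
    using AE_space by eventually_elim (use slope space_var_measure[OF qBV] in auto)
  then have "AE r in diffuse_measure q. 1 \<le> slope r (q r)"
    unfolding diffuse_measure_def
    by (subst AE_density) (auto intro!: borel_measurable_indicator cont_set_in_sets[OF qBV] elim: eventually_mono)
  then have "(\<integral>\<^sup>+ r. indicator {t0..t1} r \<partial>diffuse_measure q) \<le> (\<integral>\<^sup>+ r\<in>{t0..t1}. ennreal (slope r (q r)) \<partial>diffuse_measure q)"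
    by (intro nn_integral_mono_AE) (auto simp: indicator_def elim!: eventually_mono)
  moreover have "(\<integral>\<^sup>+ r. indicator {t0..t1} r \<partial>diffuse_measure q) = emeasure (diffuse_measure q) {t0..t1}"
    by (rule nn_integral_indicator[OF I])
  ultimately show "emeasure (diffuse_measure q) {t0..t1} \<le> (\<integral>\<^sup>+ r\<in>{t0..t1}. ennreal (slope r (q r)) \<partial>diffuse_measure q)"
    by simp
  show "(\<Sum>\<^sub>\<infinity>t\<in>jump_set q \<inter> {t0<..<t1}. ennreal (dissip_dist (left_lim q t) (q t) + dissip_dist (q t) (right_lim q t)))
    \<le> (\<Sum>\<^sub>\<infinity>t\<in>jump_set q \<inter> {t0<..<t1}. ennreal (S0 t (left_lim q t) (q t) + S0 t (q t) (right_lim q t)))"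
    by (intro infsum_mono nonneg_summable_on_complete ennreal_leI add_mono S) (use t in auto)
qed (use S t in \<open>auto intro!: ennreal_leI\<close>)

lemma S0_refl: "t \<in> {0..T} \<Longrightarrow> S0 t p p = 0"
  unfolding S0_eq_wdist by (rule wdist_refl) (rule slope_nonneg)

text \<open>The energy drop along each of the two pieces of the jump curve is at most the weighted
  length of that piece. These lengths add up to the total drop, so both estimates are equalities.
  Slope at least 1 makes each weighted length dominate the length.\<close>

lemma optimal_jump_split:
  assumes t: "t \<in> {0..T}" and opt: "optimal_jump q t"
  obtains a b where "S0 t (left_lim q t) (q t) \<le> a" "S0 t (q t) (right_lim q t) \<le> b"
    "dissip_dist (left_lim q t) (q t) \<le> a" "dissip_dist (q t) (right_lim q t) \<le> b"
    "a = E t (left_lim q t) - E t (q t)" "b = E t (q t) - E t (right_lim q t)"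
proof -
  obtain y \<theta> where y: "y \<in> admissible (left_lim q t) (right_lim q t)" and \<theta>: "\<theta> \<in> {0..1}" "y \<theta> = q t"
    and s1: "\<And>s. s \<in> {0..1} \<Longrightarrow> 1 \<le> slope t (y s)"
    and bal: "E t (right_lim q t) - E t (left_lim q t) = - (LINT s:{0..1}|lebesgue. slope t (y s) * speed y s)"
    using opt unfolding optimal_jump_def by blast
  have yA: "y \<in> AC" and y0: "y 0 = left_lim q t" and y1: "y 1 = right_lim q t"
    using y by (auto simp: admissible_def)
  note cont = slope_continuous_state[OF t]
  let ?f = "\<lambda>s. slope t (y s) * speed y s"
  have int: "?f integrable_on {0..1}" using wlen_has_integral[OF yA cont] by (rule has_integral_integrable)
  have int1: "speed y integrable_on {0..1}" using wlen_has_integral[OF yA, of "\<lambda>_. 1"] by (auto simp: has_integral_iff)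
  let ?a = "integral {0..\<theta>} ?f" and ?b = "integral {\<theta>..1} ?f"
  have "?a + ?b = integral {0..1} ?f"
    by (rule Henstock_Kurzweil_Integration.integral_combine[OF _ _ int]) (use \<theta> in auto)
  then have sum: "?a + ?b = E t (left_lim q t) - E t (right_lim q t)"
    using bal wlen_eq_LINT[OF yA cont] by (simp add: wlen_def)
  have "E t (left_lim q t) - E t (q t) \<le> ?a"
    using energy_le_slope[OF yA order_refl _ _ t, of \<theta>] \<theta> y0 by auto
  moreover have "E t (q t) - E t (right_lim q t) \<le> ?b"
    using energy_le_slope[OF yA _ _ order_refl t, of \<theta>] \<theta> y1 by auto
  ultimately have eq: "?a = E t (left_lim q t) - E t (q t)" "?b = E t (q t) - E t (right_lim q t)"
    using sum by linarith+
  have piece: "S0 t (y u) (y v) \<le> integral {u..v} ?f \<and> dissip_dist (y u) (y v) \<le> integral {u..v} ?f"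
    if uv: "0 \<le> u" "u \<le> v" "v \<le> 1" for u v
  proof (cases "u = v")
    case True
    then show ?thesis using S0_refl[OF t] by simp
  next
    case False
    then have uv': "u < v" using uv by simp
    let ?z = "\<lambda>s. y ((v - u) * s + u)"
    have "wdist (slope t) (y u) (y v) \<le> wlen (slope t) ?z"
      by (rule wdist_le[OF slope_nonneg[OF t] wlen_subcurve(1)[OF yA uv(1) uv' uv(3) cont]])
    then have "S0 t (y u) (y v) \<le> integral {u..v} ?f"
      unfolding S0_eq_wdist[OF t] wlen_subcurve(2)[OF yA uv(1) uv' uv(3) cont] .
    moreover have "dissip_dist (y u) (y v) \<le> integral {u..v} (speed y)"
      using dissip_dist_le[OF wlen_subcurve(1)[OF yA uv(1) uv' uv(3) cont]]
        wlen_subcurve(2)[OF yA uv(1) uv' uv(3), of "\<lambda>_. 1"] by simp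
    moreover have "integral {u..v} (speed y) \<le> integral {u..v} ?f"
    proof (rule integral_le)
      show "speed y integrable_on {u..v}" by (rule integrable_on_subinterval[OF int1]) (use uv in auto)
      show "?f integrable_on {u..v}" by (rule integrable_on_subinterval[OF int]) (use uv in auto)
      fix s assume "s \<in> {u..v}"
      then have "1 \<le> slope t (y s)" using s1 uv by auto
      then show "speed y s \<le> ?f s" using mult_right_mono[of 1 "slope t (y s)" "speed y s"] speed_nonneg by simp
    qed
    ultimately show ?thesis by simp
  qed
  show ?thesis
    by (rule that[of ?a ?b]) (use piece[of 0 \<theta>] piece[of \<theta> 1] \<theta> y0 y1 eq in auto)
qed

end

end

section \<open>Energetic solutions and BV solutions\<close>

context rate_independent_system begin

text \<open>An almost shortest curve between two points near p0 cannot leave \<open>U\<close>, so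
  the slope is at most \<kappa> along it. Its excess length \<open>e\<close> over the distance is
  sent to 0 at the end.\<close>

lemma slope_Lipschitz_local:
  assumes \<kappa>: "0 \<le> \<kappa>" and U: "open U" "p0 \<in> U"
  obtains \<delta> where "\<delta> > 0" "\<And>p. dissip_dist p0 p < \<delta> \<Longrightarrow> p \<in> U"
    "\<And>r p p'. r \<in> {0..T} \<Longrightarrow> (\<And>x. x \<in> U \<Longrightarrow> slope r x \<le> \<kappa>) \<Longrightarrow> dissip_dist p0 p < \<delta> \<Longrightarrow> dissip_dist p0 p' < \<delta> \<Longrightarrow>
       E r p - E r p' \<le> \<kappa> * dissip_dist p p'"
proof -
  obtain \<delta> where \<delta>: "\<delta> > 0" "\<And>q. dissip_dist p0 q < \<delta> \<Longrightarrow> q \<in> U"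
    "\<And>y s. y \<in> AC \<Longrightarrow> y 0 = p0 \<Longrightarrow> wlen (\<lambda>_. 1) y < \<delta> \<Longrightarrow> 0 \<le> s \<Longrightarrow> s \<le> 1 \<Longrightarrow> y s \<in> U"
    using dissip_dist_small_imp_in[OF U] by metis
  show ?thesis
  \<comment> \<open>A curve from p0 to \<open>p\<close> of length below \<delta> / 4, followed by
    one from \<open>p\<close> to p' of length below \<delta> / 2 + e with e < \<delta> / 4, is
    shorter than \<delta>.\<close>
  proof (rule that[of "\<delta> / 4"])
    fix r p p' assume r: "r \<in> {0..T}" and sl: "\<And>x. x \<in> U \<Longrightarrow> slope r x \<le> \<kappa>"
      and p: "dissip_dist p0 p < \<delta> / 4" and p': "dissip_dist p0 p' < \<delta> / 4"
    have dpp: "dissip_dist p p' < \<delta> / 2"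
      using dissip_dist_triangle[of p p' p0] dissip_dist_commute[of p p0] p p' by linarith
    have main: "E r p - E r p' \<le> \<kappa> * (dissip_dist p p' + e)" if e: "0 < e" "e < \<delta> / 4" for e
    proof -
      obtain y where y: "y \<in> admissible p p'" "wlen (\<lambda>_. 1) y < dissip_dist p p' + e"
        using dissip_dist_approx[OF e(1)] by metis
      obtain y0 where y0: "y0 \<in> admissible p0 p" "wlen (\<lambda>_. 1) y0 < dissip_dist p0 p + (\<delta> / 4 - dissip_dist p0 p)"
        using dissip_dist_approx[of "\<delta> / 4 - dissip_dist p0 p"] p by (metis diff_gt_0_iff_gt)
      have A: "y0 \<in> AC" "y \<in> AC" "y0 1 = y 0" and ends: "y 0 = p" "y 1 = p'" "y0 0 = p0"
        using y y0 by (auto simp: admissible_def)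
      \<comment> \<open>The escape estimate concerns curves starting at p0, so the curve from
        \<open>p\<close> is preceded by one from p0.\<close>
      let ?j = "join_curves y0 y"
      have "wlen (\<lambda>_. 1) ?j < \<delta>"
        using wlen_join[OF A, of "\<lambda>_. 1"] y(2) y0(2) dpp e by simp
      moreover have "?j \<in> AC" "?j 0 = p0" using join_curves_AC[OF A] ends by (auto simp: join_curves_def)
      ultimately have inU: "?j s \<in> U" if "0 \<le> s" "s \<le> 1" for s using \<delta>(3) that by blast
      have yU: "y s \<in> U" if "s \<in> {0..1}" for s :: real
      proof -
        have "?j ((s + 1) / 2) = y (2 * ((s + 1) / 2) + - 1)"
          by (rule join_curves_right) (use A that in auto)
        also have "2 * ((s + 1) / 2) + - 1 = s" by (simp add: field_simps)
        finally show ?thesis using inU[of "(s + 1) / 2"] that by simp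
      qed
      note cont = slope_continuous_state[OF r]
      have int: "((\<lambda>s. slope r (y s) * speed y s) has_integral wlen (slope r) y) {0..1}"
        by (rule wlen_has_integral[OF A(2) cont])
      have int1: "((\<lambda>s. \<kappa> * speed y s) has_integral \<kappa> * wlen (\<lambda>_. 1) y) {0..1}"
        by (rule has_integral_mult_right) (use wlen_has_integral[OF A(2), of "\<lambda>_. 1"] in simp)
      have "E r p - E r p' \<le> integral {0..1} (\<lambda>s. slope r (y s) * speed y s)"
        using energy_le_slope[OF A(2) order_refl _ order_refl r] ends by simp
      also have "\<dots> = wlen (slope r) y" by (simp add: wlen_def)
      also have "\<dots> \<le> \<kappa> * wlen (\<lambda>_. 1) y"
        by (rule has_integral_le[OF int int1]) (use sl yU speed_nonneg in \<open>auto intro!: mult_right_mono\<close>)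
      also have "\<dots> \<le> \<kappa> * (dissip_dist p p' + e)" using y(2) \<kappa> by (intro mult_left_mono) auto
      finally show ?thesis .
    qed
    have "((\<lambda>e. \<kappa> * (dissip_dist p p' + e)) \<longlongrightarrow> \<kappa> * (dissip_dist p p' + 0)) (at_right 0)"
      by (intro tendsto_intros)
    moreover have "eventually (\<lambda>e. E r p - E r p' \<le> \<kappa> * (dissip_dist p p' + e)) (at_right 0)"
      unfolding eventually_at_right_field using main \<delta>(1) by (intro exI[of _ "\<delta> / 4"]) auto
    ultimately have "E r p - E r p' \<le> \<kappa> * (dissip_dist p p' + 0)"
      by (rule tendsto_lowerbound) simp
    then show "E r p - E r p' \<le> \<kappa> * dissip_dist p p'" by simp
  next
    fix p assume "dissip_dist p0 p < \<delta> / 4"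
    then show "p \<in> U" using \<delta>(1) by (intro \<delta>(2)) linarith
  qed (use \<delta>(1) in simp)
qed

lemma global_slope_imp_stable:
  assumes "global_slope t p \<le> 1"
  shows "stable t p"
  unfolding stable_def
proof
  fix p'
  show "E t p \<le> E t p' + dissip_dist p p'"
  proof (cases "p' = p")
    case False
    have "ereal (max 0 (E t p - E t p') / dissip_dist p p') \<le> global_slope t p"
      unfolding global_slope_def by (rule SUP_upper) (use False in simp)
    then have le: "max 0 (E t p - E t p') / dissip_dist p p' \<le> 1"
      using assms by (metis dual_order.trans ereal_less_eq(3) one_ereal_def)
    have "0 < dissip_dist p p'"
      using dissip_dist_nonneg[of p p'] dissip_dist_eq_0_iff[of p p'] False by (metis less_eq_real_def)
    then have "max 0 (E t p - E t p') \<le> dissip_dist p p'" using le by (simp add: pos_divide_le_eq)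
    then show ?thesis by linarith
  qed simp
qed

context
  fixes q assumes qBV: "q \<in> BV"
begin

section \<open>Energetic solutions: jumps and support of the variation\<close>

lemma energy_left:
  assumes t: "0 < t" "t \<le> T"
  shows "((\<lambda>r. E r (q r)) \<longlongrightarrow> E t (left_lim q t)) (at_left t)"
  by (rule curve_left_limit[OF qBV E_continuous t])

text \<open>The work is continuous in time, so taking left limits in the balance turns the whole
  energy drop into the jump of \<open>V q\<close>, known from \<open>V_left_limit\<close>.\<close>

lemma energetic_jump_left:
  assumes en: "energetic_solution q" and t: "t \<in> {0..T}"
  shows "E t (left_lim q t) - E t (q t) = dissip_dist (left_lim q t) (q t)"
proof (cases "t = 0")
  case True
  then show ?thesis by (simp add: left_lim_def)
next
  case False
  then have t0: "0 < t" "t \<le> T" using t by auto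
  have eq: "E r (q r) + V q r - power_integral q r = E 0 (q 0)" if "r \<in> {0..T}" for r
    using en[unfolded energetic_solution_iff[OF qBV]] that by force
  have "((\<lambda>r. E r (q r) + V q r - power_integral q r) \<longlongrightarrow> E t (left_lim q t) + Vm q t - power_integral q t) (at_left t)"
  proof (intro tendsto_diff tendsto_add energy_left[OF t0] V_left_limit[OF qBV t0])
    have "(power_integral q \<longlongrightarrow> power_integral q t) (at t within {0..T})"
      using power_integral_continuous[OF qBV] t by (simp add: continuous_on_def)
    then show "(power_integral q \<longlongrightarrow> power_integral q t) (at_left t)"
      by (rule tendsto_at_left_within) (use t0 in auto)
  qed
  moreover have "((\<lambda>r. E r (q r) + V q r - power_integral q r) \<longlongrightarrow> E 0 (q 0)) (at_left t)"
    by (rule tendsto_eventually) (rule eventually_mono[OF eventually_in_T_left[OF t0] eq])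
  ultimately have "E t (left_lim q t) + Vm q t - power_integral q t = E 0 (q 0)"
    by (rule tendsto_unique[rotated]) simp
  then show ?thesis using eq[OF t] by (simp add: Vm_def)
qed

lemma energetic_jump_right:
  assumes en: "energetic_solution q" and t: "t \<in> {0..T}"
  shows "E t (q t) - E t (right_lim q t) = dissip_dist (q t) (right_lim q t)"
proof (cases "t = T")
  case True
  then show ?thesis by (simp add: right_lim_def)
next
  case False
  then have t0: "0 \<le> t" "t < T" using t by auto
  have eq: "E r (q r) + V q r - power_integral q r = E 0 (q 0)" if "r \<in> {0..T}" for r
    using en[unfolded energetic_solution_iff[OF qBV]] that by force
  have "((\<lambda>r. E r (q r) + V q r - power_integral q r) \<longlongrightarrow> E t (right_lim q t) + Vp q t - power_integral q t) (at_right t)"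
  proof (intro tendsto_diff tendsto_add curve_right_limit[OF qBV E_continuous t0] V_right_limit[OF qBV t0])
    have "(power_integral q \<longlongrightarrow> power_integral q t) (at t within {0..T})"
      using power_integral_continuous[OF qBV] t by (simp add: continuous_on_def)
    then show "(power_integral q \<longlongrightarrow> power_integral q t) (at_right t)"
      by (rule tendsto_at_right_within) (use t0 in auto)
  qed
  moreover have "((\<lambda>r. E r (q r) + V q r - power_integral q r) \<longlongrightarrow> E 0 (q 0)) (at_right t)"
    by (rule tendsto_eventually) (rule eventually_mono[OF eventually_in_T_right[OF t0] eq])
  ultimately have "E t (right_lim q t) + Vp q t - power_integral q t = E 0 (q 0)"
    by (rule tendsto_unique[rotated]) simp
  then show ?thesis using eq[OF t] by (simp add: Vp_def)
qed

lemma energetic_S0_le: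
  assumes en: "energetic_solution q" and opt: "\<forall>t\<in>jump_set q. optimal_jump q t" and t: "t \<in> {0..T}"
  shows "S0 t (left_lim q t) (q t) \<le> dissip_dist (left_lim q t) (q t)"
    and "S0 t (q t) (right_lim q t) \<le> dissip_dist (q t) (right_lim q t)"
proof -
  have "S0 t (left_lim q t) (q t) \<le> dissip_dist (left_lim q t) (q t) \<and>
      S0 t (q t) (right_lim q t) \<le> dissip_dist (q t) (right_lim q t)"
    using cont_or_jump[OF t, of q]
  proof
    assume "t \<in> cont_set q"
    then have "left_lim q t = q t" "right_lim q t = q t" by (auto simp: cont_set_def)
    then show ?thesis using S0_refl[OF qBV t] by simp
  next
    assume "t \<in> jump_set q"
    then have "optimal_jump q t" using opt by blast
    from optimal_jump_split[OF qBV t this] show ?thesis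
      using energetic_jump_left[OF en t] energetic_jump_right[OF en t] by metis
  qed
  then show "S0 t (left_lim q t) (q t) \<le> dissip_dist (left_lim q t) (q t)"
    "S0 t (q t) (right_lim q t) \<le> dissip_dist (q t) (right_lim q t)" by auto
qed

lemma power_difference_small:
  assumes s: "s \<in> {0..T}" and e: "0 < e" and lim: "\<And>U. open U \<Longrightarrow> l \<in> U \<Longrightarrow> \<exists>d>0. \<forall>r\<in>A. \<bar>r - s\<bar> < d \<longrightarrow> q r \<in> U"
    and A: "A \<subseteq> {0..T}"
  obtains d where "d > 0" "\<And>r r' p. r \<in> A \<Longrightarrow> r' \<in> A \<Longrightarrow> \<bar>r - s\<bar> < d \<Longrightarrow> \<bar>r' - s\<bar> < d \<Longrightarrow> p = l \<or> p = q r' \<Longrightarrow>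
     \<bar>dtE r (q r) - dtE r p\<bar> \<le> e"
proof -
  have e2: "0 < e / 2" using e by simp
  obtain \<rho> U where U: "\<rho> > 0" "open U" "l \<in> U"
    "\<And>r p'. r \<in> {0..T} \<Longrightarrow> \<bar>r - s\<bar> < \<rho> \<Longrightarrow> p' \<in> U \<Longrightarrow> \<bar>dtE r p' - dtE s l\<bar> < e / 2"
    using joint_nbhd[OF dtE_continuous s e2, of l] by metis
  obtain d where d: "d > 0" "\<And>r. r \<in> A \<Longrightarrow> \<bar>r - s\<bar> < d \<Longrightarrow> q r \<in> U" using lim[OF U(2,3)] by blast
  show ?thesis
  proof (rule that[of "min \<rho> d"])
    fix r r' p assume *: "r \<in> A" "r' \<in> A" "\<bar>r - s\<bar> < min \<rho> d" "\<bar>r' - s\<bar> < min \<rho> d" "p = l \<or> p = q r'"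
    have "p \<in> U" using *(5) d(2)[OF *(2)] *(4) U(3) by auto
    moreover have "q r \<in> U" using d(2)[OF *(1)] *(3) by simp
    ultimately have "\<bar>dtE r (q r) - dtE s l\<bar> < e / 2" "\<bar>dtE r p - dtE s l\<bar> < e / 2"
      using U(4)[of r] * A by auto
    then show "\<bar>dtE r (q r) - dtE r p\<bar> \<le> e" by linarith
  qed (use U d in auto)
qed

text \<open>The energy balance bounds \<open>(1 - \<kappa>) * (V q s' - V q s)\<close> by the oscillation of the power times
  \<open>s' - s\<close>. The crude bound makes \<open>V q\<close> Lipschitz, hence \<open>q\<close> continuous, and then the oscillation
  tends to zero.\<close>

lemma energetic_V_locally_constant:
  assumes en: "energetic_solution q" and t: "t \<in> cont_set q" and sl: "slope t (q t) < 1"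
  obtains \<eta> where "\<eta> > 0" "\<And>s s'. s \<in> {0..T} \<Longrightarrow> s' \<in> {0..T} \<Longrightarrow> \<bar>s - t\<bar> < \<eta> \<Longrightarrow> \<bar>s' - t\<bar> < \<eta> \<Longrightarrow> s \<le> s' \<Longrightarrow> V q s' = V q s"
proof -
  have tT: "t \<in> {0..T}" and lr: "left_lim q t = q t" "right_lim q t = q t" using t by (auto simp: cont_set_def)
  \<comment> \<open>Midway between the slope and 1: by continuity the slope stays below \<kappa>
    near q t, and 1 - \<kappa> stays positive for the absorption in \<open>step\<close>.\<close>
  define \<kappa> where "\<kappa> = (1 + slope t (q t)) / 2"
  have \<kappa>: "0 \<le> \<kappa>" "\<kappa> < 1" "0 < \<kappa> - slope t (q t)" using sl slope_nonneg[OF tT, of "q t"] by (auto simp: \<kappa>_def)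
  obtain \<rho>1 U1 where U1: "\<rho>1 > 0" "open U1" "q t \<in> U1"
    "\<And>r p. r \<in> {0..T} \<Longrightarrow> \<bar>r - t\<bar> < \<rho>1 \<Longrightarrow> p \<in> U1 \<Longrightarrow> \<bar>slope r p - slope t (q t)\<bar> < \<kappa> - slope t (q t)"
    using joint_nbhd[OF slope_continuous tT \<kappa>(3), of "q t"] by metis
  obtain \<rho>2 U2 where U2: "\<rho>2 > 0" "open U2" "q t \<in> U2"
    "\<And>r p. r \<in> {0..T} \<Longrightarrow> \<bar>r - t\<bar> < \<rho>2 \<Longrightarrow> p \<in> U2 \<Longrightarrow> \<bar>dtE r p - dtE t (q t)\<bar> < 1"
    using joint_nbhd[OF dtE_continuous tT zero_less_one, of "q t"] by metis
  let ?U = "U1 \<inter> U2"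
  obtain \<delta> where \<delta>: "\<delta> > 0" "\<And>p. dissip_dist (q t) p < \<delta> \<Longrightarrow> p \<in> ?U"
    and lip: "\<And>r p p'. r \<in> {0..T} \<Longrightarrow> (\<And>x. x \<in> ?U \<Longrightarrow> slope r x \<le> \<kappa>) \<Longrightarrow> dissip_dist (q t) p < \<delta> \<Longrightarrow>
       dissip_dist (q t) p' < \<delta> \<Longrightarrow> E r p - E r p' \<le> \<kappa> * dissip_dist p p'"
    using slope_Lipschitz_local[OF \<kappa>(1), of ?U "q t"] U1 U2 by (metis IntI open_Int)
  have "\<exists>\<rho>3>0. \<forall>r\<in>{0..T}. \<bar>r - t\<bar> < \<rho>3 \<longrightarrow> dissip_dist (q t) (q r) < \<delta>"
  proof -
    have "\<exists>a<t. \<forall>r\<in>{0..T}. a < r \<and> r < t \<longrightarrow> dissip_dist (q t) (q r) < \<delta>"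
    proof (cases "t = 0")
      case True
      then show ?thesis by (intro exI[of _ "-1"]) auto
    next
      case False
      then have "(q \<longlongrightarrow> q t) (at_left t)" using left_lim_tendsto[OF qBV, of t] tT lr by auto
      from order_tendstoD(2)[OF this[unfolded tendsto_iff_dissip_dist] \<delta>(1)]
      show ?thesis unfolding eventually_at_left_field by blast
    qed
    then obtain a where a: "a < t" "\<And>r. r \<in> {0..T} \<Longrightarrow> a < r \<Longrightarrow> r < t \<Longrightarrow> dissip_dist (q t) (q r) < \<delta>" by blast
    have "\<exists>b>t. \<forall>r\<in>{0..T}. t < r \<and> r < b \<longrightarrow> dissip_dist (q t) (q r) < \<delta>"
    proof (cases "t = T")
      case True
      then show ?thesis by (intro exI[of _ "T + 1"]) auto
    next
      case False
      then have "(q \<longlongrightarrow> q t) (at_right t)" using right_lim_tendsto[OF qBV, of t] tT lr by auto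
      from order_tendstoD(2)[OF this[unfolded tendsto_iff_dissip_dist] \<delta>(1)]
      show ?thesis unfolding eventually_at_right_field by blast
    qed
    then obtain b where b: "t < b" "\<And>r. r \<in> {0..T} \<Longrightarrow> t < r \<Longrightarrow> r < b \<Longrightarrow> dissip_dist (q t) (q r) < \<delta>" by blast
    have "dissip_dist (q t) (q r) < \<delta>" if "r \<in> {0..T}" "\<bar>r - t\<bar> < min (t - a) (b - t)" for r
    proof -
      consider "r < t" | "r = t" | "t < r" by linarith
      then show ?thesis
      proof cases
        case 1 then show ?thesis by (intro a(2)) (use that in auto)
      next
        case 2 then show ?thesis using \<delta>(1) by simp
      next
        case 3 then show ?thesis by (intro b(2)) (use that in auto)
      qed
    qed
    then show ?thesis using a(1) b(1) by (intro exI[of _ "min (t - a) (b - t)"]) auto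
  qed
  then obtain \<rho>3 where \<rho>3: "\<rho>3 > 0" "\<And>r. r \<in> {0..T} \<Longrightarrow> \<bar>r - t\<bar> < \<rho>3 \<Longrightarrow> dissip_dist (q t) (q r) < \<delta>" by blast
  define \<eta> where "\<eta> = min \<rho>1 (min \<rho>2 \<rho>3)"
  define N where "N = {r \<in> {0..T}. \<bar>r - t\<bar> < \<eta>}"
  have NT: "N \<subseteq> {0..T}" by (auto simp: N_def)
  have Nconv: "r \<in> N" if "s \<in> N" "s' \<in> N" "s \<le> r" "r \<le> s'" for r s s'
    using that by (auto simp: N_def abs_less_iff)
  have eq: "E r (q r) + V q r = E 0 (q 0) + power_integral q r" if "r \<in> {0..T}" for r
    using en[unfolded energetic_solution_iff[OF qBV]] that by blast
  \<comment> \<open>The state is frozen at q s'. The balance writes the increment of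
    \<open>V q\<close> as the energy drop at the fixed time \<open>s\<close>, which is at most
    \<kappa> times that same increment, plus the error of freezing the power.\<close>
  have step: "(1 - \<kappa>) * (V q s' - V q s) \<le> C * (s' - s)"
    if s: "s \<in> N" "s' \<in> N" "s \<le> s'" and C: "\<And>r. s < r \<Longrightarrow> r < s' \<Longrightarrow> \<bar>dtE r (q r) - dtE r (q s')\<bar> \<le> C" for s s' C
  proof -
    have sT: "s \<in> {0..T}" "s' \<in> {0..T}" using s NT by auto
    have "slope s x \<le> \<kappa>" if "x \<in> ?U" for x
      using U1(4)[OF sT(1), of x] s(1) that by (auto simp: N_def \<eta>_def)
    then have "E s (q s) - E s (q s') \<le> \<kappa> * dissip_dist (q s) (q s')"
      using lip[OF sT(1)] \<rho>3(2)[OF sT(1)] \<rho>3(2)[OF sT(2)] s by (auto simp: N_def \<eta>_def)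
    also have "\<dots> \<le> \<kappa> * (V q s' - V q s)"
      using V_increment[OF qBV, of s s'] sT s \<kappa> by (intro mult_left_mono) auto
    finally have 1: "E s (q s) - E s (q s') \<le> \<kappa> * (V q s' - V q s)" .
    have 2: "(power_integral q s' - power_integral q s) - (E s' (q s') - E s (q s')) \<le> C * (s' - s)"
      by (rule power_difference_le[OF qBV]) (use sT s C in auto)
    have "(1 - \<kappa>) * (V q s' - V q s) = (V q s' - V q s) - \<kappa> * (V q s' - V q s)" by (simp add: algebra_simps)
    then show ?thesis using 1 2 eq[OF sT(1)] eq[OF sT(2)] by linarith
  qed
  have Lip: "V q s' - V q s \<le> 2 / (1 - \<kappa>) * (s' - s)" if s: "s \<in> N" "s' \<in> N" "s \<le> s'" for s s'
  proof -
    have near: "\<bar>dtE r (q x) - dtE t (q t)\<bar> < 1" if "r \<in> N" "x \<in> N" for r x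
    proof -
      have "q x \<in> ?U" by (rule \<delta>(2)[OF \<rho>3(2)]) (use that in \<open>auto simp: N_def \<eta>_def\<close>)
      then show ?thesis using U2(4)[of r "q x"] that by (auto simp: N_def \<eta>_def)
    qed
    have "(1 - \<kappa>) * (V q s' - V q s) \<le> 2 * (s' - s)"
    proof (rule step[OF s])
      fix r assume "s < r" "r < s'"
      then have "r \<in> N" using Nconv[OF s(1,2), of r] by simp
      then show "\<bar>dtE r (q r) - dtE r (q s')\<bar> \<le> 2" using near[of r r] near[of r s'] s by linarith
    qed
    then show ?thesis using \<kappa>(2) by (simp add: field_simps)
  qed
  have qcont: "\<exists>d>0. \<forall>r\<in>N. \<bar>r - s\<bar> < d \<longrightarrow> q r \<in> U" if s: "s \<in> N" and U: "open U" "q s \<in> U" for s U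
  proof -
    obtain d where d: "d > 0" "\<And>p. dissip_dist (q s) p < d \<Longrightarrow> p \<in> U"
      using dissip_dist_small_imp_in[OF U] by metis
    define K where "K = 2 / (1 - \<kappa>)"
    have K: "K > 0" using \<kappa>(2) by (simp add: K_def)
    have "q r \<in> U" if r: "r \<in> N" "\<bar>r - s\<bar> < d / K" for r
    proof (rule d(2))
      have "dissip_dist (q s) (q r) \<le> K * \<bar>r - s\<bar>"
      proof (cases "s \<le> r")
        case True
        have "dissip_dist (q s) (q r) \<le> V q r - V q s"
          by (rule V_increment[OF qBV]) (use s r NT True in auto)
        also have "\<dots> \<le> K * (r - s)" unfolding K_def by (rule Lip[OF s r(1) True])
        finally show ?thesis using True by simp
      next
        case False
        have "dissip_dist (q r) (q s) \<le> V q s - V q r"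
          by (rule V_increment[OF qBV]) (use s r NT False in auto)
        also have "\<dots> \<le> K * (s - r)" unfolding K_def by (rule Lip[OF r(1) s]) (use False in simp)
        finally show ?thesis using False dissip_dist_commute[of "q s" "q r"] by simp
      qed
      also have "\<dots> < d" using r(2) K by (simp add: field_simps)
      finally show "dissip_dist (q s) (q r) < d" .
    qed
    then show ?thesis using d(1) K by (intro exI[of _ "d / K"]) auto
  qed
  have const: "V q s' - V q s \<le> e * (s' - s)" if s: "s \<in> N" "s' \<in> N" "s \<le> s'" and e: "e > 0" for s s' e
  proof -
    define Q where "Q u w \<longleftrightarrow> (s \<le> u \<and> u \<le> w \<and> w \<le> s' \<longrightarrow> V q w - V q u \<le> e * (w - u))" for u w
    have "Q s s'"
    proof (rule Bolzano[OF s(3), of Q])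
      fix u v w assume "Q u v" "Q v w" "u \<le> v" "v \<le> w"
      then show "Q u w" by (auto simp: Q_def algebra_simps)
    next
      fix x assume x: "s \<le> x" "x \<le> s'"
      then have xN: "x \<in> N" using Nconv[OF s(1,2)] by simp
      \<comment> \<open>With this tolerance for the power, \<open>step\<close> yields the rate
        \<open>e\<close> after division by 1 - \<kappa>.\<close>
      have e': "e * (1 - \<kappa>) > 0" using e \<kappa> by simp
      obtain d where d: "d > 0" "\<And>r r' p. r \<in> N \<Longrightarrow> r' \<in> N \<Longrightarrow> \<bar>r - x\<bar> < d \<Longrightarrow> \<bar>r' - x\<bar> < d \<Longrightarrow> p = q x \<or> p = q r' \<Longrightarrow>
          \<bar>dtE r (q r) - dtE r p\<bar> \<le> e * (1 - \<kappa>)"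
        by (rule power_difference_small[OF subsetD[OF NT xN] e' qcont[OF xN] NT]) (assumption | rule that)+
      show "\<exists>d>0. \<forall>u w. u \<le> x \<and> x \<le> w \<and> w - u < d \<longrightarrow> Q u w"
      proof (rule exI[of _ d], intro conjI allI impI d(1))
        fix u w assume uw: "u \<le> x \<and> x \<le> w \<and> w - u < d"
        show "Q u w" unfolding Q_def
        proof
          assume uw': "s \<le> u \<and> u \<le> w \<and> w \<le> s'"
          have N: "u \<in> N" "w \<in> N" using Nconv[OF s(1,2)] uw' by auto
          have "(1 - \<kappa>) * (V q w - V q u) \<le> (e * (1 - \<kappa>)) * (w - u)"
          proof (rule step[OF N])
            fix r assume r: "u < r" "r < w"
            then have rN: "r \<in> N" using Nconv[OF N, of r] by simp
            show "\<bar>dtE r (q r) - dtE r (q w)\<bar> \<le> e * (1 - \<kappa>)"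
              by (rule d(2)[OF rN N(2)]) (use r uw in auto)
          qed (use uw' in simp)
          then have "(1 - \<kappa>) * (V q w - V q u) \<le> (1 - \<kappa>) * (e * (w - u))" by (simp add: algebra_simps)
          then show "V q w - V q u \<le> e * (w - u)" using \<kappa>(2) by simp
        qed
      qed
    qed
    then show ?thesis using s by (simp add: Q_def)
  qed
  show ?thesis
  proof (rule that[of \<eta>])
    show "\<eta> > 0" using U1(1) U2(1) \<rho>3(1) by (simp add: \<eta>_def)
    fix s s' assume "s \<in> {0..T}" "s' \<in> {0..T}" "\<bar>s - t\<bar> < \<eta>" "\<bar>s' - t\<bar> < \<eta>" and ss: "s \<le> s'"
    then have s: "s \<in> N" "s' \<in> N" by (auto simp: N_def)
    have "((\<lambda>e. e * (s' - s)) \<longlongrightarrow> 0 * (s' - s)) (at_right 0)" by (intro tendsto_intros)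
    moreover have "eventually (\<lambda>e. V q s' - V q s \<le> e * (s' - s)) (at_right 0)"
      unfolding eventually_at_right_field using const[OF s ss] by (intro exI[of _ 1]) auto
    ultimately have "V q s' - V q s \<le> 0 * (s' - s)" by (rule tendsto_lowerbound) simp
    moreover have "V q s \<le> V q s'"
      by (rule mono_onD[OF V_mono[OF qBV] subsetD[OF NT s(1)] subsetD[OF NT s(2)] ss])
    ultimately show "V q s' = V q s" by simp
  qed
qed

lemma energetic_slope_on_support:
  assumes en: "energetic_solution q" and opt: "\<forall>t\<in>jump_set q. optimal_jump q t" and t: "t \<in> var_support q"
  shows "1 \<le> slope t (q t)"
proof (rule ccontr)
  assume "\<not> 1 \<le> slope t (q t)"
  then have sl: "slope t (q t) < 1" by simp
  have tT: "t \<in> {0..T}" using t by (simp add: var_support_def)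
  have "t \<notin> jump_set q"
  proof
    assume "t \<in> jump_set q"
    then have "optimal_jump q t" using opt by blast
    \<comment> \<open>The state q t lies on the jump curve, along which the slope is at least
      1.\<close>
    then have "1 \<le> slope t (q t)" unfolding optimal_jump_def by force
    then show False using sl by simp
  qed
  then have tc: "t \<in> cont_set q" using cont_or_jump[OF tT, of q] by blast
  obtain \<eta> where \<eta>: "\<eta> > 0" and const: "\<And>s s'. s \<in> {0..T} \<Longrightarrow> s' \<in> {0..T} \<Longrightarrow> \<bar>s - t\<bar> < \<eta> \<Longrightarrow> \<bar>s' - t\<bar> < \<eta> \<Longrightarrow> s \<le> s' \<Longrightarrow> V q s' = V q s"
    using energetic_V_locally_constant[OF en tc sl] by metis
  let ?\<mu> = "var_measure q"
  \<comment> \<open>Half of \<eta> keeps the endpoints strictly inside the region where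
    \<open>V q\<close> is constant, so its one-sided limits there agree with its values and exclude
    atoms.\<close>
  define a b where "a = max 0 (t - \<eta> / 2)" and "b = min T (t + \<eta> / 2)"
  have ab: "a \<in> {0..T}" "b \<in> {0..T}" "\<bar>a - t\<bar> < \<eta>" "\<bar>b - t\<bar> < \<eta>" "a < b" "a \<le> t" "t \<le> b"
    using tT \<eta> T_pos by (auto simp: a_def b_def min_def max_def)
  have Vp_eq: "Vp q x \<le> V q x" if x: "x \<in> {0..T}" "\<bar>x - t\<bar> < \<eta>" for x
  proof (cases "x = T")
    case True
    then show ?thesis using Vp_T[OF qBV] by simp
  next
    case False
    define r where "r = min T ((x + (t + \<eta>)) / 2)"
    have r: "r \<in> {0..T}" "x < r" "\<bar>r - t\<bar> < \<eta>" using x False by (auto simp: r_def min_def field_simps abs_less_iff)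
    show ?thesis using Vp_le_V[OF qBV, of x r] const[of x r] x r by auto
  qed
  have Vm_eq: "V q x \<le> Vm q x" if x: "x \<in> {0..T}" "\<bar>x - t\<bar> < \<eta>" for x
  proof (cases "x = 0")
    case True
    then show ?thesis using Vm_0[OF qBV] V_0[OF qBV] by simp
  next
    case False
    define r where "r = max 0 ((x + (t - \<eta>)) / 2)"
    have r: "r \<in> {0..T}" "r < x" "\<bar>r - t\<bar> < \<eta>" using x False by (auto simp: r_def max_def field_simps abs_less_iff)
    show ?thesis using V_le_Vm[OF qBV, of r x] const[of r x] x r by auto
  qed
  have pt: "emeasure ?\<mu> {x} = 0" if x: "x \<in> {0..T}" "\<bar>x - t\<bar> < \<eta>" for x
    using is_var_measure_singleton[OF qBV is_var_measure_var_measure[OF qBV] x(1)] Vp_eq[OF x] Vm_eq[OF x]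
    by (simp add: ennreal_neg)
  have io: "emeasure ?\<mu> {a<..<b} = 0"
    using is_var_measure_Ioo[OF qBV is_var_measure_var_measure[OF qBV], of a b] ab const[of a b]
      V_le_Vp[OF qBV, of a] Vm_le_V[OF qBV, of b] by (simp add: ennreal_neg)
  let ?U = "{t - \<eta> / 2<..<t + \<eta> / 2}"
  have sub: "?U \<inter> {0..T} \<subseteq> {a<..<b} \<union> ({a} \<union> {b})" by (auto simp: a_def b_def)
  have sets: "{a<..<b} \<in> sets ?\<mu>" "{a} \<in> sets ?\<mu>" "{b} \<in> sets ?\<mu>"
    using ab by (auto intro!: sets_var_measureI[OF qBV])
  have "emeasure ?\<mu> (?U \<inter> {0..T}) \<le> emeasure ?\<mu> ({a<..<b} \<union> ({a} \<union> {b}))"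
    by (rule emeasure_mono[OF sub]) (intro sets.Un sets)
  also have "\<dots> \<le> emeasure ?\<mu> {a<..<b} + emeasure ?\<mu> ({a} \<union> {b})"
    by (rule emeasure_subadditive) (intro sets.Un sets)+
  also have "\<dots> \<le> emeasure ?\<mu> {a<..<b} + (emeasure ?\<mu> {a} + emeasure ?\<mu> {b})"
    by (intro add_left_mono emeasure_subadditive) (use sets in auto)
  also have "\<dots> = 0" using io pt[OF ab(1,3)] pt[OF ab(2,4)] by simp
  finally have "emeasure ?\<mu> (?U \<inter> {0..T}) = 0" by simp
  moreover have "open ?U \<and> t \<in> ?U" using \<eta> by auto
  ultimately show False using t unfolding var_support_def by (metis (mono_tags, lifting) less_irrefl mem_Collect_eq)
qed

theorem energetic_imp_BV_solution:
  assumes en: "energetic_solution q" and opt: "\<forall>t\<in>jump_set q. optimal_jump q t"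
  shows "BV_solution q"
  unfolding BV_solution_def
proof (intro conjI allI impI ballI)
  have en': "stable t (q t)" "E t (q t) + V q t = E 0 (q 0) + power_integral q t" if "t \<in> {0..T}" for t
    using en[unfolded energetic_solution_iff[OF qBV]] that by auto
  have sl: "slope t (q t) \<le> 1" if "t \<in> {0..T}" for t
    using slope_le_one_of_stable[OF that, of "q t"] en'(1)[OF that] by (auto simp: stable_def)
  show "q \<in> BV" by (rule qBV)
  show "slope t (q t) \<le> 1" if "t \<in> {0..T} - jump_set q" for t using sl that by simp
  show "1 \<le> slope t (q t)" if "t \<in> var_support q" for t by (rule energetic_slope_on_support[OF en opt that])
  show "optimal_jump q t" if "t \<in> jump_set q" for t using opt that by blast
  fix t0 t1 assume t: "0 \<le> t0 \<and> t0 < t1 \<and> t1 \<le> T"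
  have "Sigma0 q t0 t1 \<le> ennreal (V q t1 - V q t0)"
    by (rule Sigma0_le[OF qBV _ _ _ sl energetic_S0_le[OF en opt] ]) (use t in auto)
  then have "enn2ereal (Sigma0 q t0 t1) \<le> enn2ereal (ennreal (V q t1 - V q t0))"
    by (simp only: less_eq_ennreal.rep_eq)
  moreover have "0 \<le> V q t1 - V q t0" using mono_onD[OF V_mono[OF qBV], of t0 t1] t by auto
  ultimately have "enn2ereal (Sigma0 q t0 t1) \<le> ereal (V q t1 - V q t0)" by (simp add: enn2ereal_ennreal)
  then have "- ereal (V q t1 - V q t0) \<le> - enn2ereal (Sigma0 q t0 t1)" by (simp only: ereal_minus_le_minus)
  moreover have "E t1 (q t1) - E t0 (q t0) - (LINT t:{t0..t1}|lebesgue. dtE t (q t)) = - (V q t1 - V q t0)"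
    using power_LINT[OF qBV, of t0 t1] en'(2)[of t0] en'(2)[of t1] t by simp
  ultimately show "ereal (E t1 (q t1) - E t0 (q t0) - (LINT t:{t0..t1}|lebesgue. dtE t (q t))) \<le> - enn2ereal (Sigma0 q t0 t1)"
    by simp
qed

section \<open>From BV solutions to energetic solutions\<close>

lemma stable_left_lim:
  assumes st: "\<And>t. t \<in> cont_set q \<Longrightarrow> stable t (q t)" and t: "0 < t" "t \<le> T"
  shows "stable t (left_lim q t)"
  unfolding stable_def
proof (rule allI, rule ccontr)
  \<comment> \<open>Stability is known only on the dense set \<open>cont_set q\<close>, not
    eventually to the left of \<open>t\<close>. A strict violation in the limit would persist on a
    left neighbourhood and so at some continuity point.\<close>
  fix p assume "\<not> E t (left_lim q t) \<le> E t p + dissip_dist (left_lim q t) p"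
  then have pos: "0 < E t (left_lim q t) - (E t p + dissip_dist (left_lim q t) p)" by simp
  have "((\<lambda>r. E r (q r) - (E r p + dissip_dist (q r) p)) \<longlongrightarrow> E t (left_lim q t) - (E t p + dissip_dist (left_lim q t) p)) (at_left t)"
  proof (intro tendsto_diff tendsto_add energy_left[OF t] tendsto_dissip_dist left_lim_tendsto[OF qBV t] tendsto_const)
    show "((\<lambda>r. E r p) \<longlongrightarrow> E t p) (at_left t)"
      by (rule joint_tendsto[OF E_continuous _ tendsto_ident_at tendsto_const eventually_in_T_left[OF t]]) (use t in auto)
  qed
  from order_tendstoD(1)[OF this pos] obtain b where b: "b < t"
    "\<And>r. b < r \<Longrightarrow> r < t \<Longrightarrow> 0 < E r (q r) - (E r p + dissip_dist (q r) p)"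
    unfolding eventually_at_left_field by blast
  obtain r where r: "r \<in> cont_set q" "max 0 b < r" "r < t"
    using cont_set_dense[OF qBV, of "max 0 b" t] b t by auto
  then have "E r (q r) \<le> E r p + dissip_dist (q r) p" using st by (auto simp: stable_def)
  then show False using b(2)[of r] r by simp
qed

theorem BV_solution_imp_energetic:
  assumes bv: "BV_solution q"
    and gs: "\<forall>t\<in>{0..T}. global_slope t (q t) \<le> ereal (max 1 (slope t (q t)))"
    and gs0: "global_slope 0 (q 0) \<le> 1"
  shows "energetic_solution q"
proof -
  have ineq: "\<And>t0 t1. 0 \<le> t0 \<Longrightarrow> t0 < t1 \<Longrightarrow> t1 \<le> T \<Longrightarrow>
        ereal (E t1 (q t1) - E t0 (q t0) - (LINT t:{t0..t1}|lebesgue. dtE t (q t))) \<le> - enn2ereal (Sigma0 q t0 t1)"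
    and sl: "\<And>t. t \<in> {0..T} - jump_set q \<Longrightarrow> slope t (q t) \<le> 1"
    and supp: "\<And>t. t \<in> var_support q \<Longrightarrow> 1 \<le> slope t (q t)"
    and opt: "\<And>t. t \<in> jump_set q \<Longrightarrow> optimal_jump q t"
    using bv unfolding BV_solution_def by blast+
  have st_cont: "stable t (q t)" if "t \<in> cont_set q" for t
  proof (rule global_slope_imp_stable)
    have "t \<in> {0..T} - jump_set q" using that by (auto simp: jump_set_def cont_set_def)
    then have "max 1 (slope t (q t)) = 1" "t \<in> {0..T}" using sl[of t] by auto
    then show "global_slope t (q t) \<le> 1" using gs by (metis one_ereal_def)
  qed
  have st_left: "stable t (left_lim q t)" if t: "t \<in> {0..T}" for t
  proof (cases "t = 0")
    case True
    \<comment> \<open>At time 0 there is nothing to approach from the left; the separate hypothesis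
      on the initial global slope takes over.\<close>
    then show ?thesis using global_slope_imp_stable[OF gs0] by (simp add: left_lim_def)
  next
    case False
    then show ?thesis using stable_left_lim[OF st_cont] t by simp
  qed
  have jumps: "dissip_dist (left_lim q t) (q t) \<le> E t (left_lim q t) - E t (q t) \<and>
      dissip_dist (q t) (right_lim q t) \<le> E t (q t) - E t (right_lim q t)" if t: "t \<in> {0..T}" for t
    using cont_or_jump[OF t, of q]
  proof
    assume "t \<in> cont_set q"
    then have "left_lim q t = q t" "right_lim q t = q t" by (auto simp: cont_set_def)
    then show ?thesis by simp
  next
    assume "t \<in> jump_set q"
    from optimal_jump_split[OF qBV t opt[OF this]] show ?thesis by metis
  qed
  \<comment> \<open>The slope may exceed 1 at a jump, so the global slope bound is not enough there.
    Instead the jump from the left limit dissipates at least its length, and the triangle inequality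
    transports the stability of the left limit to q t.\<close>
  have st: "stable t (q t)" if t: "t \<in> {0..T}" for t
    unfolding stable_def
  proof
    fix p
    have "E t (left_lim q t) \<le> E t p + dissip_dist (left_lim q t) p" using st_left[OF t] by (simp add: stable_def)
    moreover have "dissip_dist (left_lim q t) p \<le> dissip_dist (left_lim q t) (q t) + dissip_dist (q t) p"
      by (rule dissip_dist_triangle)
    ultimately show "E t (q t) \<le> E t p + dissip_dist (q t) p" using jumps[OF t] by linarith
  qed
  have upper: "E t (q t) + V q t \<le> E 0 (q 0) + power_integral q t" if t: "t \<in> {0..T}" for t
  proof (cases "t = 0")
    case True
    then show ?thesis using V_0[OF qBV] power_integral_0[OF qBV] by simp
  next
    case False
    then have t0: "0 < t" "t \<le> T" using t by auto
    \<comment> \<open>The energy drop mediates: \<open>jumps\<close> bounds the distance by it, and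
      \<open>energy_le_S0\<close> bounds it by \<open>S0\<close>.\<close>
    have S: "dissip_dist (left_lim q r) (q r) \<le> S0 r (left_lim q r) (q r)"
      "dissip_dist (q r) (right_lim q r) \<le> S0 r (q r) (right_lim q r)" if "r \<in> {0..T}" for r
      using jumps[OF that] energy_le_S0[OF that, of "q r" "left_lim q r"] energy_le_S0[OF that, of "right_lim q r" "q r"]
      by linarith+
    have "ennreal (V q t - V q 0) \<le> Sigma0 q 0 t" by (rule Sigma0_ge[OF qBV order_refl t0 supp S])
    then have "enn2ereal (ennreal (V q t)) \<le> enn2ereal (Sigma0 q 0 t)"
      using V_0[OF qBV] by (simp add: less_eq_ennreal.rep_eq)
    then have "ereal (V q t) \<le> enn2ereal (Sigma0 q 0 t)" using V_nonneg[OF qBV, of t] by (simp add: enn2ereal_ennreal)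
    then have "- enn2ereal (Sigma0 q 0 t) \<le> - ereal (V q t)" by (simp only: ereal_minus_le_minus)
    with ineq[OF order_refl t0] have "ereal (E t (q t) - E 0 (q 0) - (LINT t:{0..t}|lebesgue. dtE t (q t))) \<le> - ereal (V q t)"
      by (rule order_trans)
    then show ?thesis using power_LINT[OF qBV, of 0 t] power_integral_0[OF qBV] t0 by simp
  qed
  \<comment> \<open>Energy plus dissipation minus work. The missing half of the balance says that
    its value at \<open>t\<close> is not below its value at 0.\<close>
  define \<Psi> where "\<Psi> r = E r (q r) + V q r - power_integral q r" for r
  have mono: "\<Psi> u - \<Psi> w \<le> e * (w - u)" if uw: "0 \<le> u" "u \<le> w" "w \<le> T" and e: "0 < e" for u w e
  proof -
    define Q where "Q a b \<longleftrightarrow> (u \<le> a \<and> a \<le> b \<and> b \<le> w \<longrightarrow> \<Psi> a - \<Psi> b \<le> e * (b - a))" for a b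
    have "Q u w"
    proof (rule Bolzano[OF uw(2), of Q])
      fix a b c assume "Q a b" "Q b c" "a \<le> b" "b \<le> c"
      then show "Q a c" by (auto simp: Q_def algebra_simps)
    next
      fix s assume "u \<le> s" "s \<le> w"
      then have s: "0 \<le> s" "s \<le> T" "s \<in> {0..T}" using uw by auto
      have "\<exists>d>0. \<forall>a\<in>{0..T}. a \<le> s \<and> s - a < d \<longrightarrow> \<Psi> a - \<Psi> s \<le> e * (s - a)"
      proof (cases "s = 0")
        case True
        then show ?thesis by (intro exI[of _ 1]) auto
      next
        case False
        then have s0: "0 < s" using s by simp
        \<comment> \<open>States just before \<open>s\<close> are near \<open>?l\<close> but not
          near q s, so the power is frozen at \<open>?l\<close>. Stability of q a reaches
          \<open>?l\<close>, and stability of \<open>?l\<close> reaches q s across the jump.\<close>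
        let ?l = "left_lim q s"
        have near: "\<exists>d>0. \<forall>r\<in>{0..<s}. \<bar>r - s\<bar> < d \<longrightarrow> q r \<in> U" if U: "open U" "?l \<in> U" for U
        proof -
          obtain b where "b < s" "\<And>r. b < r \<Longrightarrow> r < s \<Longrightarrow> q r \<in> U"
            using topological_tendstoD[OF left_lim_tendsto[OF qBV s0 s(2)] U] unfolding eventually_at_left_field by blast
          then show ?thesis by (intro exI[of _ "s - b"]) auto
        qed
        have sub: "{0..<s} \<subseteq> {0..T}" using s by auto
        obtain d where d: "d > 0" "\<And>r r' p. r \<in> {0..<s} \<Longrightarrow> r' \<in> {0..<s} \<Longrightarrow> \<bar>r - s\<bar> < d \<Longrightarrow> \<bar>r' - s\<bar> < d \<Longrightarrow> p = ?l \<or> p = q r' \<Longrightarrow>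
           \<bar>dtE r (q r) - dtE r p\<bar> \<le> e"
          by (rule power_difference_small[OF s(3) e near]) (assumption | rule sub that)+
        have "\<Psi> a - \<Psi> s \<le> e * (s - a)" if a: "a \<in> {0..T}" "a \<le> s" "s - a < d" for a
        proof (cases "a = s")
          case False
          then have as: "a < s" using a by simp
          have "(power_integral q s - power_integral q a) - (E s ?l - E a ?l) \<le> e * (s - a)"
          proof (rule power_difference_le[OF qBV])
            fix r assume "a < r" "r < s"
            then show "\<bar>dtE r (q r) - dtE r ?l\<bar> \<le> e" by (intro d(2)[of r r]) (use a in auto)
          qed (use a as s in auto)
          moreover have "E a (q a) \<le> E a ?l + dissip_dist (q a) ?l" using st[OF a(1)] by (simp add: stable_def)
          moreover have "dissip_dist (q a) ?l \<le> Vm q s - V q a"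
          proof (rule tendsto_le[OF _ tendsto_diff[OF V_left_limit[OF qBV s0 s(2)] tendsto_const]
                tendsto_dissip_dist[OF tendsto_const left_lim_tendsto[OF qBV s0 s(2)]]])
            show "eventually (\<lambda>r. dissip_dist (q a) (q r) \<le> V q r - V q a) (at_left s)"
              unfolding eventually_at_left_field
              by (intro exI[of _ a] conjI allI impI as V_increment[OF qBV]) (use a s in auto)
          qed simp
          moreover have "E s ?l \<le> E s (q s) + dissip_dist ?l (q s)" using st_left[OF s(3)] by (simp add: stable_def)
          ultimately show ?thesis by (simp add: \<Psi>_def Vm_def)
        qed simp
        then show ?thesis using d(1) by blast
      qed
      then obtain d1 where d1: "d1 > 0" "\<And>a. a \<in> {0..T} \<Longrightarrow> a \<le> s \<Longrightarrow> s - a < d1 \<Longrightarrow> \<Psi> a - \<Psi> s \<le> e * (s - a)" by blast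
      have "\<exists>d>0. \<forall>b\<in>{0..T}. s \<le> b \<and> b - s < d \<longrightarrow> \<Psi> s - \<Psi> b \<le> e * (b - s)"
      proof (cases "s = T")
        case True
        then show ?thesis by (intro exI[of _ 1]) auto
      next
        case False
        then have sT: "s < T" using s by simp
        let ?l = "right_lim q s"
        have near: "\<exists>d>0. \<forall>r\<in>{s<..T}. \<bar>r - s\<bar> < d \<longrightarrow> q r \<in> U" if U: "open U" "?l \<in> U" for U
        proof -
          obtain b where "b > s" "\<And>r. s < r \<Longrightarrow> r < b \<Longrightarrow> q r \<in> U"
            using topological_tendstoD[OF right_lim_tendsto[OF qBV s(1) sT] U] unfolding eventually_at_right_field by blast
          then show ?thesis by (intro exI[of _ "b - s"]) auto
        qed
        have sub: "{s<..T} \<subseteq> {0..T}" using s by auto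
        obtain d where d: "d > 0" "\<And>r r' p. r \<in> {s<..T} \<Longrightarrow> r' \<in> {s<..T} \<Longrightarrow> \<bar>r - s\<bar> < d \<Longrightarrow> \<bar>r' - s\<bar> < d \<Longrightarrow> p = ?l \<or> p = q r' \<Longrightarrow>
           \<bar>dtE r (q r) - dtE r p\<bar> \<le> e"
          by (rule power_difference_small[OF s(3) e near]) (assumption | rule sub that)+
        have "\<Psi> s - \<Psi> b \<le> e * (b - s)" if b: "b \<in> {0..T}" "s \<le> b" "b - s < d" for b
        proof (cases "b = s")
          case False
          then have sb: "s < b" using b by simp
          \<comment> \<open>After \<open>s\<close> the power is frozen at q b, which is close to q r
            for s < r < b. Testing stability of q s against q b includes the jump at
            \<open>s\<close> in the increment of \<open>V q\<close>.\<close>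
          have "(power_integral q b - power_integral q s) - (E b (q b) - E s (q b)) \<le> e * (b - s)"
          proof (rule power_difference_le[OF qBV])
            fix r assume "s < r" "r < b"
            then show "\<bar>dtE r (q r) - dtE r (q b)\<bar> \<le> e" by (intro d(2)[of r b]) (use b in auto)
          qed (use b sb s in auto)
          moreover have "E s (q s) \<le> E s (q b) + dissip_dist (q s) (q b)" using st[OF s(3)] by (simp add: stable_def)
          moreover have "dissip_dist (q s) (q b) \<le> V q b - V q s" by (rule V_increment[OF qBV]) (use b s in auto)
          ultimately show ?thesis by (simp add: \<Psi>_def)
        qed simp
        then show ?thesis using d(1) by blast
      qed
      then obtain d2 where d2: "d2 > 0" "\<And>b. b \<in> {0..T} \<Longrightarrow> s \<le> b \<Longrightarrow> b - s < d2 \<Longrightarrow> \<Psi> s - \<Psi> b \<le> e * (b - s)" by blast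
      show "\<exists>d>0. \<forall>a b. a \<le> s \<and> s \<le> b \<and> b - a < d \<longrightarrow> Q a b"
      proof (rule exI[of _ "min d1 d2"], intro conjI allI impI)
        fix a b assume ab: "a \<le> s \<and> s \<le> b \<and> b - a < min d1 d2"
        show "Q a b" unfolding Q_def
        proof
          assume ab': "u \<le> a \<and> a \<le> b \<and> b \<le> w"
          have "\<Psi> a - \<Psi> s \<le> e * (s - a)" by (rule d1(2)) (use ab ab' uw in auto)
          moreover have "\<Psi> s - \<Psi> b \<le> e * (b - s)" by (rule d2(2)) (use ab ab' uw in auto)
          ultimately show "\<Psi> a - \<Psi> b \<le> e * (b - a)" by (simp add: algebra_simps)
        qed
      qed (use d1 d2 in auto)
    qed
    then show ?thesis using uw by (simp add: Q_def)
  qed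
  have lower: "E 0 (q 0) + power_integral q t \<le> E t (q t) + V q t" if t: "t \<in> {0..T}" for t
  proof -
    have "((\<lambda>e. e * (t - 0)) \<longlongrightarrow> 0 * (t - 0)) (at_right 0)" by (intro tendsto_intros)
    moreover have "eventually (\<lambda>e. \<Psi> 0 - \<Psi> t \<le> e * (t - 0)) (at_right 0)"
      unfolding eventually_at_right_field using mono[of 0 t] t by (intro exI[of _ 1]) auto
    ultimately have "\<Psi> 0 - \<Psi> t \<le> 0 * (t - 0)" by (rule tendsto_lowerbound) simp
    then show ?thesis using V_0[OF qBV] power_integral_0[OF qBV] by (simp add: \<Psi>_def)
  qed
  show ?thesis unfolding energetic_solution_iff[OF qBV]
    using st upper lower by (auto intro: antisym)
qed

end

end

theorem proposition5p3:
  fixes atlas :: "('q::{t2_space, second_countable_topology}, 'e::euclidean_space) chart set"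
    and R1 :: "'q \<Rightarrow> ('q, 'e) tvec \<Rightarrow> real"
    and T :: real
    and E :: "real \<Rightarrow> 'q \<Rightarrow> real"
    and q :: "real \<Rightarrow> 'q"
  assumes "rate_independent_system atlas R1 T E"
    and "q \<in> rate_independent_system.BV atlas R1 T"
  shows
    "(rate_independent_system.energetic_solution atlas R1 T E q \<longrightarrow>
       (rate_independent_system.BV_solution atlas R1 T E q \<longleftrightarrow>
         (\<forall>t\<in>rate_independent_system.jump_set T q.
            rate_independent_system.optimal_jump atlas R1 T E q t)))
     \<and>
     (rate_independent_system.BV_solution atlas R1 T E q \<and>
       (\<forall>t\<in>{0..T}. rate_independent_system.global_slope atlas R1 E t (q t)
          \<le> ereal (max 1 (rate_independent_system.slope atlas R1 E t (q t)))) \<and>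
       rate_independent_system.global_slope atlas R1 E 0 (q 0) \<le> 1
      \<longrightarrow> rate_independent_system.energetic_solution atlas R1 T E q)"
proof -
  interpret rate_independent_system atlas R1 T E by (rule assms(1))
  have A: "energetic_solution q \<longrightarrow> (BV_solution q \<longleftrightarrow> (\<forall>t\<in>jump_set q. optimal_jump q t))"
  proof (intro impI iffI)
    assume "BV_solution q"
    then show "\<forall>t\<in>jump_set q. optimal_jump q t" unfolding BV_solution_def by (elim conjE)
  next
    assume "energetic_solution q" "\<forall>t\<in>jump_set q. optimal_jump q t"
    then show "BV_solution q" by (rule energetic_imp_BV_solution[OF assms(2)])
  qed
  have B: "BV_solution q \<and> (\<forall>t\<in>{0..T}. global_slope t (q t) \<le> ereal (max 1 (slope t (q t)))) \<and>
      global_slope 0 (q 0) \<le> 1 \<longrightarrow> energetic_solution q"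
    by (intro impI, elim conjE) (rule BV_solution_imp_energetic[OF assms(2)])
  show ?thesis by (rule conjI[OF A B])
qed

end
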